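(* The monodromy groups of the trees with the following passports (each determining exactly two trees) are, up to isomorphism, as follows, where $\rtimes$ denotes some semidirect product. (1) $[3^2,1;2^2,1^3;7]$: both trees have monodromy group $\mathrm{PSL}(3,2)$. (2) $[3,2^2;2^2,1^3;7]$: both trees have monodromy group $A_7$. (3) $[3^2,1^3;2^4,1;9]$: both trees have monodromy group $\mathrm{PSL}(2,8)\rtimes\mathbb{Z}_3$. (4) $[3,2^2,1^3;2^5;10]$: one tree has monodromy group $(A_5\times A_5)\rtimes(\mathbb{Z}_2\times\mathbb{Z}_2)$ and the other $(A_5\times A_5)\rtimes\mathbb{Z}_2$. (5) $[4^3,1^8;2^{10};20]$: one tree has monodromy group $\mathbb{Z}_2^8\rtimes((A_5\times A_5)\rtimes D_8)$ and the other $(A_{10}\times A_{10})\rtimes D_8$. (6) $[5^3,1^{11};2^{13};26]$: both trees have monodromy group $(A_{13}\times A_{13})\rtimes\mathbb{Z}_2$.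
   Context: A tree is a bicolored (black/white) plane tree, up to color- and orientation-preserving isomorphism. The passport $[\alpha;\beta;n]$ of a tree with $n$ edges records the partition $\alpha\vdash n$ of black vertex degrees and $\beta\vdash n$ of white vertex degrees ($k^m$ means $k$ repeated $m$ times). Label the edges by $1,\dots,n$; let $\sigma_0\in S_n$ (resp. $\sigma_1$) be the permutation whose cycles are the cyclic orders of edges around the black (resp. white) vertices. The monodromy group is $\langle\sigma_0,\sigma_1\rangle\le S_n$ (well defined up to conjugacy). $A_m$ is the alternating group, $\mathbb{Z}_m$ the cyclic group of order $m$, and $D_8$ the dihedral group of order $8$. *)

theory Defs
  imports
    "HOL-Analysis.Analysis"
    "HOL-Algebra.Algebra"
    "HOL-Library.Multiset"
    "HOL-Library.Z2"
begin

section \<open>Bicolored plane trees\<close>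

text \<open>
  A bicolored plane tree with labelled edges \<open>1, \<dots>, n\<close>, given as a rotation system: each edge has
  a black and a white end, and \<open>black_rot\<close> (\<open>white_rot\<close>) sends an edge to the next one in the
  cyclic (say, counterclockwise) order around its black (white) end. Every rotation system on a
  tree comes from a plane embedding, unique up to orientation-preserving homeomorphism.
\<close>

record labelled_tree =
  num_edges :: nat
  black :: "nat set"
  white :: "nat set"
  black_end :: "nat \<Rightarrow> nat"
  white_end :: "nat \<Rightarrow> nat"
  black_rot :: "nat \<Rightarrow> nat"
  white_rot :: "nat \<Rightarrow> nat"

definition edges :: "labelled_tree \<Rightarrow> nat set" where
  "edges T = {1..num_edges T}"

definition vertices :: "labelled_tree \<Rightarrow> nat set" where
  "vertices T = black T \<union> white T"

definition adjacency :: "labelled_tree \<Rightarrow> (nat \<times> nat) set" where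
  "adjacency T = {(u, v). \<exists>e\<in>edges T. {u, v} = {black_end T e, white_end T e}}"

definition connected_graph :: "labelled_tree \<Rightarrow> bool" where
  "connected_graph T \<longleftrightarrow>
     vertices T \<noteq> {} \<and> (\<forall>u\<in>vertices T. \<forall>v\<in>vertices T. (u, v) \<in> (adjacency T)\<^sup>*)"

text \<open>
  The edge \<open>es ! i\<close> joins \<open>vs ! i\<close> to the cyclically next vertex. A cycle of length two is a pair of
  parallel edges, so these are excluded by acyclicity.
\<close>

definition acyclic_graph :: "labelled_tree \<Rightarrow> bool" where
  "acyclic_graph T \<longleftrightarrow>
     \<not> (\<exists>vs es. vs \<noteq> [] \<and> length es = length vs \<and> distinct vs \<and> distinct es \<and> set es \<subseteq> edges T \<and>
          (\<forall>i<length es. {black_end T (es ! i), white_end T (es ! i)} =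
                         {vs ! i, vs ! (Suc i mod length vs)}))"

definition is_rotation :: "nat set \<Rightarrow> (nat \<Rightarrow> nat) \<Rightarrow> (nat \<Rightarrow> nat) \<Rightarrow> bool" where
  "is_rotation E endp r \<longleftrightarrow>
     r permutes E \<and> (\<forall>e\<in>E. \<forall>e'\<in>E. endp e = endp e' \<longleftrightarrow> (\<exists>k. (r ^^ k) e = e'))"

definition plane_tree :: "labelled_tree \<Rightarrow> bool" where
  "plane_tree T \<longleftrightarrow>
     finite (black T) \<and> finite (white T) \<and> black T \<inter> white T = {} \<and>
     black_end T ` edges T \<subseteq> black T \<and> white_end T ` edges T \<subseteq> white T \<and>
     connected_graph T \<and> acyclic_graph T \<and>
     is_rotation (edges T) (black_end T) (black_rot T) \<and>
     is_rotation (edges T) (white_end T) (white_rot T)"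

definition tree_isomorphic :: "labelled_tree \<Rightarrow> labelled_tree \<Rightarrow> bool" where
  "tree_isomorphic S T \<longleftrightarrow>
     (\<exists>\<phi> f. bij_betw \<phi> (edges S) (edges T) \<and>
            bij_betw f (black S) (black T) \<and> bij_betw f (white S) (white T) \<and>
            (\<forall>e\<in>edges S.
               black_end T (\<phi> e) = f (black_end S e) \<and> white_end T (\<phi> e) = f (white_end S e) \<and>
               black_rot T (\<phi> e) = \<phi> (black_rot S e) \<and> white_rot T (\<phi> e) = \<phi> (white_rot S e)))"

definition isomorphism_relation :: "(labelled_tree \<times> labelled_tree) set" where
  "isomorphism_relation = {(S, T). plane_tree S \<and> plane_tree T \<and> tree_isomorphic S T}"

definition black_degrees :: "labelled_tree \<Rightarrow> nat multiset" where
  "black_degrees T = image_mset (\<lambda>v. card {e \<in> edges T. black_end T e = v}) (mset_set (black T))"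

definition white_degrees :: "labelled_tree \<Rightarrow> nat multiset" where
  "white_degrees T = image_mset (\<lambda>v. card {e \<in> edges T. white_end T e = v}) (mset_set (white T))"

definition passport :: "labelled_tree \<Rightarrow> nat multiset \<times> nat multiset \<times> nat" where
  "passport T = (black_degrees T, white_degrees T, num_edges T)"

text \<open>
  The set of trees with passport \<open>[\<alpha>; \<beta>; n]\<close>. A tree is an isomorphism class of labelled trees; its
  elements are all labellings of all its representatives with vertices taken from \<open>nat\<close>.
\<close>

definition trees :: "nat multiset \<Rightarrow> nat multiset \<Rightarrow> nat \<Rightarrow> labelled_tree set set" where
  "trees \<alpha> \<beta> n = {T. plane_tree T \<and> passport T = (\<alpha>, \<beta>, n)} // isomorphism_relation"

definition monodromy_group :: "labelled_tree \<Rightarrow> (nat \<Rightarrow> nat) monoid" where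
  "monodromy_group T = subgroup_generated (sym_group (num_edges T)) {black_rot T, white_rot T}"


section \<open>Groups\<close>

definition semidirect_product ::
  "('a, 'm) monoid_scheme \<Rightarrow> ('b, 'l) monoid_scheme \<Rightarrow> ('b \<Rightarrow> 'a \<Rightarrow> 'a) \<Rightarrow> ('a \<times> 'b) monoid" where
  "semidirect_product N H \<theta> =
     \<lparr>carrier = carrier N \<times> carrier H,
      monoid.mult = (\<lambda>(a, h) (b, k). (a \<otimes>\<^bsub>N\<^esub> \<theta> h b, h \<otimes>\<^bsub>H\<^esub> k)),
      one = (\<one>\<^bsub>N\<^esub>, \<one>\<^bsub>H\<^esub>)\<rparr>"

definition is_some_semidirect_product ::
  "('g, 'n) monoid_scheme \<Rightarrow> ('a, 'm) monoid_scheme \<Rightarrow> ('b, 'l) monoid_scheme \<Rightarrow> bool" where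
  "is_some_semidirect_product G N H \<longleftrightarrow>
     (\<exists>\<theta>\<in>hom H (AutoGroup N). G \<cong> semidirect_product N H \<theta>)"

text \<open>The dihedral group of order \<open>2 * m\<close>; elements of \<open>AutoGroup\<close> are extensional functions.\<close>

definition dihedral_group :: "nat \<Rightarrow> (int \<times> int) monoid" where
  "dihedral_group m =
     semidirect_product (integer_mod_group m) (integer_mod_group 2)
       (\<lambda>h. \<lambda>a\<in>carrier (integer_mod_group m). if h = 0 then a else inv\<^bsub>integer_mod_group m\<^esub> a)"

definition group_center :: "('a, 'm) monoid_scheme \<Rightarrow> 'a set" where
  "group_center G = {z \<in> carrier G. \<forall>x\<in>carrier G. z \<otimes>\<^bsub>G\<^esub> x = x \<otimes>\<^bsub>G\<^esub> z}"

definition SL :: "('k::field ^ 'n ^ 'n) monoid" where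
  "SL = \<lparr>carrier = {A. det A = 1}, monoid.mult = (**), one = mat 1\<rparr>"

definition PSL :: "('k::field ^ 'n ^ 'n) set monoid" where
  "PSL = SL Mod group_center SL"


section \<open>The field with eight elements\<close>

text \<open>
  The quotient of \<open>GF(2)[x]\<close> by the irreducible polynomial \<open>x ^ 3 + x + 1\<close>;
  \<open>GF8 a b c\<close> is the class of \<open>a + b * x + c * x ^ 2\<close>.
\<close>

datatype gf8 = GF8 bit bit bit

instantiation gf8 :: field
begin

definition zero_gf8 :: gf8 where "0 = GF8 0 0 0"

definition one_gf8 :: gf8 where "1 = GF8 1 0 0"

fun plus_gf8 :: "gf8 \<Rightarrow> gf8 \<Rightarrow> gf8" where
  "GF8 a b c + GF8 a' b' c' = GF8 (a + a') (b + b') (c + c')"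

definition uminus_gf8 :: "gf8 \<Rightarrow> gf8" where "- x = (x :: gf8)"

definition minus_gf8 :: "gf8 \<Rightarrow> gf8 \<Rightarrow> gf8" where "x - y = x + (y :: gf8)"

text \<open>From \<open>x ^ 3 = x + 1\<close> and \<open>x ^ 4 = x ^ 2 + x\<close>.\<close>

fun times_gf8 :: "gf8 \<Rightarrow> gf8 \<Rightarrow> gf8" where
  "GF8 a b c * GF8 a' b' c' =
     GF8 (a * a' + (b * c' + c * b'))
         (a * b' + b * a' + (b * c' + c * b') + c * c')
         (a * c' + b * b' + c * a' + c * c')"

definition inverse_gf8 :: "gf8 \<Rightarrow> gf8" where
  "inverse x = x * x * (x * x) * (x * (x :: gf8))"

definition divide_gf8 :: "gf8 \<Rightarrow> gf8 \<Rightarrow> gf8" where "x div y = x * inverse (y :: gf8)"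

instance
proof
  have all_bit: "(\<forall>x. P x) \<longleftrightarrow> P 0 \<and> P 1" for P :: "bit \<Rightarrow> bool"
    by (metis bit.exhaust)
  have all_gf8: "(\<forall>x. P x) \<longleftrightarrow> (\<forall>a b c. P (GF8 a b c))" for P :: "gf8 \<Rightarrow> bool"
    by (metis gf8.exhaust)
  fix a b c :: gf8
  have "\<forall>a b c :: gf8. a * b * c = a * (b * c)"
    by (simp add: all_gf8 all_bit)
  then show "a * b * c = a * (b * c)" by blast
  have "\<forall>a b :: gf8. a * b = b * a"
    by (simp add: all_gf8 all_bit)
  then show "a * b = b * a" by blast
  show "1 * a = a"
    by (cases a) (simp add: one_gf8_def)
  have "\<forall>a b c :: gf8. a + b + c = a + (b + c)"
    by (simp add: all_gf8 all_bit)
  then show "a + b + c = a + (b + c)" by blast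
  have "\<forall>a b :: gf8. a + b = b + a"
    by (simp add: all_gf8 all_bit)
  then show "a + b = b + a" by blast
  show "0 + a = a"
    by (cases a) (simp add: zero_gf8_def)
  show "- a + a = 0"
    by (cases a) (simp add: zero_gf8_def uminus_gf8_def)
  show "a - b = a + - b"
    by (simp add: minus_gf8_def uminus_gf8_def)
  have "\<forall>a b c :: gf8. (a + b) * c = a * c + b * c"
    by (simp add: all_gf8 all_bit)
  then show "(a + b) * c = a * c + b * c" by blast
  show "(0 :: gf8) \<noteq> 1"
    by (simp add: zero_gf8_def one_gf8_def)
  show "a div b = a * inverse b"
    by (simp add: divide_gf8_def)
  show "inverse (0 :: gf8) = 0"
    by (simp add: inverse_gf8_def zero_gf8_def)
  show "inverse a * a = 1" if "a \<noteq> 0"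
  proof (cases a)
    case (GF8 x y z)
    with that show ?thesis
      by (cases x; cases y; cases z) (simp_all add: inverse_gf8_def zero_gf8_def one_gf8_def)
  qed
qed

end

end

theory Submission
  imports Defs
begin

text \<open>A plane tree is determined by the word of vertex degrees read along a closed depth-first walk, so
  two trees are isomorphic iff the sets of words read from all edges agree, and the trees with a given
  passport are found by running through the finitely many admissible words. This leaves two trees in
  each case, given by explicit permutations.

  The two generators are then shown to lie in a concrete group: the linear group of
  \<open>GF(2)\<^sup>3\<close>, the alternating group, the semilinear group of the projective line over \<open>GF(8)\<close>, a wreath
  product with two blocks, or a group of signed permutations. Conversely, straight-line programs in
  the generators produce elements that generate this group, mostly three-cycles supported in one block:
  linked three-cycles generate the alternating group of the points they move.\<close>

text \<open>In the last three passports all white degrees are 2, so the tree is an ordinary plane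
  tree whose edges are halved by white midpoints. Two-colouring the vertices of that tree splits the
  half-edges into two equal blocks, preserved by the black rotation and exchanged by the white one;
  hence the wreath products. Within this frame the group depends on the parities of the black
  rotation on the two blocks. The exception is the first tree of case 5: its half-turn symmetry
  commutes with both rotations, so its edges fall into pairs and signed permutations appear. In
  cases 1 and 3 the two trees are mirror images and one computation serves both.

  The groups are far too large to enumerate, and every computation is carried out by rewriting.
  Therefore nothing is searched for or counted inside the proof: it checks certificates, namely an
  edge from which each word is read, square roots that witness even parity, and lists of products
  leading to particular elements. The edge labels are chosen to suit these checks, for instance as
  codes of vectors or of points of a projective line.\<close>

definition end_of :: "labelled_tree \<Rightarrow> bool \<Rightarrow> nat \<Rightarrow> nat" where
  "end_of T c = (if c then white_end T else black_end T)"

definition rot_of :: "labelled_tree \<Rightarrow> bool \<Rightarrow> nat \<Rightarrow> nat" where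
  "rot_of T c = (if c then white_rot T else black_rot T)"

definition side :: "labelled_tree \<Rightarrow> bool \<Rightarrow> nat set" where
  "side T c = (if c then white T else black T)"

lemma ends_end_of: "{black_end T e, white_end T e} = {end_of T c e, end_of T (\<not> c) e}"
  by (cases c) (auto simp: end_of_def)

lemma finite_edges [simp]: "finite (edges T)" and card_edges [simp]: "card (edges T) = num_edges T"
  by (simp_all add: edges_def)

lemma plane_tree_end_of:
  assumes "plane_tree T" "e \<in> edges T"
  shows "end_of T c e \<in> side T c"
  using assms by (auto simp: plane_tree_def end_of_def side_def)

lemma plane_tree_end_vertex:
  assumes "plane_tree T" "e \<in> edges T"
  shows "end_of T c e \<in> vertices T"
  using plane_tree_end_of[OF assms, of c] by (auto simp: side_def vertices_def split: if_splits)

lemma plane_tree_side_disjoint: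
  assumes "plane_tree T" shows "side T c \<inter> side T (\<not> c) = {}"
  using assms by (cases c) (auto simp: plane_tree_def side_def)

lemma plane_tree_end_of_eq:
  assumes "plane_tree T" "e \<in> edges T" "f \<in> edges T" "end_of T c e = end_of T c' f"
  shows "c = c'"
proof (rule ccontr)
  assume "c \<noteq> c'"
  then have "c' = (\<not> c)" by auto
  then show False
    using plane_tree_end_of[OF assms(1,2), of c] plane_tree_end_of[OF assms(1,3), of "\<not> c"]
      plane_tree_side_disjoint[OF assms(1), of c] assms(4) by auto
qed

lemma plane_tree_rot_of:
  assumes "plane_tree T"
  shows "rot_of T c permutes edges T"
    and "\<And>e e'. e \<in> edges T \<Longrightarrow> e' \<in> edges T \<Longrightarrow>
      end_of T c e = end_of T c e' \<longleftrightarrow> (\<exists>k. (rot_of T c ^^ k) e = e')"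
  using assms by (auto simp: plane_tree_def is_rotation_def rot_of_def end_of_def)

lemma plane_tree_connected:
  assumes T: "plane_tree T" and Z: "Z \<subseteq> vertices T" "Z \<noteq> {}"
    and closed: "\<And>c e. e \<in> edges T \<Longrightarrow> end_of T c e \<in> Z \<Longrightarrow> end_of T (\<not> c) e \<in> Z"
  shows "Z = vertices T"
proof -
  obtain u where u: "u \<in> Z" using Z by auto
  have "v \<in> Z" if "(u, v) \<in> (adjacency T)\<^sup>*" for v
    using that
  proof (induction rule: rtrancl_induct)
    case (step y z)
    then obtain e where e: "e \<in> edges T" "{y, z} = {black_end T e, white_end T e}"
      by (auto simp: adjacency_def)
    then have "(y = end_of T False e \<and> z = end_of T True e) \<or>
               (y = end_of T True e \<and> z = end_of T False e)"
      by (auto simp: end_of_def doubleton_eq_iff)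
    then show ?case using closed[OF e(1), of True] closed[OF e(1), of False] step.IH by auto
  qed (fact u)
  moreover have "(u, v) \<in> (adjacency T)\<^sup>*" if "v \<in> vertices T" for v
    using T Z(1) u that by (auto simp: plane_tree_def connected_graph_def)
  ultimately show ?thesis using Z(1) by auto
qed

text \<open>Rotation orbits are exactly the sets of edges at a vertex. So a set closed under both
  rotations contains every edge sharing an end with a member; its set of ends is then closed under
  crossing edges, and connectivity applies.\<close>

lemma plane_tree_transitive:
  assumes T: "plane_tree T" and Z: "Z \<subseteq> edges T" "Z \<noteq> {}"
    and closed: "\<And>c e. e \<in> Z \<Longrightarrow> rot_of T c e \<in> Z"
  shows "Z = edges T"
proof -
  have orbit: "(rot_of T c ^^ k) e \<in> Z" if "e \<in> Z" for c k e
    using that by (induction k) (auto intro: closed)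
  have same: "f \<in> Z" if "e \<in> Z" "f \<in> edges T" "end_of T c e = end_of T c f" for c e f
    using that plane_tree_rot_of(2)[OF T, of e f c] Z orbit by blast
  let ?V = "{end_of T c e | c e. e \<in> Z}"
  have V: "?V = vertices T"
  proof (rule plane_tree_connected[OF T])
    show "?V \<subseteq> vertices T"
      using plane_tree_end_vertex[OF T] Z by auto
    show "?V \<noteq> {}" using Z by auto
  next
    fix c e assume e: "e \<in> edges T" "end_of T c e \<in> ?V"
    then obtain c' f where f: "f \<in> Z" "end_of T c e = end_of T c' f" by auto
    then have "c = c'" using plane_tree_end_of_eq[OF T e(1), of f] Z by auto
    then have "end_of T c f = end_of T c e" using f(2) by simp
    then have "e \<in> Z" by (rule same[OF f(1) e(1)])
    then show "end_of T (\<not> c) e \<in> ?V" by auto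
  qed
  have "e \<in> Z" if e: "e \<in> edges T" for e
  proof -
    have "end_of T True e \<in> ?V"
      unfolding V by (rule plane_tree_end_vertex[OF T e])
    then obtain c f where f: "f \<in> Z" "end_of T True e = end_of T c f" by auto
    then have "c" using plane_tree_end_of_eq[OF T e, of f True c] Z by auto
    then have "end_of T True f = end_of T True e" using f(2) by simp
    then show ?thesis by (rule same[OF f(1) e])
  qed
  then show ?thesis using Z by auto
qed

section \<open>Isomorphisms of plane trees as equivariant bijections\<close>

text \<open>The vertex map of an isomorphism is left out: it can be recovered from
  \<open>\<phi>\<close>, because vertices are rotation orbits.\<close>

definition rot_iso :: "labelled_tree \<Rightarrow> labelled_tree \<Rightarrow> (nat \<Rightarrow> nat) \<Rightarrow> bool" where
  "rot_iso S T \<phi> \<longleftrightarrow> bij_betw \<phi> (edges S) (edges T) \<and>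
     (\<forall>c. \<forall>e\<in>edges S. rot_of T c (\<phi> e) = \<phi> (rot_of S c e))"

lemma rot_iso_funpow:
  assumes "plane_tree S" "rot_iso S T \<phi>" "e \<in> edges S"
  shows "(rot_of T c ^^ k) (\<phi> e) = \<phi> ((rot_of S c ^^ k) e)"
    and "(rot_of S c ^^ k) e \<in> edges S"
proof -
  have m: "(rot_of S c ^^ k) e \<in> edges S" for k
    using assms(3) plane_tree_rot_of(1)[OF assms(1), of c] by (induction k) (auto simp: permutes_in_image)
  then show "(rot_of S c ^^ k) e \<in> edges S" .
  show "(rot_of T c ^^ k) (\<phi> e) = \<phi> ((rot_of S c ^^ k) e)"
    using assms(2) m by (induction k) (auto simp: rot_iso_def)
qed

text \<open>Without edges the tree could be a single isolated vertex, hence the assumption;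
  otherwise connectivity leaves no isolated vertex.\<close>

lemma plane_tree_side_image:
  assumes T: "plane_tree T" and n: "num_edges T \<noteq> 0"
  shows "end_of T c ` edges T = side T c"
proof -
  let ?V = "{end_of T c e | c e. e \<in> edges T}"
  have "?V = vertices T"
  proof (rule plane_tree_connected[OF T])
    show "?V \<subseteq> vertices T"
      using plane_tree_end_vertex[OF T] by auto
    show "?V \<noteq> {}" using n by (auto simp: edges_def)
  qed auto
  then have "v \<in> end_of T c ` edges T" if "v \<in> side T c" for v
  proof -
    have "v \<in> ?V"
      using that \<open>?V = vertices T\<close> by (auto simp: vertices_def side_def split: if_splits)
    then obtain c' e where e: "v = end_of T c' e" "e \<in> edges T" by auto
    then have "v \<in> side T c'" using plane_tree_end_of[OF T] by auto
    with that have "c' = c"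
      using plane_tree_side_disjoint[OF T, of c] by (cases "c' = c") auto
    with e show ?thesis by auto
  qed
  then show ?thesis using plane_tree_end_of[OF T] by auto
qed

text \<open>Since \<open>\<phi>\<close> carries rotation orbits to rotation orbits, two edges meet
  in S iff their images meet in T. This defines a vertex map for either colour, and the two maps
  glue because no vertex has both colours.\<close>

lemma tree_isomorphic_iff:
  assumes S: "plane_tree S" and T: "plane_tree T" and n: "num_edges S \<noteq> 0"
  shows "tree_isomorphic S T \<longleftrightarrow> (\<exists>\<phi>. rot_iso S T \<phi>)"
proof
  assume "tree_isomorphic S T"
  then obtain \<phi> f where "bij_betw \<phi> (edges S) (edges T)" "\<forall>e\<in>edges S.
      black_end T (\<phi> e) = f (black_end S e) \<and> white_end T (\<phi> e) = f (white_end S e) \<and>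
      black_rot T (\<phi> e) = \<phi> (black_rot S e) \<and> white_rot T (\<phi> e) = \<phi> (white_rot S e)"
    unfolding tree_isomorphic_def by blast
  then have "rot_iso S T \<phi>" by (simp add: rot_iso_def rot_of_def)
  then show "\<exists>\<phi>. rot_iso S T \<phi>" by blast
next
  assume "\<exists>\<phi>. rot_iso S T \<phi>"
  then obtain \<phi> where \<phi>: "rot_iso S T \<phi>" by auto
  then have bij: "bij_betw \<phi> (edges S) (edges T)" by (simp add: rot_iso_def)
  then have nT: "num_edges T \<noteq> 0"
    using n by (metis bij_betw_same_card card_edges)
  have \<phi>E: "\<phi> e \<in> edges T" if "e \<in> edges S" for e
    using bij that by (auto simp: bij_betw_def)
  have ends: "end_of T c (\<phi> e) = end_of T c (\<phi> e') \<longleftrightarrow> end_of S c e = end_of S c e'"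
    if "e \<in> edges S" "e' \<in> edges S" for c e e'
  proof -
    have "end_of T c (\<phi> e) = end_of T c (\<phi> e') \<longleftrightarrow> (\<exists>k. \<phi> ((rot_of S c ^^ k) e) = \<phi> e')"
      using plane_tree_rot_of(2)[OF T \<phi>E \<phi>E] that by (simp add: rot_iso_funpow[OF S \<phi>])
    also have "\<dots> \<longleftrightarrow> (\<exists>k. (rot_of S c ^^ k) e = e')"
      using bij that rot_iso_funpow(2)[OF S \<phi>] by (auto simp: bij_betw_def inj_on_eq_iff)
    also have "\<dots> \<longleftrightarrow> end_of S c e = end_of S c e'"
      using plane_tree_rot_of(2)[OF S] that by simp
    finally show ?thesis .
  qed
  \<comment> \<open>Any edge at \<open>v\<close> serves: by \<open>ends\<close> the value does not
    depend on the choice.\<close>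
  define g where "g c v = end_of T c (\<phi> (SOME e. e \<in> edges S \<and> end_of S c e = v))" for c v
  have g: "g c (end_of S c e) = end_of T c (\<phi> e)" if "e \<in> edges S" for c e
  proof -
    let ?e = "SOME f. f \<in> edges S \<and> end_of S c f = end_of S c e"
    have "?e \<in> edges S \<and> end_of S c ?e = end_of S c e" using that by (metis (mono_tags, lifting) someI_ex)
    then show ?thesis using ends that by (simp add: g_def)
  qed
  have gbij: "bij_betw (g c) (side S c) (side T c)" for c
    unfolding bij_betw_def
  proof
    show "inj_on (g c) (side S c)"
      unfolding plane_tree_side_image[OF S n, symmetric]
      by (rule inj_onI) (auto simp: g ends)
    have "g c ` end_of S c ` edges S = end_of T c ` \<phi> ` edges S"
      unfolding image_image using g by (intro image_cong) auto
    then show "g c ` side S c = side T c"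
      using bij by (simp add: plane_tree_side_image[OF S n] plane_tree_side_image[OF T nT] bij_betw_def)
  qed
  define f where "f v = (if v \<in> white S then g True v else g False v)" for v
  have disj: "black S \<inter> white S = {}" using S by (simp add: plane_tree_def)
  have fb: "f v = g False v" if "v \<in> black S" for v using that disj by (auto simp: f_def)
  have fw: "f v = g True v" if "v \<in> white S" for v using that by (auto simp: f_def)
  have ft: "bij_betw f (white S) (white T)"
    using gbij[of True] bij_betw_cong[of "white S" f "g True" "white T"] fw by (simp add: side_def)
  moreover have ff: "bij_betw f (black S) (black T)"
    using gbij[of False] bij_betw_cong[of "black S" f "g False" "black T"] fb by (simp add: side_def)
  moreover have "black_end T (\<phi> e) = f (black_end S e) \<and> white_end T (\<phi> e) = f (white_end S e) \<and>
      black_rot T (\<phi> e) = \<phi> (black_rot S e) \<and> white_rot T (\<phi> e) = \<phi> (white_rot S e)"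
    if e: "e \<in> edges S" for e
  proof -
    have "black_end S e \<in> black S" "white_end S e \<in> white S"
      using S e by (auto simp: plane_tree_def)
    moreover have "rot_of T c (\<phi> e) = \<phi> (rot_of S c e)" for c using \<phi> e by (simp add: rot_iso_def)
    from this[of True] this[of False] show ?thesis
      using g[OF e, of True] g[OF e, of False] fb fw calculation by (simp add: end_of_def rot_of_def)
  qed
  ultimately show "tree_isomorphic S T"
    unfolding tree_isomorphic_def using bij by (intro exI[of _ \<phi>] exI[of _ f] conjI ballI) simp_all
qed

lemma rot_iso_sym:
  assumes S: "plane_tree S" and \<phi>: "rot_iso S T \<phi>"
  shows "rot_iso T S (inv_into (edges S) \<phi>)"
proof -
  have bij: "bij_betw \<phi> (edges S) (edges T)" using \<phi> by (simp add: rot_iso_def)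
  have "rot_of S c (inv_into (edges S) \<phi> e) = inv_into (edges S) \<phi> (rot_of T c e)"
    if "e \<in> edges T" for c e
  proof -
    have "e \<in> \<phi> ` edges S" using that bij_betw_imp_surj_on[OF bij] by simp
    then obtain x where x: "x \<in> edges S" "e = \<phi> x" by blast
    have "rot_of S c x \<in> edges S"
      using x plane_tree_rot_of(1)[OF S] by (simp add: permutes_in_image)
    moreover have "rot_of T c e = \<phi> (rot_of S c x)" using \<phi> x by (simp add: rot_iso_def)
    ultimately show ?thesis using x bij by (simp add: bij_betw_def)
  qed
  then show ?thesis using bij by (simp add: rot_iso_def bij_betw_inv_into)
qed

lemma rot_iso_trans:
  assumes "rot_iso S T \<phi>" "rot_iso T U \<psi>"
  shows "rot_iso S U (\<psi> \<circ> \<phi>)"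
proof -
  have \<phi>: "bij_betw \<phi> (edges S) (edges T)" and \<psi>: "bij_betw \<psi> (edges T) (edges U)"
    using assms by (simp_all add: rot_iso_def)
  have "\<phi> e \<in> edges T" if "e \<in> edges S" for e using bij_betw_imp_surj_on[OF \<phi>] that by blast
  then show ?thesis
    using assms bij_betw_trans[OF \<phi> \<psi>] by (simp add: rot_iso_def)
qed

lemma trees_eq_pair:
  assumes n: "n \<noteq> 0"
    and S: "plane_tree S" "passport S = (\<alpha>, \<beta>, n)"
    and S': "plane_tree S'" "passport S' = (\<alpha>, \<beta>, n)"
    and noniso: "\<And>\<phi>. \<not> rot_iso S S' \<phi>"
    and all: "\<And>T. plane_tree T \<Longrightarrow> passport T = (\<alpha>, \<beta>, n) \<Longrightarrow> \<exists>\<phi>. rot_iso S T \<phi> \<or> rot_iso S' T \<phi>"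
  defines "C \<equiv> isomorphism_relation `` {S}" and "C' \<equiv> isomorphism_relation `` {S'}"
  shows "trees \<alpha> \<beta> n = {C, C'}" "C \<noteq> C'"
    and "\<And>T. T \<in> C \<Longrightarrow> plane_tree T \<and> (\<exists>\<phi>. rot_iso S T \<phi>)"
    and "\<And>T. T \<in> C' \<Longrightarrow> plane_tree T \<and> (\<exists>\<phi>. rot_iso S' T \<phi>)"
proof -
  have rel: "isomorphism_relation `` {V} = {Y. plane_tree Y \<and> (\<exists>\<phi>. rot_iso V Y \<phi>)}"
    if "plane_tree V" "passport V = (\<alpha>, \<beta>, n)" for V
  proof -
    have "num_edges V \<noteq> 0" using that n by (simp add: passport_def)
    from tree_isomorphic_iff[OF that(1) _ this] that(1) show ?thesis
      by (auto simp: isomorphism_relation_def)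
  qed
  have cls: "isomorphism_relation `` {V} = isomorphism_relation `` {T}"
    if "plane_tree V" "passport V = (\<alpha>, \<beta>, n)" "plane_tree T" "passport T = (\<alpha>, \<beta>, n)" "rot_iso V T \<phi>" for V T \<phi>
  proof -
    have "(\<exists>\<phi>. rot_iso V Y \<phi>) \<longleftrightarrow> (\<exists>\<phi>. rot_iso T Y \<phi>)" for Y
    proof
      assume "\<exists>\<phi>. rot_iso V Y \<phi>"
      then obtain \<psi> where "rot_iso V Y \<psi>" ..
      from rot_iso_trans[OF rot_iso_sym[OF that(1,5)] this] show "\<exists>\<phi>. rot_iso T Y \<phi>" by blast
    next
      assume "\<exists>\<phi>. rot_iso T Y \<phi>"
      then obtain \<psi> where "rot_iso T Y \<psi>" ..
      from rot_iso_trans[OF that(5) this] show "\<exists>\<phi>. rot_iso V Y \<phi>" by blast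
    qed
    then show ?thesis unfolding rel[OF that(1,2)] rel[OF that(3,4)] by simp
  qed
  show C: "\<And>T. T \<in> C \<Longrightarrow> plane_tree T \<and> (\<exists>\<phi>. rot_iso S T \<phi>)"
    unfolding C_def rel[OF S] by simp
  show "\<And>T. T \<in> C' \<Longrightarrow> plane_tree T \<and> (\<exists>\<phi>. rot_iso S' T \<phi>)"
    unfolding C'_def rel[OF S'] by simp
  have "rot_iso S' S' id" by (simp add: rot_iso_def)
  then have "S' \<in> C'" unfolding C'_def rel[OF S'] using S'(1) by blast
  then show "C \<noteq> C'" using C noniso by blast
  show "trees \<alpha> \<beta> n = {C, C'}"
  proof
    show "trees \<alpha> \<beta> n \<subseteq> {C, C'}"
    proof
      fix D assume "D \<in> trees \<alpha> \<beta> n"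
      then obtain T where T: "plane_tree T" "passport T = (\<alpha>, \<beta>, n)" "D = isomorphism_relation `` {T}"
        by (auto simp: trees_def quotient_def)
      obtain \<phi> where "rot_iso S T \<phi> \<or> rot_iso S' T \<phi>" using all[OF T(1,2)] by blast
      then show "D \<in> {C, C'}"
      proof
        assume "rot_iso S T \<phi>"
        from cls[OF S T(1,2) this] T(3) show ?thesis by (simp add: C_def)
      next
        assume "rot_iso S' T \<phi>"
        from cls[OF S' T(1,2) this] T(3) show ?thesis by (simp add: C'_def)
      qed
    qed
    show "{C, C'} \<subseteq> trees \<alpha> \<beta> n"
      unfolding trees_def C_def C'_def using S S' by (simp add: quotientI)
  qed
qed

section \<open>Trees are determined by their depth-first degree words\<close>

text \<open>The stack holds edges together with the colour of the end still to be explored. The test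
  \<open>(s c ^^ d) x = x\<close> accepts every multiple of the orbit length, not only the degree
  itself; the prescribed sum of the letters in \<open>same_traces_rot_iso\<close> makes up for
  this.\<close>

fun traces :: "(bool \<Rightarrow> nat \<Rightarrow> nat) \<Rightarrow> nat list \<Rightarrow> (nat \<times> bool) list \<Rightarrow> bool" where
  "traces s [] st \<longleftrightarrow> st = []"
| "traces s (d # w) [] \<longleftrightarrow> False"
| "traces s (d # w) ((x, c) # st) \<longleftrightarrow> d > 0 \<and> (s c ^^ d) x = x \<and>
     traces s w (map (\<lambda>k. ((s c ^^ k) x, \<not> c)) [1..<d] @ st)"

text \<open>Two trees explored in parallel along one word: edges reached at the same moment are
  matched.\<close>

fun pairs :: "(bool \<Rightarrow> nat \<Rightarrow> nat) \<Rightarrow> (bool \<Rightarrow> nat \<Rightarrow> nat) \<Rightarrow> nat list \<Rightarrow> (nat \<times> nat \<times> bool) list \<Rightarrow> (nat \<times> nat) list" where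
  "pairs s t [] st = []"
| "pairs s t (d # w) [] = []"
| "pairs s t (d # w) ((x, y, c) # st) =
     map (\<lambda>k. ((s c ^^ k) x, (t c ^^ k) y)) [1..<d] @
     pairs s t w (map (\<lambda>k. ((s c ^^ k) x, (t c ^^ k) y, \<not> c)) [1..<d] @ st)"

lemma length_pairs:
  "length (pairs s t w st) \<le> sum_list (map (\<lambda>d. d - 1) w)"
  by (induction s t w st rule: pairs.induct) auto

text \<open>A stack entry owes only the rotation step of its own colour, whereas a reported pair
  must admit both steps. One of them runs along the orbit in which the pair was found, which closes
  up at \<open>(x, y)\<close> after \<open>d\<close> steps; the other is owed by the entry pushed
  for that pair.\<close>

lemma pairs_closed:
  assumes "traces s w (map (\<lambda>q. (fst q, snd (snd q))) st)" "traces t w (map snd st)"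
  shows "(\<forall>(x, y, c)\<in>set st. (s c x, t c y) \<in> insert (x, y) (set (pairs s t w st))) \<and>
    (\<forall>(x, y)\<in>set (pairs s t w st). \<forall>c.
       (s c x, t c y) \<in> (\<lambda>q. (fst q, fst (snd q))) ` set st \<union> set (pairs s t w st))"
  using assms
proof (induction s t w st rule: pairs.induct)
  case (3 s t d w x y c st)
  define P where "P k = ((s c ^^ k) x, (t c ^^ k) y)" for k
  define st' where "st' = map (\<lambda>k. ((s c ^^ k) x, (t c ^^ k) y, \<not> c)) [1..<d] @ st"
  have d: "d > 0" "P d = (x, y)" "P 0 = (x, y)"
    using 3(2,3) by (auto simp: P_def)
  have IH: "(\<forall>(x, y, c)\<in>set st'. (s c x, t c y) \<in> insert (x, y) (set (pairs s t w st')))"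
    "(\<forall>(x, y)\<in>set (pairs s t w st'). \<forall>c.
       (s c x, t c y) \<in> (\<lambda>q. (fst q, fst (snd q))) ` set st' \<union> set (pairs s t w st'))"
  proof -
    have "traces s w (map (\<lambda>q. (fst q, snd (snd q))) st')" "traces t w (map snd st')"
      using 3(2,3) by (simp_all add: st'_def comp_def)
    from 3(1)[unfolded st'_def[symmetric], OF this]
    show "(\<forall>(x, y, c)\<in>set st'. (s c x, t c y) \<in> insert (x, y) (set (pairs s t w st')))"
      "(\<forall>(x, y)\<in>set (pairs s t w st'). \<forall>c.
       (s c x, t c y) \<in> (\<lambda>q. (fst q, fst (snd q))) ` set st' \<union> set (pairs s t w st'))" by auto
  qed
  have set1: "set (pairs s t (d # w) ((x, y, c) # st)) = P ` {1..<d} \<union> set (pairs s t w st')"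
    by (auto simp: P_def st'_def)
  have im: "(\<lambda>q. (fst q, fst (snd q))) ` set st' = P ` {1..<d} \<union> (\<lambda>q. (fst q, fst (snd q))) ` set st"
    by (force simp: st'_def P_def)
  have Pstep: "(s c (fst (P k)), t c (snd (P k))) \<in> insert (x, y) (P ` {1..<d})" if "k < d" for k
  proof -
    have "(s c (fst (P k)), t c (snd (P k))) = P (Suc k)" by (simp add: P_def)
    moreover have "P (Suc k) = (x, y) \<or> Suc k \<in> {1..<d}"
      using that d by (cases "Suc k = d") auto
    ultimately show ?thesis by auto
  qed
  have Pother: "(s (\<not> c) (fst (P k)), t (\<not> c) (snd (P k))) \<in> insert (P k) (set (pairs s t w st'))"
    if "k \<in> {1..<d}" for k
  proof -
    have "(fst (P k), snd (P k), \<not> c) \<in> set st'" using that by (force simp: st'_def P_def)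
    then show ?thesis using IH(1) by fastforce
  qed
  have stk: "(s c' x', t c' y') \<in> insert (x', y') (set (pairs s t w st'))" if "(x', y', c') \<in> set st" for x' y' c'
  proof -
    have "(x', y', c') \<in> set st'" using that by (simp add: st'_def)
    then show ?thesis using IH(1) by fastforce
  qed
  have A: "(s c x, t c y) \<in> insert (x, y) (P ` {1..<d})"
    using Pstep[of 0] d by (simp add: P_def)
  have B: "(s c' (fst (P k)), t c' (snd (P k))) \<in> insert (x, y) (P ` {1..<d} \<union> set (pairs s t w st'))"
    if "k \<in> {1..<d}" for k c'
    using Pstep[of k] Pother[of k] that by (cases "c' = c") auto
  have C: "(s c' x', t c' y') \<in> P ` {1..<d} \<union> (\<lambda>q. (fst q, fst (snd q))) ` set st \<union> set (pairs s t w st')"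
    if "(x', y') \<in> set (pairs s t w st')" for x' y' c'
    using IH(2) that unfolding im by blast
  have im2: "(\<lambda>q. (fst q, fst (snd q))) ` set ((x, y, c) # st) = insert (x, y) ((\<lambda>q. (fst q, fst (snd q))) ` set st)"
    by simp
  show ?case unfolding set1 im2
  proof (intro conjI ballI, goal_cases)
    case (1 z)
    obtain x' y' c' where z: "z = (x', y', c')" by (cases z)
    show ?case using 1 A stk[of x' y' c'] unfolding z by auto
  next
    case (2 z)
    obtain x' y' where z: "z = (x', y')" by (cases z)
    from 2 show ?case
    proof
      assume "z \<in> P ` {1..<d}"
      then obtain k where k: "k \<in> {1..<d}" "P k = (x', y')" using z by auto
      show ?case using B[OF k(1)] k(2) unfolding z by auto
    next
      assume "z \<in> set (pairs s t w st')"
      then show ?case using C[of x' y'] unfolding z by auto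
    qed
  qed
qed auto

text \<open>The matched pairs are closed under both rotations, so by transitivity they project onto
  all edges of either tree. The letter sum bounds their number by the number of edges, so both
  projections are injective and the pairs form the graph of an isomorphism.\<close>

lemma same_traces_rot_iso:
  assumes S: "plane_tree S" and T: "plane_tree T" and n: "num_edges S = num_edges T"
    and w: "Suc (sum_list (map (\<lambda>d. d - 1) w)) = num_edges S"
    and e: "e \<in> edges S" and tS: "traces (rot_of S) w [(e, False), (e, True)]"
    and f: "f \<in> edges T" and tT: "traces (rot_of T) w [(f, False), (f, True)]"
  shows "\<exists>\<phi>. rot_iso S T \<phi>"
proof -
  let ?st = "[(e, f, False), (e, f, True)]"
  define L where "L = set ((e, f) # pairs (rot_of S) (rot_of T) w ?st)"
  have closed: "(rot_of S c x, rot_of T c y) \<in> L" if "(x, y) \<in> L" for c x y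
  proof -
    have *: "traces (rot_of S) w (map (\<lambda>q. (fst q, snd (snd q))) ?st)" "traces (rot_of T) w (map snd ?st)"
      using tS tT by auto
    show ?thesis using pairs_closed[OF *] that by (cases c) (auto simp: L_def)
  qed
  have rS: "rot_of S c x \<in> edges S \<longleftrightarrow> x \<in> edges S" for c x
    using plane_tree_rot_of(1)[OF S] by (rule permutes_in_image)
  have rT: "rot_of T c x \<in> edges T \<longleftrightarrow> x \<in> edges T" for c x
    using plane_tree_rot_of(1)[OF T] by (rule permutes_in_image)
  define M where "M = L \<inter> edges S \<times> edges T"
  have Mclosed: "(rot_of S c x, rot_of T c y) \<in> M" if "(x, y) \<in> M" for c x y
    using that closed by (auto simp: M_def rS rT)
  have ef: "(e, f) \<in> M" using e f by (simp add: M_def L_def)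
  have fstM: "fst ` M = edges S"
  proof (rule plane_tree_transitive[OF S])
    show "rot_of S c x \<in> fst ` M" if x: "x \<in> fst ` M" for c x
    proof -
      obtain y where "(x, y) \<in> M" using x by force
      then show ?thesis using Mclosed by (metis fst_conv image_eqI)
    qed
  qed (use ef in \<open>auto simp: M_def\<close>)
  have sndM: "snd ` M = edges T"
  proof (rule plane_tree_transitive[OF T])
    show "rot_of T c y \<in> snd ` M" if y: "y \<in> snd ` M" for c y
    proof -
      obtain x where "(x, y) \<in> M" using y by force
      then show ?thesis using Mclosed by (metis snd_conv image_eqI)
    qed
  qed (use ef in \<open>auto simp: M_def\<close>)
  have "card L \<le> length ((e, f) # pairs (rot_of S) (rot_of T) w ?st)"
    unfolding L_def by (rule card_length)
  also have "\<dots> \<le> num_edges S" using w length_pairs[of "rot_of S" "rot_of T" w ?st] by simp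
  finally have "card L \<le> num_edges S" .
  moreover have finL: "finite L" by (simp add: L_def)
  ultimately have cM: "card M \<le> num_edges S" "finite M"
    by (auto simp: M_def intro: order_trans[OF card_mono])
  have inj1: "inj_on fst M"
    using cM card_image_le[of M fst] by (intro eq_card_imp_inj_on) (simp_all add: fstM)
  have inj2: "inj_on snd M"
    using cM card_image_le[of M snd] n by (intro eq_card_imp_inj_on) (simp_all add: sndM)
  define \<phi> where "\<phi> = snd \<circ> inv_into M fst"
  have b1: "bij_betw fst M (edges S)" and b2: "bij_betw snd M (edges T)"
    using inj1 inj2 fstM sndM by (auto simp: bij_betw_def)
  then have "bij_betw \<phi> (edges S) (edges T)"
    unfolding \<phi>_def by (metis bij_betw_inv_into bij_betw_trans)
  moreover have \<phi>: "\<phi> x = y" if "(x, y) \<in> M" for x y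
    using inv_into_f_f[OF inj1 that] by (simp add: \<phi>_def)
  moreover have in_M: "(x, \<phi> x) \<in> M" if "x \<in> edges S" for x
  proof -
    from that obtain y where "(x, y) \<in> M" using fstM by force
    then show ?thesis using \<phi> by simp
  qed
  moreover have "rot_of T c (\<phi> x) = \<phi> (rot_of S c x)" if "x \<in> edges S" for c x
    using \<phi>[OF Mclosed[OF in_M[OF that]]] by simp
  ultimately have "rot_iso S T \<phi>"
    unfolding rot_iso_def by blast
  then show ?thesis by auto
qed

section \<open>Enumerating the degree words of a passport\<close>

text \<open>The exploration of \<open>traces\<close> with the edges forgotten: the colour on top of
  the stack decides which list supplies the next degree, and a vertex of degree \<open>d\<close>
  contributes \<open>d - 1\<close> further ends of the opposite colour.\<close>

function words :: "nat list \<Rightarrow> nat list \<Rightarrow> bool list \<Rightarrow> nat list list" where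
  "words \<alpha> \<beta> [] = (if \<alpha> = [] \<and> \<beta> = [] then [[]] else [])"
| "words \<alpha> \<beta> (False # cs) =
     concat (map (\<lambda>d. map ((#) d) (words (remove1 d \<alpha>) \<beta> (replicate (d - 1) True @ cs))) (remdups \<alpha>))"
| "words \<alpha> \<beta> (True # cs) =
     concat (map (\<lambda>d. map ((#) d) (words \<alpha> (remove1 d \<beta>) (replicate (d - 1) False @ cs))) (remdups \<beta>))"
  by pat_completeness auto
termination
  by (relation "Wellfounded.measure (\<lambda>(\<alpha>, \<beta>, cs). length \<alpha> + length \<beta>)")
    (auto simp: length_remove1 dest!: length_pos_if_in_set)

section \<open>Growing subtrees edge by edge, and paths inside them\<close>

inductive subtree :: "labelled_tree \<Rightarrow> nat set \<Rightarrow> nat set \<Rightarrow> bool" for T where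
  base: "e \<in> edges T \<Longrightarrow> subtree T {end_of T False e, end_of T True e} {e}"
| step: "subtree T U L \<Longrightarrow> e \<in> edges T \<Longrightarrow> e \<notin> L \<Longrightarrow> end_of T c e \<in> U \<Longrightarrow>
    subtree T (insert (end_of T (\<not> c) e) U) (insert e L)"

lemma subtree_edges: "subtree T U L \<Longrightarrow> L \<subseteq> edges T"
  by (induction rule: subtree.induct) auto

definition simple_path :: "labelled_tree \<Rightarrow> nat set \<Rightarrow> nat list \<Rightarrow> nat list \<Rightarrow> bool" where
  "simple_path T L vs es \<longleftrightarrow> length vs = Suc (length es) \<and> distinct vs \<and> distinct es \<and> set es \<subseteq> L \<and>
     (\<forall>i<length es. {black_end T (es ! i), white_end T (es ! i)} = {vs ! i, vs ! Suc i})"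

lemma simple_path_mono: "simple_path T L vs es \<Longrightarrow> L \<subseteq> L' \<Longrightarrow> simple_path T L' vs es"
  by (auto simp: simple_path_def)

lemma simple_path_Cons:
  assumes "simple_path T L vs es" "v \<notin> set vs" "e \<notin> L"
    "{black_end T e, white_end T e} = {v, hd vs}"
  shows "simple_path T (insert e L) (v # vs) (e # es)"
  using assms unfolding simple_path_def
  by (cases vs) (auto simp: nth_Cons split: nat.splits)

lemma simple_path_rev:
  assumes p: "simple_path T L vs es"
  shows "simple_path T L (rev vs) (rev es)"
proof -
  have "{black_end T (rev es ! i), white_end T (rev es ! i)} = {rev vs ! i, rev vs ! Suc i}"
    if i: "i < length es" for i
  proof -
    have "rev es ! i = es ! (length es - Suc i)" using i by (rule rev_nth)
    moreover have "rev vs ! i = vs ! Suc (length es - Suc i)"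
      using i p by (simp add: rev_nth simple_path_def Suc_diff_Suc)
    moreover have "rev vs ! Suc i = vs ! (length es - Suc i)"
      using i p by (simp add: rev_nth simple_path_def)
    moreover have "{black_end T (es ! (length es - Suc i)), white_end T (es ! (length es - Suc i))} =
      {vs ! (length es - Suc i), vs ! Suc (length es - Suc i)}"
      using p i by (simp add: simple_path_def)
    ultimately show ?thesis by (simp add: insert_commute)
  qed
  then show ?thesis using p by (simp add: simple_path_def)
qed

lemma no_closing_edge:
  assumes T: "acyclic_graph T" and p: "simple_path T L vs es" "L \<subseteq> edges T"
    and e: "e \<in> edges T" "e \<notin> L" "{black_end T e, white_end T e} = {last vs, hd vs}"
  shows False
proof -
  have len: "length (es @ [e]) = length vs" and ne: "vs \<noteq> []" using p by (auto simp: simple_path_def)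
  have "{black_end T ((es @ [e]) ! i), white_end T ((es @ [e]) ! i)} = {vs ! i, vs ! (Suc i mod length vs)}"
    if "i < length (es @ [e])" for i
  proof (cases "i < length es")
    case True
    then have "Suc i mod length vs = Suc i" using len by auto
    then show ?thesis using p True by (simp add: simple_path_def nth_append)
  next
    case False
    then have "i = length es" using that by auto
    moreover have "Suc (length es) = length vs" using len by simp
    ultimately show ?thesis
      using e(3) ne by (simp add: last_conv_nth hd_conv_nth flip: \<open>Suc (length es) = length vs\<close>)
  qed
  moreover have "distinct (es @ [e])" "set (es @ [e]) \<subseteq> edges T" "distinct vs"
    using p e by (auto simp: simple_path_def)
  ultimately have "\<exists>vs es. vs \<noteq> [] \<and> length es = length vs \<and> distinct vs \<and> distinct es \<and> set es \<subseteq> edges T \<and>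
      (\<forall>i<length es. {black_end T (es ! i), white_end T (es ! i)} = {vs ! i, vs ! (Suc i mod length vs)})"
    using len ne by (intro exI[of _ vs] exI[of _ "es @ [e]"] conjI) simp_all
  then show False using T unfolding acyclic_graph_def by blast
qed

text \<open>The new edge is needed only for paths from or to a new vertex: it then prolongs a path
  that starts at its old end.\<close>

lemma subtree_path:
  assumes T: "plane_tree T" and "subtree T U L" "u \<in> U" "v \<in> U"
  shows "\<exists>vs es. simple_path T L vs es \<and> set vs \<subseteq> U \<and> hd vs = u \<and> last vs = v"
  using assms(2-)
proof (induction arbitrary: u v rule: subtree.induct)
  case (base e)
  have triv: "simple_path T {e} [w] [] \<and> set [w] \<subseteq> {end_of T False e, end_of T True e} \<and> hd [w] = w \<and> last [w] = w"
    if "w \<in> {end_of T False e, end_of T True e}" for w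
    using that by (auto simp: simple_path_def)
  show ?case
  proof (cases "u = v")
    case True
    then show ?thesis using triv[OF base(2)] by blast
  next
    case False
    have "simple_path T {e} [u, v] [e]"
      using base False ends_end_of[of T e False] by (auto simp: simple_path_def)
    then show ?thesis using base by (intro exI[of _ "[u, v]"] exI[of _ "[e]"]) simp
  qed
next
  case (step U L e c)
  let ?z = "end_of T (\<not> c) e" and ?p = "end_of T c e"
  show ?case
  proof (cases "?z \<in> U")
    case True
    then show ?thesis using step.IH[of u v] step.prems simple_path_mono[of T L _ _ "insert e L"]
      by (metis insert_absorb subset_insertI)
  next
    case False
    have from_z: "\<exists>vs es. simple_path T (insert e L) vs es \<and> set vs \<subseteq> insert ?z U \<and> hd vs = ?z \<and> last vs = w"
      if w: "w \<in> U" for w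
    proof -
      obtain vs es where vs: "simple_path T L vs es" "set vs \<subseteq> U" "hd vs = ?p" "last vs = w"
        using step.IH[OF step.hyps(4) w] by blast
      have "simple_path T (insert e L) (?z # vs) (e # es)"
        using vs False step.hyps ends_end_of[of T e c] by (intro simple_path_Cons) (auto simp: insert_commute)
      moreover have "vs \<noteq> []" using vs(1) by (auto simp: simple_path_def)
      ultimately show ?thesis using vs by (intro exI[of _ "?z # vs"] exI[of _ "e # es"]) auto
    qed
    show ?thesis
    proof (cases "u = ?z")
      case True
      show ?thesis
      proof (cases "v = ?z")
        case True
        have "simple_path T (insert e L) [?z] []" by (simp add: simple_path_def)
        then show ?thesis using \<open>u = ?z\<close> True by (intro exI[of _ "[?z]"] exI[of _ "[]"]) auto
      next
        case False
        then show ?thesis using from_z[of v] step.prems \<open>u = ?z\<close> by simp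
      qed
    next
      case u: False
      show ?thesis
      proof (cases "v = ?z")
        case True
        then obtain vs es where vs: "simple_path T (insert e L) vs es" "set vs \<subseteq> insert ?z U"
          "hd vs = ?z" "last vs = u" using from_z[of u] u step.prems by auto
        then have "vs \<noteq> []" by (auto simp: simple_path_def)
        then show ?thesis using vs True simple_path_rev[OF vs(1)]
          by (intro exI[of _ "rev vs"] exI[of _ "rev es"]) (simp add: hd_rev last_rev)
      next
        case False
        then obtain vs es where "simple_path T L vs es" "set vs \<subseteq> U" "hd vs = u" "last vs = v"
          using step.IH[of u v] u step.prems by auto
        then show ?thesis using simple_path_mono[of T L vs es "insert e L"]
          by (intro exI[of _ vs] exI[of _ es]) auto
      qed
    qed
  qed
qed

text \<open>Otherwise the edge would close the path between its ends inside L to a cycle.\<close>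

lemma subtree_induced:
  assumes T: "plane_tree T" and U: "subtree T U L" and e: "e \<in> edges T" "end_of T False e \<in> U" "end_of T True e \<in> U"
  shows "e \<in> L"
proof (rule ccontr)
  assume "e \<notin> L"
  obtain vs es where "simple_path T L vs es" "hd vs = end_of T False e" "last vs = end_of T True e"
    using subtree_path[OF T U e(2,3)] by blast
  then show False
    using T e \<open>e \<notin> L\<close> subtree_edges[OF U] ends_end_of[of T e False]
    by (intro no_closing_edge[of T L vs es e]) (auto simp: plane_tree_def insert_commute)
qed

text \<open>The rules of \<open>subtree\<close> do not ask that the added end be new; its freshness
  is a consequence of acyclicity.\<close>

lemma subtree_new_end:
  assumes T: "plane_tree T" and U: "subtree T U L" and e: "e \<in> edges T" "e \<notin> L" "end_of T c e \<in> U"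
  shows "end_of T (\<not> c) e \<notin> U"
  using subtree_induced[OF T U e(1)] e(2,3) by (cases c) auto

text \<open>Adding the edges one at a time makes each far end new with respect to U and to all
  earlier ones.\<close>

lemma subtree_extend:
  assumes T: "plane_tree T" and "subtree T U L" "distinct ys" "set ys \<subseteq> edges T - L" "v \<in> U"
    "\<forall>y\<in>set ys. end_of T c y = v"
  shows "subtree T (U \<union> end_of T (\<not> c) ` set ys) (L \<union> set ys) \<and> distinct (map (end_of T (\<not> c)) ys) \<and>
    end_of T (\<not> c) ` set ys \<inter> U = {}"
  using assms(2-)
proof (induction ys arbitrary: U L)
  case (Cons y ys)
  let ?z = "end_of T (\<not> c) y"
  have "subtree T (insert ?z U) (insert y L)"
    using Cons.prems by (intro subtree.step) auto
  then have IH: "subtree T (insert ?z U \<union> end_of T (\<not> c) ` set ys) (insert y L \<union> set ys) \<and>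
    distinct (map (end_of T (\<not> c)) ys) \<and> end_of T (\<not> c) ` set ys \<inter> insert ?z U = {}"
    using Cons.prems by (intro Cons.IH) auto
  moreover have "?z \<notin> U" using Cons.prems by (intro subtree_new_end[OF T]) auto
  moreover have "insert ?z U \<union> end_of T (\<not> c) ` set ys = U \<union> end_of T (\<not> c) ` set (y # ys)"
    "insert y L \<union> set ys = L \<union> set (y # ys)" by auto
  ultimately show ?case by auto
qed simp

section \<open>Exploring a tree along its degree word\<close>

definition vdegree :: "labelled_tree \<Rightarrow> bool \<Rightarrow> nat \<Rightarrow> nat" where
  "vdegree T c v = card {e \<in> edges T. end_of T c e = v}"

text \<open>The orbit of an edge lists the edges at its vertex without repetition, so the orbit
  length \<open>least_power\<close> is the degree. Thus \<open>ys\<close> consists of the other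
  edges there, in the order in which \<open>traces\<close> pushes them.\<close>

lemma rotation_orbit:
  fixes c :: bool
  assumes T: "plane_tree T" and x: "x \<in> edges T"
  defines "s \<equiv> rot_of T c"
  defines "d \<equiv> vdegree T c (end_of T c x)"
  defines "ys \<equiv> map (\<lambda>k. (s ^^ k) x) [1..<d]"
  shows "d > 0" "(s ^^ d) x = x" "distinct (x # ys)"
    "set (x # ys) = {e \<in> edges T. end_of T c e = end_of T c x}"
proof -
  have s: "s permutes edges T" unfolding s_def by (rule plane_tree_rot_of(1)[OF T])
  then have perm: "permutation s" unfolding permutation_permutes using finite_edges[of T] by (intro exI[of _ "edges T"] conjI)
  define m where "m = least_power s x"
  have m: "m > 0" "(s ^^ m) x = x"
    unfolding m_def using least_power_of_permutation[OF perm] by auto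
  have dist: "distinct (map (\<lambda>k. (s ^^ k) x) [0..<m])"
    unfolding m_def by (rule cycle_of_permutation[OF perm])
  have img: "set (map (\<lambda>k. (s ^^ k) x) [0..<m]) = {e \<in> edges T. end_of T c e = end_of T c x}"
  proof -
    have in_orbit: "y \<in> (\<lambda>k. (s ^^ k) x) ` {0..<m}" if "(s ^^ k) x = y" for k y
    proof -
      have "y = (s ^^ (k mod m)) x" using funpow_mod_eq[OF m(2), of k] that by simp
      then show ?thesis using m(1) by simp
    qed
    have orbE: "(s ^^ k) x \<in> edges T" for k
      using x s by (induction k) (simp_all add: permutes_in_image)
    have ends: "end_of T c x = end_of T c e \<longleftrightarrow> (\<exists>k. (s ^^ k) x = e)" if "e \<in> edges T" for e
      unfolding s_def by (rule plane_tree_rot_of(2)[OF T x that])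
    have "(\<lambda>k. (s ^^ k) x) ` {0..<m} = {e \<in> edges T. end_of T c e = end_of T c x}"
    proof (intro subset_antisym subsetI)
      fix y assume "y \<in> (\<lambda>k. (s ^^ k) x) ` {0..<m}"
      then obtain k where k: "y = (s ^^ k) x" by (rule imageE)
      then show "y \<in> {e \<in> edges T. end_of T c e = end_of T c x}"
        using orbE[of k] ends[OF orbE[of k]] by simp metis
    next
      fix y assume y: "y \<in> {e \<in> edges T. end_of T c e = end_of T c x}"
      then obtain k where "(s ^^ k) x = y" using ends[of y] by auto
      then show "y \<in> (\<lambda>k. (s ^^ k) x) ` {0..<m}" by (rule in_orbit)
    qed
    then show ?thesis by simp
  qed
  have "m = card (set (map (\<lambda>k. (s ^^ k) x) [0..<m]))"
    using distinct_card[OF dist] by simp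
  then have md: "m = d" unfolding img d_def vdegree_def .
  have cons: "map (\<lambda>k. (s ^^ k) x) [0..<m] = x # ys"
    using m(1) unfolding ys_def md[symmetric] by (simp add: upt_conv_Cons)
  show "d > 0" "(s ^^ d) x = x" using m unfolding md by simp_all
  show "distinct (x # ys)" using dist unfolding cons .
  show "set (x # ys) = {e \<in> edges T. end_of T c e = end_of T c x}" using img unfolding cons .
qed

definition rest_degrees :: "labelled_tree \<Rightarrow> bool \<Rightarrow> nat set \<Rightarrow> nat multiset" where
  "rest_degrees T c Vis = image_mset (vdegree T c) (mset_set (side T c - Vis))"

lemma rest_degrees_insert:
  assumes T: "plane_tree T" and v: "v \<in> side T c" "v \<notin> Vis"
  shows "rest_degrees T c Vis = add_mset (vdegree T c v) (rest_degrees T c (insert v Vis))"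
    "rest_degrees T (\<not> c) (insert v Vis) = rest_degrees T (\<not> c) Vis"
proof -
  have "finite (side T c)" using T by (cases c) (auto simp: plane_tree_def side_def)
  moreover have "side T c - Vis = insert v (side T c - insert v Vis)" using v by auto
  ultimately show "rest_degrees T c Vis = add_mset (vdegree T c v) (rest_degrees T c (insert v Vis))"
    unfolding rest_degrees_def by (metis (no_types, lifting) Diff_iff finite_Diff image_mset_add_mset insertI1 mset_set.insert)
  have "v \<notin> side T (\<not> c)" using plane_tree_side_disjoint[OF T, of c] v by auto
  then have "side T (\<not> c) - insert v Vis = side T (\<not> c) - Vis" by auto
  then show "rest_degrees T (\<not> c) (insert v Vis) = rest_degrees T (\<not> c) Vis"
    by (simp add: rest_degrees_def)
qed

text \<open>Invariants of the exploration: the known edges L form a subtree whose vertices are the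
  visited ones and the distinct, unvisited ends on the stack; every known edge has each end visited
  or on the stack; every edge at a visited vertex is known. With an empty stack the visited vertices
  are closed under crossing edges, hence all vertices, and both degree lists are used up.\<close>

lemma exploration_words:
  assumes T: "plane_tree T"
  shows "subtree T (Vis \<union> (\<lambda>(x, c). end_of T c x) ` set st) L \<Longrightarrow>
    distinct (map (\<lambda>(x, c). end_of T c x) st) \<Longrightarrow>
    (\<lambda>(x, c). end_of T c x) ` set st \<inter> Vis = {} \<Longrightarrow> fst ` set st \<subseteq> L \<Longrightarrow>
    (\<forall>y\<in>L. \<forall>c. end_of T c y \<in> Vis \<or> (y, c) \<in> set st) \<Longrightarrow>
    (\<forall>y\<in>edges T. \<forall>c. end_of T c y \<in> Vis \<longrightarrow> y \<in> L) \<Longrightarrow>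
    Vis \<subseteq> vertices T \<Longrightarrow>
    mset \<alpha> = rest_degrees T False Vis \<Longrightarrow> mset \<beta> = rest_degrees T True Vis \<Longrightarrow>
    \<exists>w\<in>set (words \<alpha> \<beta> (map snd st)). traces (rot_of T) w st"
proof (induction "card (vertices T - Vis)" arbitrary: Vis st L \<alpha> \<beta> rule: less_induct)
  case less
  have fin: "finite (vertices T)" using T by (simp add: plane_tree_def vertices_def)
  have L: "L \<subseteq> edges T" using less.prems(1) by (rule subtree_edges)
  show ?case
  proof (cases st)
    case Nil
    have "Vis \<noteq> {}" using less.prems(1) Nil by (auto elim: subtree.cases)
    moreover have "end_of T (\<not> c) e \<in> Vis" if "e \<in> edges T" "end_of T c e \<in> Vis" for c e
      using less.prems(5,6) that Nil by auto
    ultimately have "Vis = vertices T" using less.prems(7) by (intro plane_tree_connected[OF T]) auto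
    then have none: "side T c - Vis = {}" for c by (auto simp: side_def vertices_def)
    have "rest_degrees T c Vis = {#}" for c unfolding rest_degrees_def none by simp
    then have "\<alpha> = []" "\<beta> = []" using less.prems(8,9) by simp_all
    then show ?thesis using Nil by simp
  next
    case (Cons p st')
    obtain x c where p: "p = (x, c)" by (cases p)
    define v d where "v = end_of T c x" and "d = vdegree T c v"
    define ys where "ys = map (\<lambda>k. (rot_of T c ^^ k) x) [1..<d]"
    define V' where "V' = insert v Vis"
    define st'' where "st'' = map (\<lambda>y. (y, \<not> c)) ys @ st'"
    let ?end = "\<lambda>(x, c). end_of T c x"
    have xL: "x \<in> L" using less.prems(4) by (simp add: Cons p)
    then have x: "x \<in> edges T" using L by auto
    have vVis: "v \<notin> Vis" using less.prems(3) by (auto simp: Cons p v_def)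
    have vside: "v \<in> side T c" unfolding v_def by (rule plane_tree_end_of[OF T x])
    note orb = rotation_orbit[OF T x, of c, folded v_def, folded d_def, folded ys_def]
    have ysE: "set ys \<subseteq> edges T" and ysv: "\<forall>y\<in>set ys. end_of T c y = v" and ysd: "distinct ys" "x \<notin> set ys"
      using orb(3,4) by auto
    have only: "y = x" if "(y, c) \<in> set st" "end_of T c y = v" for y
      using less.prems(2) that by (force simp: Cons p v_def)
    \<comment> \<open>\<open>x\<close> is the only stack entry ending at \<open>v\<close>, so the
      remaining edges at \<open>v\<close> have not been met before.\<close>
    have ysL: "y \<notin> L" if y: "y \<in> set ys" for y
    proof
      assume "y \<in> L"
      then have "end_of T c y \<in> Vis \<or> (y, c) \<in> set st" using less.prems(5) by blast
      then have "(y, c) \<in> set st" using ysv y vVis by auto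
      then show False using only ysv y ysd by blast
    qed
    have ext: "subtree T (Vis \<union> ?end ` set st \<union> end_of T (\<not> c) ` set ys) (L \<union> set ys) \<and>
      distinct (map (end_of T (\<not> c)) ys) \<and> end_of T (\<not> c) ` set ys \<inter> (Vis \<union> ?end ` set st) = {}"
    proof (rule subtree_extend[OF T less.prems(1) ysd(1) _ _ ysv])
      show "set ys \<subseteq> edges T - L" using ysE ysL by auto
      show "v \<in> Vis \<union> ?end ` set st" by (simp add: Cons p v_def)
    qed
    have end_st: "?end ` set st = insert v (?end ` set st')" by (simp add: Cons p v_def)
    have end_st'': "?end ` set st'' = end_of T (\<not> c) ` set ys \<union> ?end ` set st'"
      by (auto simp: st''_def image_Un image_image)
    have dst: "distinct (map ?end st')" "v \<notin> ?end ` set st'"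
      using less.prems(2) by (auto simp: Cons p v_def)
    have map_st'': "map ?end st'' = map (end_of T (\<not> c)) ys @ map ?end st'"
      by (simp add: st''_def comp_def)
    have IH: "mset \<alpha>' = rest_degrees T False V' \<Longrightarrow> mset \<beta>' = rest_degrees T True V' \<Longrightarrow>
        \<exists>w\<in>set (words \<alpha>' \<beta>' (map snd st'')). traces (rot_of T) w st''" for \<alpha>' \<beta>'
    proof (rule less.hyps[of V' st'' "L \<union> set ys"])
      show "card (vertices T - V') < card (vertices T - Vis)"
        using vside vVis fin by (intro psubset_card_mono) (auto simp: V'_def vertices_def side_def split: if_splits)
      have "V' \<union> ?end ` set st'' = Vis \<union> ?end ` set st \<union> end_of T (\<not> c) ` set ys"
        by (auto simp: V'_def end_st end_st'')
      then show "subtree T (V' \<union> ?end ` set st'') (L \<union> set ys)" using ext by simp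
      show "distinct (map ?end st'')"
        unfolding map_st'' distinct_append set_map using ext dst(1) end_st by blast
      show "?end ` set st'' \<inter> V' = {}"
        using ext less.prems(3) dst(2) unfolding end_st'' end_st V'_def by blast
      show "fst ` set st'' \<subseteq> L \<union> set ys"
        using less.prems(4) by (auto simp: st''_def Cons)
      show "V' \<subseteq> vertices T" using less.prems(7) vside by (auto simp: V'_def vertices_def side_def split: if_splits)
      show "\<forall>y\<in>L \<union> set ys. \<forall>b. end_of T b y \<in> V' \<or> (y, b) \<in> set st''"
      proof (intro ballI allI)
        fix y b assume y: "y \<in> L \<union> set ys"
        show "end_of T b y \<in> V' \<or> (y, b) \<in> set st''"
        proof (cases "y \<in> set ys")
          case True
          then show ?thesis using ysv by (cases "b = c") (auto simp: V'_def st''_def)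
        next
          case False
          then have "end_of T b y \<in> Vis \<or> (y, b) \<in> set st" using less.prems(5) y by blast
          then show ?thesis by (auto simp: V'_def st''_def Cons p v_def)
        qed
      qed
      show "\<forall>y\<in>edges T. \<forall>b. end_of T b y \<in> V' \<longrightarrow> y \<in> L \<union> set ys"
      proof (intro ballI allI impI)
        fix y b assume y: "y \<in> edges T" "end_of T b y \<in> V'"
        show "y \<in> L \<union> set ys"
        proof (cases "end_of T b y \<in> Vis")
          case True
          then show ?thesis using less.prems(6) y(1) by blast
        next
          case False
          then have yv: "end_of T b y = v" using y by (simp add: V'_def)
          then have "b = c" using plane_tree_end_of_eq[OF T y(1) x, of b c] by (simp add: v_def)
          then have "y \<in> set (x # ys)" using orb(4) y(1) yv by blast
          then show ?thesis using xL by auto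
        qed
      qed
    qed
    have w_st: "traces (rot_of T) (d # w) st" if "traces (rot_of T) w st''" for w
      using that orb(1,2) by (simp add: Cons p st''_def ys_def comp_def)
    have snd_st'': "map snd st'' = replicate (d - 1) (\<not> c) @ map snd st'"
      by (simp add: st''_def ys_def comp_def map_replicate_const)
    note rest = rest_degrees_insert[OF T vside vVis, folded d_def V'_def]
    show ?thesis
    proof (cases c)
      case True
      have "d \<in># mset \<beta>" using rest(1) less.prems(9) True by simp
      then have d: "d \<in> set \<beta>" by simp
      have "mset (remove1 d \<beta>) = rest_degrees T True V'" using rest(1) less.prems(9) True by simp
      moreover have "mset \<alpha> = rest_degrees T False V'" using rest(2) less.prems(8) True by simp
      ultimately obtain w where w: "w \<in> set (words \<alpha> (remove1 d \<beta>) (map snd st''))" "traces (rot_of T) w st''"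
        using IH by blast
      have "d # w \<in> set (words \<alpha> \<beta> (map snd st))"
        using w(1) d True unfolding Cons p snd_st'' by auto
      then show ?thesis using w_st[OF w(2)] by blast
    next
      case False
      have "d \<in># mset \<alpha>" using rest(1) less.prems(8) False by simp
      then have d: "d \<in> set \<alpha>" by simp
      have "mset (remove1 d \<alpha>) = rest_degrees T False V'" using rest(1) less.prems(8) False by simp
      moreover have "mset \<beta> = rest_degrees T True V'" using rest(2) less.prems(9) False by simp
      ultimately obtain w where w: "w \<in> set (words (remove1 d \<alpha>) \<beta> (map snd st''))" "traces (rot_of T) w st''"
        using IH by blast
      have "d # w \<in> set (words \<alpha> \<beta> (map snd st))"
        using w(1) d False unfolding Cons p snd_st'' by auto
      then show ?thesis using w_st[OF w(2)] by blast
    qed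
  qed
qed

lemma plane_tree_words:
  assumes T: "plane_tree T" "passport T = (mset \<alpha>, mset \<beta>, n)" and e: "e \<in> edges T"
  shows "\<exists>w\<in>set (words \<alpha> \<beta> [False, True]). traces (rot_of T) w [(e, False), (e, True)]"
proof -
  have "\<exists>w\<in>set (words \<alpha> \<beta> (map snd [(e, False), (e, True)])). traces (rot_of T) w [(e, False), (e, True)]"
  proof (rule exploration_words[OF T(1), of "{}" _ "{e}"])
    show "subtree T ({} \<union> (\<lambda>(x, c). end_of T c x) ` set [(e, False), (e, True)]) {e}"
      using subtree.base[OF e] by simp
    show "distinct (map (\<lambda>(x, c). end_of T c x) [(e, False), (e, True)])"
      using plane_tree_end_of_eq[OF T(1) e e, of False True] by auto
    show "\<forall>y\<in>{e}. \<forall>c. end_of T c y \<in> {} \<or> (y, c) \<in> set [(e, False), (e, True)]"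
      by (simp add: all_bool_eq)
  qed (use T(2) in \<open>auto simp: passport_def black_degrees_def white_degrees_def rest_degrees_def
        side_def vdegree_def[abs_def] end_of_def\<close>)
  then show ?thesis by simp
qed

section \<open>Labelled trees given by tables\<close>

definition tab :: "nat list \<Rightarrow> nat \<Rightarrow> nat" where
  "tab l i = (if 1 \<le> i \<and> i \<le> length l then l ! (i - 1) else i)"

lemma nth_pred_image: "(\<lambda>e. l ! (e - 1)) ` {1..length l} = set l"
proof -
  have "(\<lambda>e. l ! (e - 1)) ` Suc ` {..<length l} = set l"
    by (auto simp: image_image set_conv_nth)
  then show ?thesis by (simp only: image_Suc_lessThan)
qed

lemma set_upt_1: "set [1..<Suc n] = {1..n}"
  by (simp only: set_upt atLeastLessThanSuc_atLeastAtMost)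

lemma tab_permutes:
  assumes "sort l = [1..<Suc n]"
  shows "tab l permutes {1..n}"
proof -
  have len: "length l = n" using arg_cong[OF assms, of length] by simp
  have "set (sort l) = {1..n}" unfolding assms by (rule set_upt_1)
  then have set: "set l = {1..n}" by simp
  have "tab l ` {1..n} = (\<lambda>e. l ! (e - 1)) ` {1..length l}"
    unfolding len by (intro image_cong) (simp_all add: tab_def len)
  then have im: "tab l ` {1..n} = {1..n}" by (simp only: nth_pred_image set)
  have "inj_on (tab l) {1..n}" by (rule eq_card_imp_inj_on) (simp_all only: im finite_atLeastAtMost)
  then have "bij_betw (tab l) {1..n} {1..n}" using im by (simp add: bij_betw_def)
  then show ?thesis
    by (rule bij_imp_permutes) (auto simp: tab_def len)
qed

definition mk_tree :: "nat list \<Rightarrow> nat list \<Rightarrow> nat list \<Rightarrow> nat list \<Rightarrow> labelled_tree" where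
  "mk_tree be we lb lw = \<lparr>num_edges = length lb, black = set be, white = set we,
     black_end = (\<lambda>e. be ! (e - 1)), white_end = (\<lambda>e. we ! (e - 1)),
     black_rot = tab lb, white_rot = tab lw\<rparr>"

text \<open>\<open>K\<close> bounds the number of rotation steps tried. The value 5 used below
  suffices because no vertex has a larger degree.\<close>

definition rotation_table :: "nat \<Rightarrow> nat list \<Rightarrow> nat list \<Rightarrow> bool" where
  "rotation_table K ends l \<longleftrightarrow> length ends = length l \<and> sort l = [1..<Suc (length l)] \<and>
     list_all (\<lambda>e. ends ! (tab l e - 1) = ends ! (e - 1) \<and>
       (let orb = map (\<lambda>k. (tab l ^^ k) e) [0..<K] in
        list_all (\<lambda>f. ends ! (e - 1) = ends ! (f - 1) \<longrightarrow> f \<in> set orb) [1..<Suc (length l)]))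
       [1..<Suc (length l)]"

definition degree_list :: "nat list \<Rightarrow> nat list" where
  "degree_list ends = map (\<lambda>v. length (filter (\<lambda>u. u = v) ends)) (remdups ends)"

text \<open>Every edge joins a vertex to a smaller one and every positive vertex is the larger end of
  exactly one edge; this makes the graph a tree rooted at the vertex \<open>0\<close>.\<close>

definition tree_table :: "nat \<Rightarrow> nat list \<Rightarrow> nat list \<Rightarrow> nat list \<Rightarrow> nat list \<Rightarrow> nat list \<Rightarrow> nat list \<Rightarrow> bool" where
  "tree_table K \<alpha> \<beta> be we lb lw \<longleftrightarrow> lb \<noteq> [] \<and> length lw = length lb \<and>
     rotation_table K be lb \<and> rotation_table K we lw \<and>
     list_all (\<lambda>v. v \<notin> set we) be \<and> sort (map2 max be we) = [1..<Suc (length lb)] \<and>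
     sort (degree_list be) = sort \<alpha> \<and> sort (degree_list we) = sort \<beta>"

lemma rotation_table_is_rotation:
  assumes "rotation_table K ends l"
  shows "is_rotation {1..length l} (\<lambda>e. ends ! (e - 1)) (tab l)"
proof -
  have p: "tab l permutes {1..length l}"
    using assms by (intro tab_permutes) (simp add: rotation_table_def)
  have inv: "ends ! (tab l e - 1) = ends ! (e - 1)" if "e \<in> {1..length l}" for e
    using assms that unfolding rotation_table_def list_all_iff set_upt_1 by blast
  have pow: "(tab l ^^ k) e \<in> {1..length l} \<and> ends ! ((tab l ^^ k) e - 1) = ends ! (e - 1)"
    if "e \<in> {1..length l}" for e k
  proof (induction k)
    case (Suc k)
    then show ?case using inv[of "(tab l ^^ k) e"] permutes_in_image[OF p, of "(tab l ^^ k) e"] by simp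
  qed (use that in simp)
  have "f \<in> set (map (\<lambda>k. (tab l ^^ k) e) [0..<K])"
    if "e \<in> {1..length l}" "f \<in> {1..length l}" "ends ! (e - 1) = ends ! (f - 1)" for e f
    using assms that unfolding rotation_table_def list_all_iff Let_def set_upt_1 by blast
  then have "\<exists>k. (tab l ^^ k) e = f"
    if "e \<in> {1..length l}" "f \<in> {1..length l}" "ends ! (e - 1) = ends ! (f - 1)" for e f
    using that by fastforce
  moreover have "ends ! (e - 1) = ends ! (f - 1)" if "e \<in> {1..length l}" "(tab l ^^ k) e = f" for e f k
    using pow[OF that(1), of k] that(2) by simp
  ultimately show ?thesis unfolding is_rotation_def using p by blast
qed

context
  fixes K \<alpha> \<beta> be we lb lw T
  assumes tt: "tree_table K \<alpha> \<beta> be we lb lw"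
  defines "T \<equiv> mk_tree be we lb lw"
begin

private lemma lens: "length be = length lb" "length we = length lb" "length lw = length lb"
  using tt by (auto simp: tree_table_def rotation_table_def)

private lemma fields: "edges T = {1..length lb}" "black T = set be" "white T = set we"
  "black_end T = (\<lambda>e. be ! (e - 1))" "white_end T = (\<lambda>e. we ! (e - 1))"
  "black_rot T = tab lb" "white_rot T = tab lw" "num_edges T = length lb"
  by (simp_all add: T_def mk_tree_def edges_def)

private definition "hi_end e = max (be ! (e - 1)) (we ! (e - 1))"
private definition "lo_end e = min (be ! (e - 1)) (we ! (e - 1))"

private lemma hi_bot: "{black_end T e, white_end T e} = {hi_end e, lo_end e}"
  by (auto simp: fields hi_end_def lo_end_def max_def min_def)

private lemma side_image: "black_end T ` edges T = set be" "white_end T ` edges T = set we"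
  using nth_pred_image[of be] nth_pred_image[of we] by (simp_all add: fields lens)

private lemma disjoint: "set be \<inter> set we = {}"
  using tt by (auto simp: tree_table_def list_all_iff)

private lemma lo_less_hi: "e \<in> edges T \<Longrightarrow> lo_end e < hi_end e"
  using disjoint lens unfolding hi_end_def lo_end_def fields
  by (auto simp: min_def max_def disjoint_iff) (metis Suc_le_eq Suc_pred le_neq_implies_less nth_mem)+

private lemma hi_bij: "bij_betw hi_end (edges T) {1..length lb}"
proof -
  let ?m = "map2 max be we"
  have len: "length ?m = length lb" using lens by simp
  have "set (sort ?m) = {1..length lb}" using tt set_upt_1 by (simp only: tree_table_def)
  moreover have "hi_end ` edges T = (\<lambda>e. ?m ! (e - 1)) ` {1..length ?m}"
    unfolding fields len using lens by (intro image_cong) (auto simp: hi_end_def)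
  ultimately have "hi_end ` edges T = {1..length lb}" unfolding nth_pred_image by simp
  then show ?thesis by (simp add: bij_betw_def eq_card_imp_inj_on fields)
qed

text \<open>The largest vertex of a cycle would be the larger end of both cycle edges at it, but it
  is the larger end of only one edge.\<close>

private lemma acyclic: "acyclic_graph T"
  unfolding acyclic_graph_def
proof (intro notI, elim exE conjE)
  fix vs es
  assume ne: "vs \<noteq> []" and len: "length es = length vs" and dist: "distinct vs" "distinct es"
    and es: "set es \<subseteq> edges T"
    and inc: "\<forall>i<length es. {black_end T (es ! i), white_end T (es ! i)} = {vs ! i, vs ! (Suc i mod length vs)}"
  define N where "N = length vs"
  have N: "N > 0" using ne by (simp add: N_def)
  obtain i where i: "i < N" "vs ! i = Max (set vs)"
    using Max_in[of "set vs"] ne by (auto simp: in_set_conv_nth N_def)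
  \<comment> \<open>The cycle edges at the vertex with index \<open>i\<close> are those with indices
    \<open>i\<close> and \<open>j\<close>, its cyclic predecessor.\<close>
  define j where "j = (if i = 0 then N - 1 else i - 1)"
  have j: "j < N" "Suc j mod N = i" using i N by (auto simp: j_def)
  have le: "vs ! k \<le> vs ! i" if "k < N" for k using that i by (simp add: N_def)
  have hi_i: "hi_end (es ! k) = vs ! i" if "k < N" "vs ! i \<in> {vs ! k, vs ! (Suc k mod N)}" for k
  proof -
    have "{hi_end (es ! k), lo_end (es ! k)} = {vs ! k, vs ! (Suc k mod N)}"
      using inc that(1) len by (simp add: N_def flip: hi_bot)
    moreover have "lo_end (es ! k) < hi_end (es ! k)" using es that(1) len by (intro lo_less_hi) (auto simp: N_def)
    moreover have "vs ! k \<le> vs ! i" "vs ! (Suc k mod N) \<le> vs ! i" using le that(1) N by auto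
    ultimately show ?thesis using that(2) by (auto simp: doubleton_eq_iff)
  qed
  have "hi_end (es ! i) = hi_end (es ! j)" using hi_i[of i] hi_i[of j] i j by simp
  then have "es ! i = es ! j"
    using inj_onD[OF bij_betw_imp_inj_on[OF hi_bij], of "es ! i" "es ! j"]
      subsetD[OF es nth_mem[of i es]] subsetD[OF es nth_mem[of j es]] i(1) j(1) len
    by (simp add: N_def)
  \<comment> \<open>So the cycle has length one, a loop, which is impossible since the two ends of
    an edge differ.\<close>
  then have "i = j" using dist(2) i j len by (simp add: nth_eq_iff_index_eq N_def)
  then have "{hi_end (es ! i), lo_end (es ! i)} = {vs ! i}"
    using inc i j len by (auto simp: N_def simp flip: hi_bot)
  moreover have "lo_end (es ! i) < hi_end (es ! i)" using es i len by (intro lo_less_hi) (auto simp: N_def)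
  ultimately show False by auto
qed

private lemma to_root: "v \<in> vertices T \<Longrightarrow> (v, 0) \<in> (adjacency T)\<^sup>* \<and> (0, v) \<in> (adjacency T)\<^sup>*"
proof (induction v rule: less_induct)
  case (less v)
  show ?case
  proof (cases "v = 0")
    case False
    have "v \<le> length lb"
    proof -
      obtain e where e: "e \<in> edges T" "v \<in> {hi_end e, lo_end e}"
        using less.prems unfolding vertices_def fields(2,3) side_image[symmetric] hi_bot[symmetric] by blast
      then have "v \<le> hi_end e" using lo_less_hi[of e] by auto
      moreover have "hi_end e \<in> {1..length lb}" using hi_bij e(1) by (auto simp: bij_betw_def)
      ultimately show ?thesis by simp
    qed
    then have "v \<in> hi_end ` edges T" using hi_bij False by (auto simp: bij_betw_def)
    then obtain e where e: "e \<in> edges T" "hi_end e = v" by auto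
    have "lo_end e \<in> vertices T"
      using e(1) side_image hi_bot[of e] unfolding vertices_def fields(2,3)
      by (metis (no_types, lifting) UnCI doubleton_eq_iff image_eqI)
    then have "(lo_end e, 0) \<in> (adjacency T)\<^sup>* \<and> (0, lo_end e) \<in> (adjacency T)\<^sup>*"
      using less.IH lo_less_hi[OF e(1)] e(2) by simp
    moreover have "(v, lo_end e) \<in> adjacency T" "(lo_end e, v) \<in> adjacency T"
      using e hi_bot[of e] unfolding adjacency_def by (auto simp: insert_commute)
    ultimately show ?thesis
      by (metis converse_rtrancl_into_rtrancl rtrancl_into_rtrancl)
  qed simp
qed

lemma tree_table_plane_tree: "plane_tree T"
proof -
  have "lb \<noteq> []" using tt by (simp add: tree_table_def)
  then have "be \<noteq> []" using lens by auto
  then have "connected_graph T"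
    unfolding connected_graph_def using to_root by (auto simp: vertices_def fields intro: rtrancl_trans)
  moreover have "is_rotation (edges T) (black_end T) (black_rot T)" "is_rotation (edges T) (white_end T) (white_rot T)"
    using tt rotation_table_is_rotation[of K be lb] rotation_table_is_rotation[of K we lw] lens
    by (simp_all add: fields tree_table_def)
  ultimately show ?thesis
    using acyclic side_image disjoint by (simp add: plane_tree_def fields(2,3))
qed

private lemma degrees: "image_mset (\<lambda>v. card {e \<in> {1..length l}. l ! (e - 1) = v}) (mset_set (set l)) = mset (degree_list l)"
  for l :: "nat list"
proof -
  have "card {e \<in> {1..length l}. l ! (e - 1) = v} = length (filter (\<lambda>u. u = v) l)" for v
  proof -
    have "{e \<in> {1..length l}. l ! (e - 1) = v} = Suc ` {i. i < length l \<and> l ! i = v}"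
    proof (intro subset_antisym subsetI)
      fix e assume "e \<in> {e \<in> {1..length l}. l ! (e - 1) = v}"
      then show "e \<in> Suc ` {i. i < length l \<and> l ! i = v}" by (intro image_eqI[of _ _ "e - 1"]) auto
    qed auto
    then show ?thesis by (simp add: card_image length_filter_conv_card)
  qed
  moreover have "mset_set (set l) = mset (remdups l)"
    by (simp add: mset_set_set[symmetric])
  ultimately show ?thesis by (simp add: degree_list_def)
qed

lemma tree_table_passport: "passport T = (mset \<alpha>, mset \<beta>, length lb)"
proof -
  have "mset (degree_list be) = mset \<alpha>" "mset (degree_list we) = mset \<beta>"
    using tt unfolding tree_table_def by (metis mset_sort)+
  then show ?thesis
    using degrees[of be] degrees[of we]
    by (simp add: passport_def black_degrees_def white_degrees_def fields lens)
qed

lemma tree_table_rot_of: "rot_of T = (\<lambda>c. tab (if c then lw else lb))"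
  by (auto simp: rot_of_def fields)

end

section \<open>Certificates that two trees are distinct and exhaust their passport\<close>

definition covers :: "nat list \<Rightarrow> nat list \<Rightarrow> (nat list \<times> nat list) list \<Rightarrow> bool" where
  "covers \<alpha> \<beta> Ts \<longleftrightarrow> list_all (\<lambda>w. list_all (\<lambda>(lb, lw). Suc (sum_list (map (\<lambda>d. d - 1) w)) = length lb) Ts \<and>
     list_ex (\<lambda>(lb, lw). list_ex (\<lambda>r. traces (\<lambda>c. tab (if c then lw else lb)) w [(r, False), (r, True)])
       [1..<Suc (length lb)]) Ts) (words \<alpha> \<beta> [False, True])"

definition separates :: "nat list \<Rightarrow> nat list \<Rightarrow> nat list \<Rightarrow> nat list \<Rightarrow> nat list \<Rightarrow> bool" where
  "separates w lb lw lb' lw' \<longleftrightarrow>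
     list_ex (\<lambda>r. traces (\<lambda>c. tab (if c then lw else lb)) w [(r, False), (r, True)]) [1..<Suc (length lb)] \<and>
     \<not> list_ex (\<lambda>r. traces (\<lambda>c. tab (if c then lw' else lb')) w [(r, False), (r, True)]) [1..<Suc (length lb')]"

text \<open>Exploration uses only the rotations, so an isomorphism carries it along. A word read in
  just one of two trees therefore separates them.\<close>

lemma rot_iso_traces:
  assumes S: "plane_tree S" and \<phi>: "rot_iso S T \<phi>"
  shows "fst ` set st \<subseteq> edges S \<Longrightarrow> traces (rot_of S) w st \<Longrightarrow> traces (rot_of T) w (map (\<lambda>(x, c). (\<phi> x, c)) st)"
proof (induction "rot_of S" w st rule: traces.induct)
  case (3 d w x c st)
  have x: "x \<in> edges S" using 3 by simp
  note pow = rot_iso_funpow[OF S \<phi> x]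
  have "traces (rot_of T) w (map (\<lambda>(x, c). (\<phi> x, c)) (map (\<lambda>k. ((rot_of S c ^^ k) x, \<not> c)) [1..<d] @ st))"
    using 3 pow(2) by (intro 3(1)) auto
  then show ?case using 3(3) pow by (simp add: comp_def)
qed auto

lemma trees_of_tables:
  assumes S: "tree_table K \<alpha> \<beta> be we lb lw" and S': "tree_table K \<alpha> \<beta> be' we' lb' lw'"
    and len: "length lb' = length lb"
    and cov: "covers \<alpha> \<beta> [(lb, lw), (lb', lw')]" and sep: "separates w lb lw lb' lw'"
  defines "C \<equiv> isomorphism_relation `` {mk_tree be we lb lw}"
    and "C' \<equiv> isomorphism_relation `` {mk_tree be' we' lb' lw'}"
  shows "trees (mset \<alpha>) (mset \<beta>) (length lb) = {C, C'}" "C \<noteq> C'"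
    and "\<And>T. T \<in> C \<Longrightarrow> plane_tree T \<and> (\<exists>\<phi>. rot_iso (mk_tree be we lb lw) T \<phi>)"
    and "\<And>T. T \<in> C' \<Longrightarrow> plane_tree T \<and> (\<exists>\<phi>. rot_iso (mk_tree be' we' lb' lw') T \<phi>)"
proof -
  let ?S = "mk_tree be we lb lw" and ?S' = "mk_tree be' we' lb' lw'"
  note pS = tree_table_plane_tree[OF S] and pS' = tree_table_plane_tree[OF S']
  note passS = tree_table_passport[OF S] and passS' = tree_table_passport[OF S', unfolded len]
  note rS = tree_table_rot_of[OF S, symmetric] and rS' = tree_table_rot_of[OF S', symmetric]
  have nS: "num_edges ?S = length lb" "num_edges ?S' = length lb" using len by (simp_all add: mk_tree_def)
  have n: "length lb \<noteq> 0" using S by (simp add: tree_table_def)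
  have noniso: "\<not> rot_iso ?S ?S' \<phi>" for \<phi>
  proof
    assume \<phi>: "rot_iso ?S ?S' \<phi>"
    obtain r where r: "r \<in> edges ?S" "traces (rot_of ?S) w [(r, False), (r, True)]"
      using sep unfolding separates_def list_ex_iff rS set_upt_1 edges_def nS by blast
    have "traces (rot_of ?S') w [(\<phi> r, False), (\<phi> r, True)]"
      using rot_iso_traces[OF pS \<phi> _ r(2)] r(1) by simp
    moreover have "\<phi> r \<in> edges ?S'" using \<phi> r(1) by (auto simp: rot_iso_def bij_betw_def)
    ultimately show False
      using sep unfolding separates_def list_ex_iff rS' set_upt_1 edges_def nS len by blast
  qed
  have all: "\<exists>\<phi>. rot_iso ?S T \<phi> \<or> rot_iso ?S' T \<phi>"
    if T: "plane_tree T" "passport T = (mset \<alpha>, mset \<beta>, length lb)" for T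
  proof -
    have nT: "num_edges T = length lb" using T(2) by (simp add: passport_def)
    then have e: "1 \<in> edges T" using n by (simp add: edges_def Suc_le_eq)
    obtain w where w: "w \<in> set (words \<alpha> \<beta> [False, True])" "traces (rot_of T) w [(1, False), (1, True)]"
      using plane_tree_words[OF T e] by blast
    note cw = bspec[OF cov[unfolded covers_def list_all_iff list_ex_iff set_upt_1] w(1)]
    have *: "Suc (sum_list (map (\<lambda>d. d - 1) w)) = length lb"
      "(\<exists>r\<in>edges ?S. traces (rot_of ?S) w [(r, False), (r, True)]) \<or>
       (\<exists>r\<in>edges ?S'. traces (rot_of ?S') w [(r, False), (r, True)])"
      unfolding tree_table_rot_of[OF S] tree_table_rot_of[OF S'] edges_def nS
      using cw len by (simp_all del: traces.simps)
    from *(2) show ?thesis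
    proof
      assume "\<exists>r\<in>edges ?S. traces (rot_of ?S) w [(r, False), (r, True)]"
      then obtain r where "r \<in> edges ?S" "traces (rot_of ?S) w [(r, False), (r, True)]" by blast
      from same_traces_rot_iso[OF pS T(1) _ _ this e w(2)] *(1) nT show ?thesis by (auto simp: nS)
    next
      assume "\<exists>r\<in>edges ?S'. traces (rot_of ?S') w [(r, False), (r, True)]"
      then obtain r where "r \<in> edges ?S'" "traces (rot_of ?S') w [(r, False), (r, True)]" by blast
      from same_traces_rot_iso[OF pS' T(1) _ _ this e w(2)] *(1) nT show ?thesis by (auto simp: nS)
    qed
  qed
  note res = trees_eq_pair[OF n pS passS pS' passS' noniso all, folded C_def C'_def]
  show "trees (mset \<alpha>) (mset \<beta>) (length lb) = {C, C'}" "C \<noteq> C'" using res(1,2) by blast+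
  show "\<And>T. T \<in> C \<Longrightarrow> plane_tree T \<and> (\<exists>\<phi>. rot_iso ?S T \<phi>)"
    "\<And>T. T \<in> C' \<Longrightarrow> plane_tree T \<and> (\<exists>\<phi>. rot_iso ?S' T \<phi>)" using res(3,4) by blast+
qed

lemma rot_iso_monodromy:
  assumes S: "plane_tree S" and T: "plane_tree T" and \<phi>: "rot_iso S T \<phi>"
  shows "monodromy_group S \<cong> monodromy_group T"
proof -
  have bij: "bij_betw \<phi> (edges S) (edges T)" using \<phi> by (simp add: rot_iso_def)
  define n where "n = num_edges S"
  have nT: "num_edges T = n" using bij_betw_same_card[OF bij] by (simp add: n_def)
  have E: "edges S = {1..n}" "edges T = {1..n}" by (simp_all add: edges_def nT n_def)
  \<comment> \<open>The permutations in \<open>sym_group n\<close> are functions on all numbers, so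
    \<open>\<phi>\<close> is extended by the identity before conjugating with it.\<close>
  define q where "q i = (if i \<in> {1..n} then \<phi> i else i)" for i
  have "bij_betw q {1..n} {1..n}"
    using bij unfolding E by (subst bij_betw_cong[of _ _ \<phi>]) (auto simp: q_def)
  then have q: "q permutes {1..n}"
    by (rule bij_imp_permutes) (auto simp: q_def)
  note qb = permutes_bij[OF q]
  let ?G = "sym_group n"
  interpret G: group ?G by (rule sym_group_is_group)
  define h where "h p = q \<circ> p \<circ> inv' q" for p
  have qq: "inv' q \<circ> q = id" "q \<circ> inv' q = id"
    using permutes_inv_o[OF q] by auto
  have hom: "h \<in> hom ?G ?G"
  proof (rule homI)
    show "h p \<in> carrier ?G" if "p \<in> carrier ?G" for p
      using that q by (simp add: sym_group_carrier h_def permutes_compose permutes_inv)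
    show "h (p \<otimes>\<^bsub>?G\<^esub> r) = h p \<otimes>\<^bsub>?G\<^esub> h r" for p r
      using qq by (simp add: sym_group_mult h_def fun_eq_iff)
  qed
  interpret h: group_hom ?G ?G h
    by unfold_locales (rule hom)
  have "bij_betw h (carrier ?G) (carrier ?G)"
  proof (rule bij_betwI[where g = "\<lambda>p. inv' q \<circ> p \<circ> q"])
    show "h \<in> carrier ?G \<rightarrow> carrier ?G" using hom by (simp add: hom_def)
    show "(\<lambda>p. inv' q \<circ> p \<circ> q) \<in> carrier ?G \<rightarrow> carrier ?G"
      using q by (simp add: sym_group_carrier permutes_compose permutes_inv)
  qed (use qq in \<open>simp_all add: h_def fun_eq_iff\<close>)
  then have iso: "h \<in> iso ?G ?G" using hom by (simp add: iso_def)
  have perm: "rot_of S c permutes {1..n}" "rot_of T c permutes {1..n}" for c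
    using plane_tree_rot_of(1)[OF S, of c] plane_tree_rot_of(1)[OF T, of c] by (simp_all add: E)
  have conj: "h (rot_of S c) = rot_of T c" for c
  proof -
    have "q (rot_of S c i) = rot_of T c (q i)" for i
    proof (cases "i \<in> {1..n}")
      case True
      then have "rot_of S c i \<in> {1..n}" by (simp only: permutes_in_image[OF perm(1)])
      then show ?thesis using \<phi> True by (simp add: rot_iso_def q_def E)
    next
      case False
      then have "q i = i" by (simp only: q_def if_False)
      then show ?thesis using permutes_not_in[OF perm(1) False] permutes_not_in[OF perm(2) False] by simp
    qed
    then show ?thesis using qq(2) by (simp add: h_def fun_eq_iff)
  qed
  have "h ` {black_rot S, white_rot S} = {black_rot T, white_rot T}"
    using conj[of False] conj[of True] by (simp add: rot_of_def)
  moreover have "{black_rot S, white_rot S} \<subseteq> carrier ?G"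
    using perm(1)[of False] perm(1)[of True] by (simp add: rot_of_def sym_group_carrier)
  ultimately have "h \<in> iso (monodromy_group S) (monodromy_group T)"
    using h.iso_between_subgroups[OF iso] unfolding monodromy_group_def nT n_def[symmetric] by blast
  then show ?thesis by (rule is_isoI)
qed

section \<open>The twelve trees\<close>

definition covered_by where
  "covered_by hs \<alpha> \<beta> lb lw lb' lw' \<longleftrightarrow>
     (let ws = words \<alpha> \<beta> [False, True] in length ws = length hs \<and>
      list_all (\<lambda>(w, b, r). Suc (sum_list (map (\<lambda>d. d - 1) w)) = length lb \<and> length lb' = length lb \<and>
        r \<in> set [1..<Suc (length lb)] \<and>
        traces (\<lambda>c. tab (if b then if c then lw' else lb' else if c then lw else lb)) w [(r, False), (r, True)])
       (zip ws hs))"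

text \<open>The simplifier does not evaluate disjunctions lazily, so searching for a tree and an edge that trace
  each word would be too slow; the list \<open>hs\<close> supplies them.\<close>

lemma covers_if_covered_by:
  assumes "covered_by hs \<alpha> \<beta> lb lw lb' lw'"
  shows "covers \<alpha> \<beta> [(lb, lw), (lb', lw')]"
  unfolding covers_def list_all_iff[of _ "words \<alpha> \<beta> [False, True]"]
proof
  fix w assume w: "w \<in> set (words \<alpha> \<beta> [False, True])"
  have len: "length (words \<alpha> \<beta> [False, True]) = length hs"
    using assms unfolding covered_by_def Let_def by (rule conjunct1)
  obtain h where h: "(w, h) \<in> set (zip (words \<alpha> \<beta> [False, True]) hs)"
    using in_set_impl_in_set_zip1[OF len w] by blast
  obtain b r where "h = (b, r)" by (cases h)
  then have *: "Suc (sum_list (map (\<lambda>d. d - 1) w)) = length lb" "length lb' = length lb" "r \<in> set [1..<Suc (length lb)]"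
    "traces (\<lambda>c. tab (if b then if c then lw' else lb' else if c then lw else lb)) w [(r, False), (r, True)]"
    using assms h unfolding covered_by_def Let_def list_all_iff by (blast dest: conjunct2 bspec)+
  then have "\<exists>r\<in>set [1..<Suc (length lb)]. traces (\<lambda>c. tab (if c then lw else lb)) w [(r, False), (r, True)]" if "\<not> b"
    using that by (auto simp del: traces.simps upt_Suc)
  moreover have "\<exists>r\<in>set [1..<Suc (length lb')]. traces (\<lambda>c. tab (if c then lw' else lb')) w [(r, False), (r, True)]" if b
    using that * by (auto simp del: traces.simps upt_Suc)
  ultimately show "list_all (\<lambda>(lb, lw). Suc (sum_list (map (\<lambda>d. d - 1) w)) = length lb) [(lb, lw), (lb', lw')] \<and>
      list_ex (\<lambda>(lb, lw). list_ex (\<lambda>r. traces (\<lambda>c. tab (if c then lw else lb)) w [(r, False), (r, True)])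
        [1..<Suc (length lb)]) [(lb, lw), (lb', lw')]"
    using *(1,2) by (cases b) (simp_all del: traces.simps upt_Suc add: list_ex_iff)
qed

text \<open>Edge labels are the binary codes of the nonzero vectors of a three-dimensional space
  over the field with two elements, chosen so that both rotations are linear.\<close>

definition black_rot1 :: "nat list" where
  "black_rot1 = [1, 4, 5, 6, 7, 2, 3]"

definition white_rot1 :: "nat list" where
  "white_rot1 = [2, 1, 3, 4, 6, 5, 7]"

definition black_ends1 :: "nat list" where
  "black_ends1 = [4, 0, 5, 0, 5, 0, 5]"

definition white_ends1 :: "nat list" where
  "white_ends1 = [1, 1, 7, 2, 3, 3, 6]"

definition black_rot1' :: "nat list" where
  "black_rot1' = [1, 6, 7, 2, 3, 4, 5]"

definition black_ends1' :: "nat list" where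
  "black_ends1' = [4, 0, 5, 0, 5, 0, 5]"

definition white_ends1' :: "nat list" where
  "white_ends1' = [1, 1, 6, 3, 2, 2, 7]"

lemma tables1:
  "tree_table 5 [3, 3, 1] [2, 2, 1, 1, 1] black_ends1 white_ends1 black_rot1 white_rot1"
  "tree_table 5 [3, 3, 1] [2, 2, 1, 1, 1] black_ends1' white_ends1' black_rot1' white_rot1"
  "separates [1, 2, 3, 1, 2, 3, 1, 1] black_rot1 white_rot1 black_rot1' white_rot1"
  by code_simp+

lemma covers1:
  "covers [3, 3, 1] [2, 2, 1, 1, 1] [(black_rot1, white_rot1), (black_rot1', white_rot1)]"
  by (rule covers_if_covered_by[where hs = "[(False, 3), (True, 7), (False, 4), (True, 2), (True, 4), (False, 6), (False, 7), (True, 3), (False, 2),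
       (True, 6), (False, 5), (True, 5), (True, 1), (False, 1)]"])
    code_simp

definition black_rot2 :: "nat list" where
  "black_rot2 = [2, 1, 4, 3, 6, 7, 5]"

definition white_rot2 :: "nat list" where
  "white_rot2 = [3, 2, 1, 5, 4, 6, 7]"

definition black_ends2 :: "nat list" where
  "black_ends2 = [6, 6, 4, 4, 0, 0, 0]"

definition white_ends2 :: "nat list" where
  "white_ends2 = [5, 7, 5, 1, 1, 2, 3]"

definition black_rot2' :: "nat list" where
  "black_rot2' = [2, 1, 4, 5, 3, 7, 6]"

definition white_rot2' :: "nat list" where
  "white_rot2' = [3, 2, 1, 4, 6, 5, 7]"

definition black_ends2' :: "nat list" where
  "black_ends2' = [4, 4, 0, 0, 0, 5, 5]"

definition white_ends2' :: "nat list" where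
  "white_ends2' = [1, 6, 1, 2, 3, 3, 7]"

lemma tables2:
  "tree_table 5 [3, 2, 2] [2, 2, 1, 1, 1] black_ends2 white_ends2 black_rot2 white_rot2"
  "tree_table 5 [3, 2, 2] [2, 2, 1, 1, 1] black_ends2' white_ends2' black_rot2' white_rot2'"
  "separates [2, 1, 2, 2, 2, 3, 1, 1] black_rot2 white_rot2 black_rot2' white_rot2'"
  by code_simp+

lemma covers2:
  "covers [3, 2, 2] [2, 2, 1, 1, 1] [(black_rot2, white_rot2), (black_rot2', white_rot2')]"
  by (rule covers_if_covered_by[where hs = "[(False, 7), (True, 4), (True, 5), (False, 6), (True, 3), (False, 5), (True, 7), (True, 2), (False, 3),
       (False, 2), (False, 4), (True, 6), (True, 1), (False, 1)]"])
    code_simp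

text \<open>Edge labels are codes of the points of the projective line over the field with eight
  elements, 9 being infinity; \<open>white_rot3\<close> is then x -> x + 1.\<close>

definition black_rot3 :: "nat list" where
  "black_rot3 = [5, 3, 8, 4, 9, 6, 7, 2, 1]"

definition white_rot3 :: "nat list" where
  "white_rot3 = [2, 1, 4, 3, 6, 5, 8, 7, 9]"

definition black_ends3 :: "nat list" where
  "black_ends3 = [0, 4, 4, 8, 0, 5, 9, 4, 0]"

definition white_ends3 :: "nat list" where
  "white_ends3 = [1, 1, 6, 6, 2, 2, 7, 7, 3]"

definition black_rot3' :: "nat list" where
  "black_rot3' = [9, 8, 2, 4, 1, 6, 7, 3, 5]"

definition black_ends3' :: "nat list" where
  "black_ends3' = [0, 4, 4, 9, 0, 5, 8, 4, 0]"

definition white_ends3' :: "nat list" where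
  "white_ends3' = [1, 1, 7, 7, 3, 3, 6, 6, 2]"

lemma tables3:
  "tree_table 5 [3, 3, 1, 1, 1] [2, 2, 2, 2, 1] black_ends3 white_ends3 black_rot3 white_rot3"
  "tree_table 5 [3, 3, 1, 1, 1] [2, 2, 2, 2, 1] black_ends3' white_ends3' black_rot3' white_rot3"
  "separates [1, 2, 3, 1, 2, 3, 2, 1, 2, 1] black_rot3 white_rot3 black_rot3' white_rot3"
  by code_simp+

lemma covers3:
  "covers [3, 3, 1, 1, 1] [2, 2, 2, 2, 1] [(black_rot3, white_rot3), (black_rot3', white_rot3)]"
  by (rule covers_if_covered_by[where hs = "[(False, 9), (True, 5), (False, 8), (True, 3), (True, 9), (False, 3), (True, 8), (False, 2), (True, 2),
       (False, 1), (False, 5), (True, 1), (True, 6), (False, 7), (True, 4), (False, 4), (True, 7), (False, 6)]"])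
    code_simp

text \<open>Edges i and i + 5 share a white vertex, and the edges 1 to 5 and 6 to 10 are the two
  blocks. The same labelling, with 10 and 13 in place of 5, is used for \<open>black_rot5'\<close>
  and \<open>black_rot6\<close>.\<close>

definition black_rot4 :: "nat list" where
  "black_rot4 = [2, 1, 3, 4, 5, 8, 9, 6, 10, 7]"

definition white_rot4 :: "nat list" where
  "white_rot4 = [6, 7, 8, 9, 10, 1, 2, 3, 4, 5]"

definition black_ends4 :: "nat list" where
  "black_ends4 = [4, 4, 10, 5, 6, 8, 0, 8, 0, 0]"

definition white_ends4 :: "nat list" where
  "white_ends4 = [7, 1, 9, 2, 3, 7, 1, 9, 2, 3]"

definition black_rot4' :: "nat list" where
  "black_rot4' = [2, 3, 1, 4, 5, 9, 7, 10, 6, 8]"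

definition black_ends4' :: "nat list" where
  "black_ends4' = [0, 0, 0, 9, 10, 4, 5, 6, 4, 6]"

definition white_ends4' :: "nat list" where
  "white_ends4' = [1, 2, 3, 7, 8, 1, 2, 3, 7, 8]"

lemma tables4:
  "tree_table 5 [3, 2, 2, 1, 1, 1] [2, 2, 2, 2, 2] black_ends4 white_ends4 black_rot4 white_rot4"
  "tree_table 5 [3, 2, 2, 1, 1, 1] [2, 2, 2, 2, 2] black_ends4' white_ends4' black_rot4' white_rot4"
  "separates [1, 2, 2, 2, 2, 2, 3, 2, 1, 2, 1] black_rot4 white_rot4 black_rot4' white_rot4"
  by code_simp+

lemma covers4:
  "covers [3, 2, 2, 1, 1, 1] [2, 2, 2, 2, 2] [(black_rot4, white_rot4), (black_rot4', white_rot4)]"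
  by (rule covers_if_covered_by[where hs = "[(False, 10), (True, 2), (True, 3), (False, 9), (True, 1), (False, 7), (True, 10), (True, 9), (False, 1),
       (False, 8), (False, 2), (True, 8), (True, 6), (False, 6), (False, 5), (True, 7), (False, 4), (True, 5),
       (True, 4), (False, 3)]"])
    code_simp

text \<open>Edge i + 10 is the image of edge i under the half-turn about the black vertex 0, whose
  edges are 1, 2, 11, 12 in cyclic order. On the ten pairs {i, i + 10} the blocks are 1 to 5 and 6
  to 10, exchanged by the white rotation.\<close>

definition black_rot5 :: "nat list" where
  "black_rot5 = [2, 11, 3, 4, 5, 8, 7, 9, 10, 6, 12, 1, 13, 14, 15, 18, 17, 19, 20, 16]"

definition white_rot5 :: "nat list" where
  "white_rot5 = [6, 7, 8, 9, 10, 1, 2, 3, 4, 5, 16, 17, 18, 19, 20, 11, 12, 13, 14, 15]"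

definition black_ends5 :: "nat list" where
  "black_ends5 = [0, 0, 15, 16, 17, 5, 6, 5, 5, 5, 0, 0, 18, 19, 20, 7, 8, 7, 7, 7]"

definition white_ends5 :: "nat list" where
  "white_ends5 = [1, 2, 9, 10, 11, 1, 2, 9, 10, 11, 3, 4, 12, 13, 14, 3, 4, 12, 13, 14]"

definition black_rot5' :: "nat list" where
  "black_rot5' = [2, 3, 4, 1, 5, 6, 7, 8, 9, 10, 15, 12, 13, 18, 16, 17, 11, 19, 20, 14]"

definition white_rot5' :: "nat list" where
  "white_rot5' = [11, 12, 13, 14, 15, 16, 17, 18, 19, 20, 1, 2, 3, 4, 5, 6, 7, 8, 9, 10]"

definition black_ends5' :: "nat list" where
  "black_ends5' = [0, 0, 0, 0, 15, 16, 17, 18, 19, 20, 5, 6, 7, 8, 5, 5, 5, 8, 8, 8]"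

definition white_ends5' :: "nat list" where
  "white_ends5' = [1, 2, 3, 4, 9, 10, 11, 12, 13, 14, 1, 2, 3, 4, 9, 10, 11, 12, 13, 14]"

lemma tables5:
  "tree_table 5 [4, 4, 4, 1, 1, 1, 1, 1, 1, 1, 1] [2, 2, 2, 2, 2, 2, 2, 2, 2, 2] black_ends5 white_ends5 black_rot5 white_rot5"
  "tree_table 5 [4, 4, 4, 1, 1, 1, 1, 1, 1, 1, 1] [2, 2, 2, 2, 2, 2, 2, 2, 2, 2] black_ends5' white_ends5' black_rot5' white_rot5'"
  "separates [1, 2, 4, 2, 1, 2, 1, 2, 4, 2, 1, 2, 4, 2, 1, 2, 1, 2, 1, 2, 1] black_rot5 white_rot5 black_rot5' white_rot5'"
  by code_simp+

lemma covers5: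
  "covers [4, 4, 4, 1, 1, 1, 1, 1, 1, 1, 1] [2, 2, 2, 2, 2, 2, 2, 2, 2, 2] [(black_rot5, white_rot5), (black_rot5', white_rot5')]"
  by (rule covers_if_covered_by[where hs = "[(True, 20), (False, 10), (True, 17), (True, 3), (False, 2), (True, 4), (True, 19), (False, 9), (True,
       16), (True, 2), (False, 1), (True, 18), (False, 8), (True, 15), (True, 1), (True, 14), (False, 6), (True,
       11), (True, 10), (False, 5), (True, 7), (True, 13), (False, 7), (True, 9), (False, 4), (True, 6), (True,
       12), (True, 8), (False, 3), (True, 5)]"])
    code_simp

definition black_rot6 :: "nat list" where
  "black_rot6 = [2, 3, 4, 5, 1, 6, 7, 8, 9, 10, 11, 12, 13, 19, 15, 16, 17, 23, 20, 21, 22, 14, 24, 25, 26, 18]"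

definition white_rot6 :: "nat list" where
  "white_rot6 = [14, 15, 16, 17, 18, 19, 20, 21, 22, 23, 24, 25, 26, 1, 2, 3, 4, 5, 6, 7, 8, 9, 10, 11, 12, 13]"

definition black_ends6 :: "nat list" where
  "black_ends6 = [0, 0, 0, 0, 0, 19, 20, 21, 22, 23, 24, 25, 26, 6, 7, 8, 9, 10, 6, 6, 6, 6, 10, 10, 10, 10]"

definition white_ends6 :: "nat list" where
  "white_ends6 = [1, 2, 3, 4, 5, 11, 12, 13, 14, 15, 16, 17, 18, 1, 2, 3, 4, 5, 11, 12, 13, 14, 15, 16, 17, 18]"

definition black_rot6' :: "nat list" where
  "black_rot6' = [2, 3, 4, 5, 1, 6, 7, 8, 9, 10, 11, 12, 13, 19, 15, 16, 23, 18, 20, 21, 22, 14, 24, 25, 26, 17]"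

definition black_ends6' :: "nat list" where
  "black_ends6' = [0, 0, 0, 0, 0, 19, 20, 21, 22, 23, 24, 25, 26, 6, 7, 8, 9, 10, 6, 6, 6, 6, 9, 9, 9, 9]"

definition white_ends6' :: "nat list" where
  "white_ends6' = [1, 2, 3, 4, 5, 11, 12, 13, 14, 15, 16, 17, 18, 1, 2, 3, 4, 5, 11, 12, 13, 14, 15, 16, 17, 18]"

lemma tables6:
  "tree_table 5 [5, 5, 5, 1, 1, 1, 1, 1, 1, 1, 1, 1, 1, 1] [2, 2, 2, 2, 2, 2, 2, 2, 2, 2, 2, 2, 2] black_ends6 white_ends6 black_rot6 white_rot6"
  "tree_table 5 [5, 5, 5, 1, 1, 1, 1, 1, 1, 1, 1, 1, 1, 1] [2, 2, 2, 2, 2, 2, 2, 2, 2, 2, 2, 2, 2] black_ends6' white_ends6' black_rot6' white_rot6"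
  "separates [1, 2, 5, 2, 1, 2, 1, 2, 1, 2, 5, 2, 1, 2, 1, 2, 1, 2, 5, 2, 1, 2, 1, 2, 1, 2, 1] black_rot6 white_rot6 black_rot6' white_rot6"
  by code_simp+

lemma covers6:
  "covers [5, 5, 5, 1, 1, 1, 1, 1, 1, 1, 1, 1, 1, 1] [2, 2, 2, 2, 2, 2, 2, 2, 2, 2, 2, 2, 2] [(black_rot6, white_rot6), (black_rot6', white_rot6)]"
  by (rule covers_if_covered_by[where hs = "[(False, 26), (True, 26), (True, 22), (False, 22), (False, 4), (True, 3), (True, 5), (False, 5), (False,
       25), (True, 25), (True, 21), (False, 21), (False, 3), (True, 2), (True, 4), (False, 24), (True, 24),
       (True, 20), (False, 20), (False, 2), (True, 1), (False, 23), (True, 23), (True, 19), (False, 19), (False,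
       1), (False, 18), (True, 17), (True, 14), (False, 14), (False, 13), (True, 13), (True, 9), (False, 9),
       (False, 17), (True, 16), (True, 18), (False, 12), (True, 12), (True, 8), (False, 8), (False, 16), (True,
       15), (False, 11), (True, 11), (True, 7), (False, 7), (False, 15), (False, 10), (True, 10), (True, 6),
       (False, 6)]"])
    code_simp

section \<open>Internal semidirect products\<close>

lemma semidirect_product_simps [simp]:
  "carrier (semidirect_product N H \<theta>) = carrier N \<times> carrier H"
  "(a, h) \<otimes>\<^bsub>semidirect_product N H \<theta>\<^esub> (b, k) = (a \<otimes>\<^bsub>N\<^esub> \<theta> h b, h \<otimes>\<^bsub>H\<^esub> k)"
  "\<one>\<^bsub>semidirect_product N H \<theta>\<^esub> = (\<one>\<^bsub>N\<^esub>, \<one>\<^bsub>H\<^esub>)"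
  by (simp_all add: semidirect_product_def)

text \<open>The action is conjugation in K, pulled back to N along the injection \<open>f\<close>;
  with it the product map into K is multiplicative. That map is kept in the conclusion because it is
  used once more as an embedding when products are nested.\<close>

lemma internal_semidirect_product:
  assumes K: "group K" and N: "group N" and H: "group H"
    and f: "f \<in> hom N K" "inj_on f (carrier N)" and h: "h \<in> hom H K" "inj_on h (carrier H)"
    and normalised: "\<And>x n. x \<in> carrier H \<Longrightarrow> n \<in> carrier N \<Longrightarrow>
      h x \<otimes>\<^bsub>K\<^esub> f n \<otimes>\<^bsub>K\<^esub> inv\<^bsub>K\<^esub> h x \<in> f ` carrier N"
    and disjoint: "\<And>x n. x \<in> carrier H \<Longrightarrow> n \<in> carrier N \<Longrightarrow> f n = h x \<Longrightarrow> x = \<one>\<^bsub>H\<^esub>"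
  obtains \<theta> where "\<theta> \<in> hom H (AutoGroup N)" "group (semidirect_product N H \<theta>)"
    "(\<lambda>(n, x). f n \<otimes>\<^bsub>K\<^esub> h x) \<in> hom (semidirect_product N H \<theta>) K"
    "inj_on (\<lambda>(n, x). f n \<otimes>\<^bsub>K\<^esub> h x) (carrier N \<times> carrier H)"
proof -
  interpret K: group K by fact
  interpret N: group N by fact
  interpret H: group H by fact
  interpret f: group_hom N K f by unfold_locales (rule f)
  interpret h: group_hom H K h by unfold_locales (rule h)
  have cancel: "inv\<^bsub>K\<^esub> a \<otimes>\<^bsub>K\<^esub> (a \<otimes>\<^bsub>K\<^esub> b) = b" if "a \<in> carrier K" "b \<in> carrier K" for a b
    using that by (simp flip: K.m_assoc)
  \<comment> \<open>The restriction to the carrier matters: the elements of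
    \<open>AutoGroup N\<close> are extensional functions.\<close>
  define \<theta> where "\<theta> x = (\<lambda>n\<in>carrier N. inv_into (carrier N) f (h x \<otimes>\<^bsub>K\<^esub> f n \<otimes>\<^bsub>K\<^esub> inv\<^bsub>K\<^esub> h x))" for x
  have \<theta>N: "\<theta> x n \<in> carrier N" and f\<theta>: "f (\<theta> x n) = h x \<otimes>\<^bsub>K\<^esub> f n \<otimes>\<^bsub>K\<^esub> inv\<^bsub>K\<^esub> h x"
    if "x \<in> carrier H" "n \<in> carrier N" for x n
    using normalised[OF that] that by (simp_all add: \<theta>_def inv_into_into f_inv_into_f)
  have fI: "n = n'" if "f n = f n'" "n \<in> carrier N" "n' \<in> carrier N" for n n'
    using f(2) that by (rule inj_onD)
  have \<theta>_mult: "\<theta> x (n \<otimes>\<^bsub>N\<^esub> n') = \<theta> x n \<otimes>\<^bsub>N\<^esub> \<theta> x n'"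
    if "x \<in> carrier H" "n \<in> carrier N" "n' \<in> carrier N" for x n n'
  proof (rule fI)
    show "f (\<theta> x (n \<otimes>\<^bsub>N\<^esub> n')) = f (\<theta> x n \<otimes>\<^bsub>N\<^esub> \<theta> x n')"
      using that by (simp add: f\<theta> \<theta>N K.m_assoc cancel)
  qed (use that \<theta>N in auto)
  have \<theta>_comp: "\<theta> (x \<otimes>\<^bsub>H\<^esub> y) n = \<theta> x (\<theta> y n)"
    if "x \<in> carrier H" "y \<in> carrier H" "n \<in> carrier N" for x y n
  proof (rule fI)
    show "f (\<theta> (x \<otimes>\<^bsub>H\<^esub> y) n) = f (\<theta> x (\<theta> y n))"
      using that by (simp add: f\<theta> \<theta>N K.m_assoc K.inv_mult_group)
  qed (use that \<theta>N in auto)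
  have \<theta>_one: "\<theta> \<one>\<^bsub>H\<^esub> n = n" if "n \<in> carrier N" for n
    using that by (intro fI) (simp_all add: f\<theta> \<theta>N)
  have \<theta>_auto: "\<theta> x \<in> auto N" if x: "x \<in> carrier H" for x
  proof -
    have "bij_betw (\<theta> x) (carrier N) (carrier N)"
      by (rule bij_betwI[where g = "\<theta> (inv\<^bsub>H\<^esub> x)"])
        (use x \<theta>N \<theta>_comp[of x "inv\<^bsub>H\<^esub> x"] \<theta>_comp[of "inv\<^bsub>H\<^esub> x" x] in \<open>auto simp: \<theta>_one\<close>)
    moreover have "\<theta> x \<in> hom N N" using x \<theta>N \<theta>_mult by (auto intro: homI)
    ultimately show ?thesis by (simp add: auto_def Bij_def \<theta>_def)
  qed
  have "\<theta> \<in> hom H (AutoGroup N)"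
  proof (rule homI)
    show "\<theta> x \<in> carrier (AutoGroup N)" if "x \<in> carrier H" for x
      using \<theta>_auto[OF that] by (simp add: AutoGroup_def)
    show "\<theta> (x \<otimes>\<^bsub>H\<^esub> y) = \<theta> x \<otimes>\<^bsub>AutoGroup N\<^esub> \<theta> y" if xy: "x \<in> carrier H" "y \<in> carrier H" for x y
    proof -
      have Bij: "\<theta> x \<in> Bij (carrier N)" "\<theta> y \<in> Bij (carrier N)" using \<theta>_auto xy by (auto simp: auto_def)
      have "\<theta> (x \<otimes>\<^bsub>H\<^esub> y) = compose (carrier N) (\<theta> x) (\<theta> y)"
      proof
        fix n show "\<theta> (x \<otimes>\<^bsub>H\<^esub> y) n = compose (carrier N) (\<theta> x) (\<theta> y) n"
          by (cases "n \<in> carrier N") (simp_all add: \<theta>_comp xy compose_def, simp add: \<theta>_def)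
      qed
      then show ?thesis using Bij by (simp add: AutoGroup_def BijGroup_def)
    qed
  qed
  moreover
  let ?S = "semidirect_product N H \<theta>"
  define k where "k = (\<lambda>(n, x). f n \<otimes>\<^bsub>K\<^esub> h x)"
  have kK: "k z \<in> carrier K" if "z \<in> carrier ?S" for z using that by (auto simp: k_def)
  have cl: "y \<otimes>\<^bsub>?S\<^esub> z \<in> carrier ?S" if "y \<in> carrier ?S" "z \<in> carrier ?S" for y z
    using that \<theta>N by auto
  have km: "k (y \<otimes>\<^bsub>?S\<^esub> z) = k y \<otimes>\<^bsub>K\<^esub> k z" if "y \<in> carrier ?S" "z \<in> carrier ?S" for y z
    using that by (auto simp: k_def f\<theta> \<theta>N K.m_assoc cancel)
  have khom: "k \<in> hom ?S K" using kK km by (auto intro: homI)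
  moreover have inj: "inj_on k (carrier N \<times> carrier H)"
  proof (rule inj_onI, clarify)
    fix n x n' x' assume A: "n \<in> carrier N" "n' \<in> carrier N" "x \<in> carrier H" "x' \<in> carrier H"
      and eq: "k (n, x) = k (n', x')"
    \<comment> \<open>Rearranging f n h x = f n' h x' puts one element into both images, and
      \<open>disjoint\<close> makes it trivial.\<close>
    have "f (inv\<^bsub>N\<^esub> n' \<otimes>\<^bsub>N\<^esub> n) = h (x' \<otimes>\<^bsub>H\<^esub> inv\<^bsub>H\<^esub> x)"
    proof -
      have fn: "f n = f n' \<otimes>\<^bsub>K\<^esub> (h x' \<otimes>\<^bsub>K\<^esub> inv\<^bsub>K\<^esub> h x)"
        using eq A K.inv_solve_right[of "f n" "k (n', x')" "h x"] by (simp add: k_def K.m_assoc)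
      have "f (inv\<^bsub>N\<^esub> n' \<otimes>\<^bsub>N\<^esub> n) = inv\<^bsub>K\<^esub> f n' \<otimes>\<^bsub>K\<^esub> f n" using A by simp
      also have "\<dots> = h x' \<otimes>\<^bsub>K\<^esub> inv\<^bsub>K\<^esub> h x"
        by (subst fn, rule cancel) (use A in auto)
      also have "\<dots> = h (x' \<otimes>\<^bsub>H\<^esub> inv\<^bsub>H\<^esub> x)" using A by simp
      finally show ?thesis .
    qed
    from disjoint[OF _ _ this] have "x' \<otimes>\<^bsub>H\<^esub> inv\<^bsub>H\<^esub> x = \<one>\<^bsub>H\<^esub>" using A by simp
    then have "x' = x" using A by (metis H.inv_closed H.inv_equality H.inv_inv)
    moreover from this have "f n = f n'" using eq A by (simp add: k_def)
    ultimately show "n = n' \<and> x = x'" using fI A by simp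
  qed
  \<comment> \<open>Associativity is inherited from K through the injective map
    \<open>k\<close>.\<close>
  moreover have "group ?S"
  proof (rule groupI)
    fix y z w assume yzw: "y \<in> carrier ?S" "z \<in> carrier ?S" "w \<in> carrier ?S"
    then have eq: "k ((y \<otimes>\<^bsub>?S\<^esub> z) \<otimes>\<^bsub>?S\<^esub> w) = k (y \<otimes>\<^bsub>?S\<^esub> (z \<otimes>\<^bsub>?S\<^esub> w))"
      by (simp only: km cl K.m_assoc kK)
    have "inj_on k (carrier ?S)" using inj by simp
    from inj_onD[OF this eq] show "y \<otimes>\<^bsub>?S\<^esub> z \<otimes>\<^bsub>?S\<^esub> w = y \<otimes>\<^bsub>?S\<^esub> (z \<otimes>\<^bsub>?S\<^esub> w)"
      by (simp only: cl yzw)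
  next
    fix z assume z: "z \<in> carrier ?S"
    then obtain n x where nx: "z = (n, x)" "n \<in> carrier N" "x \<in> carrier H" by auto
    show "\<one>\<^bsub>?S\<^esub> \<otimes>\<^bsub>?S\<^esub> z = z" using nx by (simp add: \<theta>_one)
    have "\<theta> (inv\<^bsub>H\<^esub> x) (inv\<^bsub>N\<^esub> n) \<otimes>\<^bsub>N\<^esub> \<theta> (inv\<^bsub>H\<^esub> x) n = \<one>\<^bsub>N\<^esub>"
    proof -
      have "\<theta> (inv\<^bsub>H\<^esub> x) \<one>\<^bsub>N\<^esub> = \<one>\<^bsub>N\<^esub>" using nx by (intro fI) (simp_all add: f\<theta> \<theta>N)
      then show ?thesis using nx \<theta>_mult[of "inv\<^bsub>H\<^esub> x" "inv\<^bsub>N\<^esub> n" n] by simp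
    qed
    then show "\<exists>y\<in>carrier ?S. y \<otimes>\<^bsub>?S\<^esub> z = \<one>\<^bsub>?S\<^esub>"
      using nx \<theta>N by (intro bexI[of _ "(\<theta> (inv\<^bsub>H\<^esub> x) (inv\<^bsub>N\<^esub> n), inv\<^bsub>H\<^esub> x)"]) simp_all
  qed (use cl in auto)
  ultimately show ?thesis using that unfolding k_def by blast
qed

lemma generated_semidirect_product:
  assumes K: "group K" and N: "group N" and H: "group H"
    and f: "f \<in> hom N K" "inj_on f (carrier N)" and h: "h \<in> hom H K" "inj_on h (carrier H)"
    and normalised: "\<And>x n. x \<in> carrier H \<Longrightarrow> n \<in> carrier N \<Longrightarrow>
      h x \<otimes>\<^bsub>K\<^esub> f n \<otimes>\<^bsub>K\<^esub> inv\<^bsub>K\<^esub> h x \<in> f ` carrier N"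
    and disjoint: "\<And>x n. x \<in> carrier H \<Longrightarrow> n \<in> carrier N \<Longrightarrow> f n = h x \<Longrightarrow> x = \<one>\<^bsub>H\<^esub>"
    and Z: "Z \<subseteq> (\<lambda>(n, x). f n \<otimes>\<^bsub>K\<^esub> h x) ` (carrier N \<times> carrier H)"
    and fZ: "f ` carrier N \<subseteq> generate K Z" and hZ: "h ` carrier H \<subseteq> generate K Z"
  shows "is_some_semidirect_product (subgroup_generated K Z) N H"
proof -
  interpret K: group K by fact
  obtain \<theta> where \<theta>: "\<theta> \<in> hom H (AutoGroup N)" and S: "group (semidirect_product N H \<theta>)"
    and k: "(\<lambda>(n, x). f n \<otimes>\<^bsub>K\<^esub> h x) \<in> hom (semidirect_product N H \<theta>) K"
      "inj_on (\<lambda>(n, x). f n \<otimes>\<^bsub>K\<^esub> h x) (carrier N \<times> carrier H)"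
    by (rule internal_semidirect_product[OF K N H f h]) (blast intro: normalised disjoint)+
  let ?S = "semidirect_product N H \<theta>"
  define k where "k = (\<lambda>(n, x). f n \<otimes>\<^bsub>K\<^esub> h x)"
  interpret k: group_hom ?S K k
    using k(1) S by (simp add: k_def group_hom_def group_hom_axioms_def K.is_group)
  have ZK: "Z \<subseteq> carrier K" using Z k.hom_closed by (fastforce simp: k_def)
  have "k ` carrier ?S = generate K Z"
  proof
    show "generate K Z \<subseteq> k ` carrier ?S"
      using Z by (intro K.generate_subgroup_incl k.img_is_subgroup) (simp add: k_def)
    show "k ` carrier ?S \<subseteq> generate K Z"
      using fZ hZ generate.eng[of _ K Z] by (auto simp: k_def)
  qed
  moreover have "k \<in> hom ?S (subgroup_generated K Z)"
    using k.homh calculation ZK by (auto simp: hom_def carrier_subgroup_generated Int_absorb1)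
  ultimately have "k \<in> iso ?S (subgroup_generated K Z)"
    using k(2) ZK by (simp add: iso_def bij_betw_def carrier_subgroup_generated Int_absorb1 k_def)
  then show ?thesis
    unfolding is_some_semidirect_product_def using \<theta> S by (metis group.iso_sym is_isoI)
qed

lemma is_some_semidirect_product_cong:
  assumes "G \<cong> G'" "group G" "is_some_semidirect_product G N H"
  shows "is_some_semidirect_product G' N H"
  using assms unfolding is_some_semidirect_product_def by (metis group.iso_sym iso_trans)

section \<open>Three-cycles\<close>

abbreviation three_cycle :: "nat \<Rightarrow> nat \<Rightarrow> nat \<Rightarrow> nat \<Rightarrow> nat" where
  "three_cycle x y z \<equiv> cycle_of_list [x, y, z]"

lemma three_cycle_rotate: "distinct [x, y, z] \<Longrightarrow> three_cycle y z x = three_cycle x y z"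
  by (auto simp: fun_eq_iff Transposition.transpose_def)

lemma inv_three_cycle: "distinct [x, y, z] \<Longrightarrow> inv' (three_cycle x y z) = three_cycle z y x"
  by (rule inv_unique_comp) (auto simp: fun_eq_iff Transposition.transpose_def)

lemma conj_three_cycle: "distinct [x, y, z] \<Longrightarrow> bij p \<Longrightarrow>
    p \<circ> three_cycle x y z \<circ> inv' p = three_cycle (p x) (p y) (p z)"
  using conjugation_of_cycle[of "[x, y, z]" p] by simp

lemma three_cycle_apply:
  assumes "distinct [x, y, z]"
  shows "three_cycle x y z x = y" "three_cycle x y z y = z" "three_cycle x y z z = x"
    "w \<notin> {x, y, z} \<Longrightarrow> three_cycle x y z w = w"
  using assms by (auto simp: Transposition.transpose_def)

text \<open>The points already linked by the three-cycles read so far.\<close>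

fun linked :: "nat list \<Rightarrow> (nat \<times> nat \<times> nat) list \<Rightarrow> nat list" where
  "linked U [] = U"
| "linked U ((x, y, z) # ts) =
     (if distinct [x, y, z] \<and> (x \<in> set U \<or> y \<in> set U \<or> z \<in> set U) then linked (x # y # z # U) ts else [])"

context
  fixes P m
  assumes P: "subgroup P (sym_group m)"
begin

private lemma closed: "p \<in> P \<Longrightarrow> q \<in> P \<Longrightarrow> p \<circ> q \<in> P"
  and closed_inv: "p \<in> P \<Longrightarrow> inv' p \<in> P" and bijP: "p \<in> P \<Longrightarrow> bij p" and permP: "p \<in> P \<Longrightarrow> p permutes {1..m}"
proof -
  show perm: "p \<in> P \<Longrightarrow> p permutes {1..m}" for p using subgroup.mem_carrier[OF P] by (simp add: sym_group_carrier)
  show "p \<in> P \<Longrightarrow> bij p" by (rule permutes_bij[OF perm])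
  show "p \<in> P \<Longrightarrow> q \<in> P \<Longrightarrow> p \<circ> q \<in> P" using subgroup.m_closed[OF P] by (simp add: sym_group_mult)
  show "p \<in> P \<Longrightarrow> inv' p \<in> P"
    using subgroup.m_inv_closed[OF P] by (metis P subgroup.mem_carrier sym_group_inv_equality)
qed

private lemma conjP: "g \<in> P \<Longrightarrow> distinct [x, y, z] \<Longrightarrow> three_cycle x y z \<in> P \<Longrightarrow> three_cycle (g x) (g y) (g z) \<in> P"
  using conj_three_cycle[of x y z g] closed closed_inv bijP by (metis (no_types, lifting))

private lemma invP: "distinct [x, y, z] \<Longrightarrow> three_cycle x y z \<in> P \<Longrightarrow> three_cycle z y x \<in> P"
  using inv_three_cycle[of x y z] closed_inv by metis

private lemma rotP: "distinct [x, y, z] \<Longrightarrow> three_cycle x y z \<in> P \<Longrightarrow> three_cycle y z x \<in> P"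
  using three_cycle_rotate[of x y z] by simp

text \<open>Some three-cycle in P sends \<open>i\<close> to \<open>j\<close>; the third point is
  left free so that the relation becomes transitive.\<close>

private definition link where
  "link i j \<longleftrightarrow> i = j \<or> (\<exists>k. distinct [i, j, k] \<and> three_cycle i j k \<in> P)"

private lemma link_sym: "link i j \<Longrightarrow> link j i"
proof -
  assume "link i j"
  then consider "i = j" | k where "distinct [i, j, k]" "three_cycle i j k \<in> P" unfolding link_def by blast
  then show "link j i"
  proof cases
    case 1
    then show ?thesis unfolding link_def by blast
  next
    case 2
    then have "three_cycle k j i \<in> P" by (rule invP)
    then have "three_cycle j i k \<in> P" by (rule rotP[rotated]) (use 2(1) in auto)
    moreover have "distinct [j, i, k]" using 2(1) by auto
    ultimately show ?thesis unfolding link_def by blast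
  qed
qed

text \<open>Conjugating (i j k) by (j l n) replaces j by l and fixes i. If i = n this fails, but
  then the inverse of (j l n) itself sends i to l.\<close>

private lemma link_trans:
  assumes "link i j" "link j l" shows "link i l"
proof (cases "i = j \<or> j = l \<or> i = l")
  case False
  then obtain k n where k: "distinct [i, j, k]" "three_cycle i j k \<in> P"
    and n: "distinct [j, l, n]" "three_cycle j l n \<in> P"
    using assms unfolding link_def by blast
  show ?thesis
  proof (cases "i = n")
    case True
    then have "three_cycle i l j \<in> P" using invP[OF n] by simp
    moreover have "distinct [i, l, j]" using n(1) True by auto
    ultimately show ?thesis unfolding link_def by blast
  next
    case i: False
    let ?g = "three_cycle j l n"
    have "three_cycle (?g i) (?g j) (?g k) \<in> P" by (rule conjP[OF n(2) k])
    moreover have "?g i = i" "?g j = l" using three_cycle_apply[OF n(1)] i False n(1) by auto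
    moreover have "distinct [?g i, ?g j, ?g k]"
      using k(1) bijP[OF n(2)] by (simp add: bij_is_inj inj_eq del: cycle_of_list.simps)
    ultimately have "three_cycle i l (?g k) \<in> P" "distinct [i, l, ?g k]" by (simp_all only:)
    then show ?thesis unfolding link_def by blast
  qed
next
  case True
  then show ?thesis using assms unfolding link_def by blast
qed

text \<open>Start from some (i j k) in P and conjugate by some (k l n) in P: this replaces k by l,
  provided that n is neither i nor j.\<close>

private lemma all_three_cycles:
  assumes all: "\<And>i j. i \<in> {1..m} \<Longrightarrow> j \<in> {1..m} \<Longrightarrow> link i j"
    and d: "distinct [i, j, l]" and ijl: "{i, j, l} \<subseteq> {1..m}"
  shows "three_cycle i j l \<in> P"
proof -
  obtain k where k: "distinct [i, j, k]" "three_cycle i j k \<in> P"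
    using all[of i j] d ijl unfolding link_def by auto
  show ?thesis
  proof (cases "k = l")
    case False
    have "k \<in> {1..m}"
      using permutes_not_in[OF permP[OF k(2)], of k] three_cycle_apply(3)[OF k(1)] k(1) by fastforce
    then obtain n where n: "distinct [k, l, n]" "three_cycle k l n \<in> P"
      using all[of k l] False ijl unfolding link_def by auto
    let ?g = "three_cycle k l n"
    note g = three_cycle_apply[OF n(1)]
    show ?thesis
    proof (cases "n \<in> {i, j}")
      case False
      have "three_cycle (?g i) (?g j) (?g k) \<in> P" by (rule conjP[OF n(2) k])
      moreover have "?g i = i" "?g j = j" using g(4) False k(1) d by auto
      ultimately show ?thesis using g(1) by (simp only:)
    next
      case n': True
      \<comment> \<open>Here \<open>?g\<close> moves \<open>i\<close> or \<open>j\<close>. Its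
        square sends k to n, l to k and n to l, and conjugating (i j k) by it gives the inverse of
        the desired cycle.\<close>
      let ?h = "?g \<circ> ?g"
      have h: "?h k = n" "?h l = k" "?h n = l"
        by (simp_all only: o_apply g)
      have h_fix: "?h w = w" if "w \<notin> {k, l, n}" for w
        using g(4)[OF that] by (simp only: o_apply)
      have conj: "three_cycle (?h i) (?h j) (?h k) \<in> P" by (rule conjP[OF closed[OF n(2) n(2)] k])
      show ?thesis
      proof (cases "n = i")
        case True
        then have "?h i = l" "?h j = j" "?h k = i" using h h_fix k(1) d by auto
        then have "three_cycle l j i \<in> P" using conj by (simp only:)
        then show ?thesis by (rule invP[rotated]) (use d in auto)
      next
        case False
        then have "?h i = i" "?h j = l" "?h k = j" using h h_fix n' k(1) d by auto
        then have "three_cycle i l j \<in> P" using conj by (simp only:)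
        then have "three_cycle j l i \<in> P" by (rule invP[rotated]) (use d in auto)
        then have "three_cycle l i j \<in> P" by (rule rotP[rotated]) (use d in auto)
        then show ?thesis by (rule rotP[rotated]) (use d in auto)
      qed
    qed
  next
    case True
    then show ?thesis using k(2) by (simp only:)
  qed
qed

private lemma linked_link:
  assumes "\<And>x y z. (x, y, z) \<in> set ts \<Longrightarrow> three_cycle x y z \<in> P"
    and "\<And>i j. i \<in> set U \<Longrightarrow> j \<in> set U \<Longrightarrow> link i j"
    and "i \<in> set (linked U ts)" "j \<in> set (linked U ts)"
  shows "link i j"
  using assms
proof (induction U ts rule: linked.induct)
  case (2 U x y z ts)
  show ?case
  proof (cases "distinct [x, y, z] \<and> (x \<in> set U \<or> y \<in> set U \<or> z \<in> set U)")
    case True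
    then have d: "distinct [x, y, z]" by blast
    have c: "three_cycle x y z \<in> P" by (rule "2.prems"(1)) simp
    have xy: "link x y" unfolding link_def using d c by blast
    have "distinct [y, z, x]" using d by auto
    then have yz: "link y z" unfolding link_def using rotP[OF d c] by blast
    have xz: "link x z" by (rule link_trans[OF xy yz])
    have tri: "link a b" if "a \<in> {x, y, z}" "b \<in> {x, y, z}" for a b
      using that xy yz xz link_sym by (auto simp: link_def[of x x] link_def[of y y] link_def[of z z])
    obtain w where w: "w \<in> {x, y, z}" "w \<in> set U" using True by blast
    have mixed: "link a b" if "a \<in> {x, y, z}" "b \<in> set U" for a b
      using link_trans[OF tri[OF that(1) w(1)] "2.prems"(2)[OF w(2) that(2)]] .
    have "link a b" if "a \<in> set (x # y # z # U)" "b \<in> set (x # y # z # U)" for a b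
      using that tri[of a b] mixed[of a b] link_sym[OF mixed[of b a]] "2.prems"(2)[of a b] by auto
    moreover have "three_cycle a b c \<in> P" if "(a, b, c) \<in> set ts" for a b c
      by (rule "2.prems"(1)) (use that in simp)
    moreover have "linked U ((x, y, z) # ts) = linked (x # y # z # U) ts"
      by (simp only: linked.simps True if_True simp_thms)
    ultimately show ?thesis
      using "2.IH"[OF True] "2.prems"(3,4) by metis
  next
    case False
    then have "linked U ((x, y, z) # ts) = []" by (simp only: linked.simps if_False)
    then show ?thesis using "2.prems"(3) by (simp only: list.set empty_iff)
  qed
qed simp

lemma alternating_subset:
  assumes ts: "\<And>x y z. (x, y, z) \<in> set ts \<Longrightarrow> three_cycle x y z \<in> P"
    and linked: "{1..m} \<subseteq> set (linked [1] ts)"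
  shows "carrier (alt_group m) \<subseteq> P"
proof -
  interpret S: group "sym_group m" by (rule sym_group_is_group)
  interpret A: group "alt_group m" by (rule alt_group_is_group)
  have all: "link i j" if "i \<in> {1..m}" "j \<in> {1..m}" for i j
  proof (rule linked_link)
    show "\<And>x y z. (x, y, z) \<in> set ts \<Longrightarrow> three_cycle x y z \<in> P" by (rule ts)
    show "\<And>i j. i \<in> set [1] \<Longrightarrow> j \<in> set [1] \<Longrightarrow> link i j" by (simp add: link_def)
    show "i \<in> set (linked [1] ts)" "j \<in> set (linked [1] ts)" using that linked by blast+
  qed
  have "three_cycles m \<subseteq> P"
  proof
    fix p assume "p \<in> three_cycles m"
    then obtain cs where cs: "p = cycle_of_list cs" "distinct cs" "length cs = 3" "set cs \<subseteq> {1..m}" by auto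
    obtain i j l where "cs = [i, j, l]" using stupid_lemma[OF cs(3)] by (rule that)
    moreover from this have "distinct [i, j, l]" "{i, j, l} \<subseteq> {1..m}" using cs by auto
    ultimately show "p \<in> P" using all_three_cycles[OF all] cs(1) by (simp only:)
  qed
  have "p \<in> P" if "p \<in> generate (alt_group m) (three_cycles m)" for p
    using that
  proof (induction rule: generate.induct)
    case one
    then show ?case using subgroup.one_closed[OF P] by (simp only: alt_group_one sym_group_one)
  next
    case (inv p)
    have p: "p \<in> P" "p \<in> carrier (alt_group m)"
      by (rule subsetD[OF \<open>three_cycles m \<subseteq> P\<close> inv], rule subsetD[OF three_cycles_incl inv])
    show ?case unfolding alt_group_inv_equality[OF p(2)] by (rule closed_inv[OF p(1)])
  next
    case (incl p)
    then show ?case using \<open>three_cycles m \<subseteq> P\<close> by blast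
  next
    case (eng p q)
    then show ?case unfolding alt_group_mult by (intro closed)
  qed
  then show ?thesis by (simp only: alt_group_carrier_as_three_cycles subsetI)
qed

end

section \<open>Words in permutation tables\<close>

definition comp_tab :: "nat list \<Rightarrow> nat list \<Rightarrow> nat list" where
  "comp_tab l k = map (tab l) k"

lemma tab_comp_tab:
  assumes "length l = length k"
  shows "tab (comp_tab l k) = tab l \<circ> tab k"
  using assms by (auto simp: fun_eq_iff comp_tab_def tab_def)

text \<open>Straight-line programs: each step appends the product of two earlier entries.\<close>

fun slp :: "nat list list \<Rightarrow> (nat \<times> nat) list \<Rightarrow> nat list list" where
  "slp L [] = L"
| "slp L ((i, j) # ps) =
     (if i < length L \<and> j < length L then slp (L @ [comp_tab (L ! i) (L ! j)]) ps else L)"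

lemma slp_closed:
  assumes "\<And>p q. p \<in> W \<Longrightarrow> q \<in> W \<Longrightarrow> p \<circ> q \<in> W"
    and "\<forall>l\<in>set L. length l = n \<and> tab l \<in> W" and "l \<in> set (slp L ps)"
  shows "length l = n \<and> tab l \<in> W"
  using assms(2,3)
proof (induction L ps rule: slp.induct)
  case (2 L i j ps)
  show ?case
  proof (cases "i < length L \<and> j < length L")
    case True
    then have "L ! i \<in> set L" "L ! j \<in> set L" by auto
    then have ij: "length (L ! i) = n" "length (L ! j) = n" "tab (L ! i) \<in> W" "tab (L ! j) \<in> W"
      using 2(2) by auto
    then have "tab (comp_tab (L ! i) (L ! j)) \<in> W" using assms(1) by (simp add: tab_comp_tab)
    moreover have "length (comp_tab (L ! i) (L ! j)) = n" using ij by (simp add: comp_tab_def)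
    ultimately show ?thesis using 2 True by auto
  next
    case False
    then have "slp L ((i, j) # ps) = L" by (simp only: slp.simps if_False)
    then show ?thesis using 2(2,3) by (simp only:)
  qed
qed simp

section \<open>Two interchanged blocks\<close>

text \<open>No upper bound on \<open>i\<close> is imposed: permutations of {1..m} fix 0 and
  everything beyond m, so the result fixes 0 and everything beyond 2 m.\<close>

definition blocks :: "nat \<Rightarrow> (nat \<Rightarrow> nat) \<Rightarrow> (nat \<Rightarrow> nat) \<Rightarrow> nat \<Rightarrow> nat" where
  "blocks m p q i = (if i \<le> m then p i else q (i - m) + m)"

definition swap_blocks :: "nat \<Rightarrow> nat \<Rightarrow> nat" where
  "swap_blocks m i = (if 1 \<le> i \<and> i \<le> m then i + m else if m < i \<and> i \<le> 2 * m then i - m else i)"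

lemma permutes_interval_iff:
  assumes "p permutes {1..m::nat}"
  shows "p i \<le> m \<longleftrightarrow> i \<le> m" "p i = 0 \<longleftrightarrow> i = 0" "p 0 = 0"
proof -
  show 0: "p 0 = 0" using permutes_not_in[OF assms, of 0] by simp
  show "p i = 0 \<longleftrightarrow> i = 0" using 0 permutes_inj[OF assms] by (metis injD)
  have "p i \<in> {1..m} \<longleftrightarrow> i \<in> {1..m}" by (rule permutes_in_image[OF assms])
  then show "p i \<le> m \<longleftrightarrow> i \<le> m" using 0 permutes_not_in[OF assms, of i] by (cases "i = 0") auto
qed

lemma permutes_if_bij: "bij p \<Longrightarrow> (\<And>x. x \<notin> S \<Longrightarrow> p x = x) \<Longrightarrow> p permutes S"
  unfolding permutes_def bij_iff by blast

lemma blocks_comp: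
  assumes "p' permutes {1..m}" "q' permutes {1..m}"
  shows "blocks m p q \<circ> blocks m p' q' = blocks m (p \<circ> p') (q \<circ> q')"
proof
  fix i
  show "(blocks m p q \<circ> blocks m p' q') i = blocks m (p \<circ> p') (q \<circ> q') i"
  proof (cases "i \<le> m")
    case True
    then show ?thesis using permutes_interval_iff(1)[OF assms(1), of i] by (simp add: blocks_def)
  next
    case False
    then have "q' (i - m) \<noteq> 0" using permutes_interval_iff(2)[OF assms(2), of "i - m"] by simp
    then show ?thesis using False by (simp add: blocks_def)
  qed
qed

lemma blocks_id: "blocks m id id = id"
  by (auto simp: blocks_def fun_eq_iff)

lemma blocks_permutes:
  assumes p: "p permutes {1..m}" and q: "q permutes {1..m}"
  shows "blocks m p q permutes {1..2 * m}"
proof (rule permutes_if_bij)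
  have "blocks m (inv' p) (inv' q) \<circ> blocks m p q = id" "blocks m p q \<circ> blocks m (inv' p) (inv' q) = id"
    using p q by (simp_all add: blocks_comp permutes_inv permutes_inv_o blocks_id)
  then show "bij (blocks m p q)" by (rule o_bij)
  show "blocks m p q x = x" if x: "x \<notin> {1..2 * m}" for x
  proof (cases "x = 0")
    case True
    then show ?thesis by (simp add: blocks_def permutes_interval_iff(3)[OF p])
  next
    case False
    then have "x - m \<notin> {1..m}" "x > m" using x by auto
    then show ?thesis using permutes_not_in[OF q] by (simp add: blocks_def)
  qed
qed

lemma blocks_eqD:
  assumes "p permutes {1..m}" "q permutes {1..m}" "p' permutes {1..m}" "q' permutes {1..m}"
    and eq: "blocks m p q = blocks m p' q'"
  shows "p = p' \<and> q = q'"
proof (intro conjI ext)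
  fix i
  show "p i = p' i"
  proof (cases "i \<in> {1..m}")
    case True
    then show ?thesis using fun_cong[OF eq, of i] by (simp add: blocks_def)
  next
    case False
    then show ?thesis using permutes_not_in[OF assms(1) False] permutes_not_in[OF assms(3) False] by simp
  qed
  show "q i = q' i"
  proof (cases "i \<in> {1..m}")
    case True
    then show ?thesis using fun_cong[OF eq, of "i + m"] by (simp add: blocks_def)
  next
    case False
    then show ?thesis using permutes_not_in[OF assms(2) False] permutes_not_in[OF assms(4) False] by simp
  qed
qed

lemma swap_swap_blocks: "swap_blocks m \<circ> swap_blocks m = id"
  by (auto simp: swap_blocks_def fun_eq_iff)

lemma swap_blocks_permutes: "swap_blocks m permutes {1..2 * m}"
proof (rule permutes_if_bij)
  show "bij (swap_blocks m)" by (rule o_bij[OF swap_swap_blocks swap_swap_blocks])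
  show "swap_blocks m x = x" if "x \<notin> {1..2 * m}" for x
    using that by (auto simp: swap_blocks_def)
qed

lemma swap_blocks_comp:
  assumes "p permutes {1..m}" "q permutes {1..m}"
  shows "swap_blocks m \<circ> blocks m p q = blocks m q p \<circ> swap_blocks m"
proof
  fix i
  consider "i = 0" | "i \<in> {1..m}" | "m < i" "i - m \<in> {1..m}" | "i \<noteq> 0" "i > m" "i - m \<notin> {1..m}"
    by fastforce
  then show "(swap_blocks m \<circ> blocks m p q) i = (blocks m q p \<circ> swap_blocks m) i"
  proof cases
    case 1
    then show ?thesis by (simp add: blocks_def swap_blocks_def permutes_interval_iff(3)[OF assms(1)] permutes_interval_iff(3)[OF assms(2)])
  next
    case 2
    then have "p i \<in> {1..m}" by (simp only: permutes_in_image[OF assms(1)])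
    then show ?thesis using 2 by (simp add: blocks_def swap_blocks_def)
  next
    case 3
    then have "q (i - m) \<in> {1..m}" by (simp only: permutes_in_image[OF assms(2)])
    moreover have "i \<le> 2 * m" using 3 by auto
    ultimately show ?thesis using 3 by (simp add: blocks_def swap_blocks_def)
  next
    case 4
    then have "q (i - m) = i - m" "p (i - m) = i - m"
      using permutes_not_in[OF assms(1)] permutes_not_in[OF assms(2)] by blast+
    moreover have "i > 2 * m" using 4 by auto
    ultimately show ?thesis by (simp add: blocks_def swap_blocks_def)
  qed
qed

section \<open>Parities of the two block permutations\<close>

definition tp :: "bool \<Rightarrow> nat \<Rightarrow> nat" where
  "tp i = (if i then Transposition.transpose 1 2 else id)"

text \<open>These eight permutations form a dihedral group that complements the product of two
  alternating groups in the wreath product of the symmetric group with \<open>\<int>\<close>/2;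
  \<open>i\<close> and \<open>j\<close> are the parities on the two blocks and \<open>k\<close>
  tells whether the blocks are exchanged.\<close>

definition block_sym :: "nat \<Rightarrow> bool \<Rightarrow> bool \<Rightarrow> bool \<Rightarrow> nat \<Rightarrow> nat" where
  "block_sym m i j k = blocks m (tp i) (tp j) \<circ> (if k then swap_blocks m else id)"

lemma tp_tp: "tp i \<circ> tp j = tp (i \<noteq> j)"
  by (simp add: tp_def)

lemma tp_tp_id: "tp i \<circ> tp i = id"
  by (simp add: tp_def)

lemma tp_permutes: "m \<ge> 2 \<Longrightarrow> tp i permutes {1..m}"
  by (auto simp: tp_def permutes_id intro: permutes_swap_id)

lemma permutation_tp: "permutation (tp i)"
  by (simp add: tp_def permutation_swap_id)

lemma evenperm_tp: "evenperm (tp i) \<longleftrightarrow> \<not> i"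
  by (simp add: tp_def evenperm_swap)

lemma permutes_interval_permutation: "p permutes {1..m::nat} \<Longrightarrow> permutation p"
  unfolding permutation_permutes by blast

lemma block_sym_comp_blocks:
  assumes m: "m \<ge> 2" and p: "p permutes {1..m}" and q: "q permutes {1..m}"
  shows "block_sym m i j k \<circ> blocks m p q =
    blocks m (tp i \<circ> (if k then q else p) \<circ> tp i) (tp j \<circ> (if k then p else q) \<circ> tp j) \<circ> block_sym m i j k"
proof -
  note t = tp_permutes[OF m]
  have *: "tp a \<circ> r \<circ> tp a \<circ> tp a = tp a \<circ> r" for a and r :: "nat \<Rightarrow> nat"
    unfolding comp_assoc tp_tp_id by simp
  show ?thesis
  proof (cases k)
    case True
    have "block_sym m i j k \<circ> blocks m p q = blocks m (tp i) (tp j) \<circ> (swap_blocks m \<circ> blocks m p q)"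
      using True by (simp add: block_sym_def comp_assoc)
    also have "\<dots> = (blocks m (tp i) (tp j) \<circ> blocks m q p) \<circ> swap_blocks m"
      unfolding swap_blocks_comp[OF p q] comp_assoc ..
    also have "\<dots> = blocks m (tp i \<circ> q) (tp j \<circ> p) \<circ> swap_blocks m"
      by (simp only: blocks_comp[OF q p])
    also have "\<dots> = (blocks m (tp i \<circ> q \<circ> tp i) (tp j \<circ> p \<circ> tp j) \<circ> blocks m (tp i) (tp j)) \<circ> swap_blocks m"
      by (simp only: blocks_comp[OF t t] *)
    finally show ?thesis using True by (simp add: block_sym_def comp_assoc)
  next
    case False
    have "blocks m (tp i) (tp j) \<circ> blocks m p q =
      blocks m (tp i \<circ> p \<circ> tp i) (tp j \<circ> q \<circ> tp j) \<circ> blocks m (tp i) (tp j)"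
      by (simp only: blocks_comp[OF t t] blocks_comp[OF p q] *)
    then show ?thesis using False by (simp add: block_sym_def)
  qed
qed

text \<open>The multiplication of the wreath product of two groups of order 2: moving the second
  factor past a swap exchanges its two parities.\<close>

lemma block_sym_comp:
  assumes m: "m \<ge> 2"
  shows "block_sym m i j k \<circ> block_sym m i' j' k' =
    block_sym m (i \<noteq> (if k then j' else i')) (j \<noteq> (if k then i' else j')) (k \<noteq> k')"
proof -
  note t = tp_permutes[OF m]
  have sw: "(if k then swap_blocks m else id) \<circ> (if k' then swap_blocks m else id) =
      (if k \<noteq> k' then swap_blocks m else id)"
    by (simp add: swap_swap_blocks)
  have "(if k then swap_blocks m else id) \<circ> blocks m (tp i') (tp j') =
      blocks m (tp (if k then j' else i')) (tp (if k then i' else j')) \<circ> (if k then swap_blocks m else id)"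
    by (simp add: swap_blocks_comp[OF t t])
  then have "block_sym m i j k \<circ> block_sym m i' j' k' =
      blocks m (tp i) (tp j) \<circ> (blocks m (tp (if k then j' else i')) (tp (if k then i' else j')) \<circ>
      (if k then swap_blocks m else id)) \<circ> (if k' then swap_blocks m else id)"
    unfolding block_sym_def by (metis comp_assoc)
  also have "\<dots> = (blocks m (tp i) (tp j) \<circ> blocks m (tp (if k then j' else i')) (tp (if k then i' else j'))) \<circ>
      ((if k then swap_blocks m else id) \<circ> (if k' then swap_blocks m else id))"
    by (simp only: comp_assoc)
  also have "\<dots> = block_sym m (i \<noteq> (if k then j' else i')) (j \<noteq> (if k then i' else j')) (k \<noteq> k')"
    unfolding sw blocks_comp[OF t t] tp_tp block_sym_def ..
  finally show ?thesis .
qed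

lemma block_sym_permutes: "m \<ge> 2 \<Longrightarrow> block_sym m i j k permutes {1..2 * m}"
  unfolding block_sym_def
  by (intro permutes_compose blocks_permutes tp_permutes) (auto intro: swap_blocks_permutes permutes_id simp del: One_nat_def)

text \<open>An exchange of the blocks is detected at the point 1.\<close>

lemma block_sym_eq_blocks:
  assumes m: "m \<ge> 2" and p: "p permutes {1..m}" "q permutes {1..m}"
    and eq: "blocks m p q = block_sym m i j k"
  shows "\<not> k \<and> p = tp i \<and> q = tp j"
proof -
  note t = tp_permutes[OF m]
  have "\<not> k"
  proof
    assume k
    have "blocks m p q 1 \<le> m" using m permutes_interval_iff(1)[OF p(1), of 1] by (simp add: blocks_def)
    moreover have "block_sym m i j k 1 > m"
      using m \<open>k\<close> permutes_interval_iff(2)[OF t, of j 1] by (simp add: block_sym_def blocks_def swap_blocks_def)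
    ultimately show False using eq by simp
  qed
  then have "blocks m p q = blocks m (tp i) (tp j)" using eq by (simp add: block_sym_def)
  then show ?thesis using blocks_eqD[OF p t t] \<open>\<not> k\<close> by blast
qed

lemma block_sym_eqD:
  assumes m: "m \<ge> 2" and eq: "block_sym m i j k = block_sym m i' j' k'"
  shows "i = i' \<and> j = j' \<and> k = k'"
proof -
  have "blocks m id id = block_sym m False False False" by (simp add: block_sym_def tp_def)
  \<comment> \<open>The second factor is the inverse of the first. Replacing the first by its equal
    \<open>block_sym m i' j' k'\<close> makes that product trivial, too, and its three bits can be
    compared with those of the identity.\<close>
  also have "\<dots> = block_sym m i j k \<circ> block_sym m (if k then j else i) (if k then i else j) k"
    by (cases k) (simp_all add: block_sym_comp[OF m])
  also have "\<dots> = block_sym m (i' \<noteq> (if k' then (if k then i else j) else (if k then j else i)))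
      (j' \<noteq> (if k' then (if k then j else i) else (if k then i else j))) (k' \<noteq> k)"
    unfolding eq by (rule block_sym_comp[OF m])
  finally have *: "blocks m id id = \<dots>" .
  have tp_id: "id = tp b \<Longrightarrow> \<not> b" for b using evenperm_tp[of b] by (metis evenperm_id)
  show ?thesis using block_sym_eq_blocks[OF m permutes_id permutes_id *] tp_id by (auto split: if_splits)
qed

lemma swapped_blocks_in_subgroup:
  assumes W: "subgroup W (sym_group (2 * m))" and swap: "swap_blocks m \<in> W"
    and p: "p permutes {1..m}" and q: "q permutes {1..m}" and pq: "blocks m p q \<in> W"
  shows "blocks m q p \<in> W"
proof -
  have "blocks m q p = swap_blocks m \<circ> blocks m p q \<circ> swap_blocks m"
    unfolding swap_blocks_comp[OF p q] comp_assoc swap_swap_blocks by simp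
  then show ?thesis
    using subgroup.m_closed[OF W subgroup.m_closed[OF W swap pq] swap] by (simp only: sym_group_mult)
qed

text \<open>The three-cycles yield the alternating group on the first block, acting trivially on the
  second; conjugating by the swap gives the other factor.\<close>

lemma even_blocks_in_subgroup:
  assumes W: "subgroup W (sym_group (2 * m))" and swap: "swap_blocks m \<in> W"
    and ts: "\<And>x y z. (x, y, z) \<in> set ts \<Longrightarrow> blocks m (three_cycle x y z) id \<in> W"
    and linked: "{1..m} \<subseteq> set (linked [1] ts)"
    and tsm: "\<And>x y z. (x, y, z) \<in> set ts \<Longrightarrow> distinct [x, y, z] \<and> {x, y, z} \<subseteq> {1..m}"
    and pq: "p permutes {1..m}" "q permutes {1..m}" "evenperm p" "evenperm q"
  shows "blocks m p q \<in> W"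
proof -
  note One_nat_def [simp del]
  have Wcomp: "p \<circ> q \<in> W" if "p \<in> W" "q \<in> W" for p q
    using subgroup.m_closed[OF W that] by (simp add: sym_group_mult)
  define P where "P = {p. p permutes {1..m} \<and> blocks m p id \<in> W}"
  have P: "subgroup P (sym_group m)"
  proof (rule group.subgroupI[OF sym_group_is_group])
    show "P \<subseteq> carrier (sym_group m)" by (auto simp: P_def sym_group_carrier)
    have "blocks m id id \<in> W"
      unfolding blocks_id using subgroup.one_closed[OF W] by (simp add: sym_group_one)
    then have "id \<in> P" by (simp add: P_def permutes_id)
    then show "P \<noteq> {}" by blast
    fix p assume p: "p \<in> P"
    then have pp: "p permutes {1..m}" and pW: "blocks m p id \<in> W" by (auto simp: P_def)
    have "inv' (blocks m p id) = blocks m (inv' p) id"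
      by (rule inv_unique_comp) (simp_all only: blocks_comp[OF permutes_inv[OF pp] permutes_id]
          blocks_comp[OF pp permutes_id] permutes_inv_o[OF pp] id_o blocks_id)
    moreover have "inv' (blocks m p id) \<in> W"
      using subgroup.m_inv_closed[OF W pW] subgroup.mem_carrier[OF W pW] by simp
    ultimately show "inv\<^bsub>sym_group m\<^esub> p \<in> P"
      using pp by (simp add: P_def sym_group_carrier permutes_inv)
    fix q assume q: "q \<in> P"
    then show "p \<otimes>\<^bsub>sym_group m\<^esub> q \<in> P"
      using p Wcomp[of "blocks m p id" "blocks m q id"]
      by (simp add: P_def sym_group_mult blocks_comp permutes_id permutes_compose)
  qed
  have "carrier (alt_group m) \<subseteq> P"
  proof (rule alternating_subset[OF P _ linked])
    fix x y z assume xyz: "(x, y, z) \<in> set ts"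
    have "three_cycle x y z permutes {1..m}"
      using cycle_permutes[of "[x, y, z]"] tsm[OF xyz] by (auto intro: permutes_subset)
    then show "three_cycle x y z \<in> P" using ts[OF xyz] by (simp add: P_def del: cycle_of_list.simps)
  qed
  then have "p \<in> P" "q \<in> P" using pq by (auto simp: alt_group_carrier)
  then have "blocks m p id \<in> W" "blocks m q id \<in> W" by (auto simp: P_def)
  then have "blocks m p id \<circ> blocks m id q \<in> W"
    using swapped_blocks_in_subgroup[OF W swap pq(2) permutes_id] by (blast intro: Wcomp)
  then show ?thesis by (simp add: blocks_comp[OF permutes_id pq(2)])
qed

text \<open>The condition on \<open>H\<close> says that the parities of the pairs in \<open>h ` H\<close> are among those generated by
  the parities of \<open>u\<close> and \<open>v\<close>.\<close>

lemma block_monodromy: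
  fixes H :: "('h, 'x) monoid_scheme" and i j k :: "'h \<Rightarrow> bool"
  assumes m: "m \<ge> 2" and u: "u permutes {1..m}" and v: "v permutes {1..m}"
  defines "Z \<equiv> {blocks m u v, swap_blocks m}"
  defines "W \<equiv> generate (sym_group (2 * m)) Z"
  assumes ts: "\<And>x y z. (x, y, z) \<in> set ts \<Longrightarrow> blocks m (three_cycle x y z) id \<in> W"
    and linked: "{1..m} \<subseteq> set (linked [1] ts)"
    and tsm: "\<And>x y z. (x, y, z) \<in> set ts \<Longrightarrow> distinct [x, y, z] \<and> {x, y, z} \<subseteq> {1..m}"
    and H: "group H"
    and mult: "\<And>x y. x \<in> carrier H \<Longrightarrow> y \<in> carrier H \<Longrightarrow>
      i (x \<otimes>\<^bsub>H\<^esub> y) = (i x \<noteq> (if k x then j y else i y)) \<and>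
      j (x \<otimes>\<^bsub>H\<^esub> y) = (j x \<noteq> (if k x then i y else j y)) \<and> k (x \<otimes>\<^bsub>H\<^esub> y) = (k x \<noteq> k y)"
    and inj: "inj_on (\<lambda>x. (i x, j x, k x)) (carrier H)"
    and rep: "(odd_u, odd_v, False) \<in> (\<lambda>x. (i x, j x, k x)) ` carrier H"
      "(False, False, True) \<in> (\<lambda>x. (i x, j x, k x)) ` carrier H"
    and parity: "evenperm u = (\<not> odd_u)" "evenperm v = (\<not> odd_v)"
    and sub: "\<And>x. x \<in> carrier H \<Longrightarrow> (i x, j x) \<in>
      {(False, False), (odd_u, odd_v), (odd_v, odd_u), (odd_u \<noteq> odd_v, odd_u \<noteq> odd_v)}"
  shows "is_some_semidirect_product (subgroup_generated (sym_group (2 * m)) Z) (alt_group m \<times>\<times> alt_group m) H"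
proof -
  let ?K = "sym_group (2 * m)" and ?N = "alt_group m \<times>\<times> alt_group m"
  note One_nat_def [simp del]
  interpret K: group ?K by (rule sym_group_is_group)
  interpret A: group "alt_group m" by (rule alt_group_is_group)
  interpret H: group H by fact
  note t = tp_permutes[OF m]
  have ZK: "Z \<subseteq> carrier ?K"
    using blocks_permutes[OF u v] swap_blocks_permutes[of m] by (simp add: Z_def sym_group_carrier)
  have Wsub: "subgroup W ?K" unfolding W_def by (rule K.generate_is_subgroup[OF ZK])
  have Wcomp: "p \<circ> q \<in> W" if "p \<in> W" "q \<in> W" for p q
    using subgroup.m_closed[OF Wsub that] by (simp add: sym_group_mult)
  have aW: "blocks m u v \<in> W" and bW: "swap_blocks m \<in> W"
    unfolding W_def Z_def by (auto intro: generate.incl)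
  note swapW = swapped_blocks_in_subgroup[OF Wsub bW]
  note evenW = even_blocks_in_subgroup[OF Wsub bW ts linked tsm]
  \<comment> \<open>The quotient of this element by the generator is a pair of even permutations,
    already known to lie in W.\<close>
  have parW: "blocks m (tp odd_u) (tp odd_v) \<in> W"
  proof -
    have ev: "evenperm (tp odd_u \<circ> inv' u)" "evenperm (tp odd_v \<circ> inv' v)"
      using parity u v
      by (simp_all add: evenperm_comp permutation_tp permutation_inverse evenperm_inv permutes_interval_permutation evenperm_tp)
    have "blocks m (tp odd_u \<circ> inv' u) (tp odd_v \<circ> inv' v) \<in> W"
      using ev by (intro evenW permutes_compose permutes_inv u v t)
    then have "blocks m (tp odd_u \<circ> inv' u) (tp odd_v \<circ> inv' v) \<circ> blocks m u v \<in> W" using aW by (rule Wcomp)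
    then show ?thesis using u v by (simp add: blocks_comp comp_assoc permutes_inv_o)
  qed
  have parW': "blocks m (tp odd_v) (tp odd_u) \<in> W" by (rule swapW[OF t t parW])
  have "blocks m (tp odd_u) (tp odd_v) \<circ> blocks m (tp odd_v) (tp odd_u) \<in> W" by (rule Wcomp[OF parW parW'])
  then have parW'': "blocks m (tp (odd_u \<noteq> odd_v)) (tp (odd_u \<noteq> odd_v)) \<in> W"
    unfolding blocks_comp[OF t t] tp_tp by (simp add: eq_commute)
  define f where "f = (\<lambda>(p, q). blocks m p q)"
  define h where "h x = block_sym m (i x) (j x) (k x)" for x
  show ?thesis
  proof (rule generated_semidirect_product[OF K.is_group DirProd_group[OF A.is_group A.is_group] H, of f h])
    show "f \<in> hom ?N ?K"
      by (rule homI) (auto simp: f_def alt_group_carrier sym_group_carrier blocks_permutes blocks_comp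
          alt_group_mult sym_group_mult simp del: One_nat_def)
    show "inj_on f (carrier ?N)"
      by (rule inj_onI) (auto simp: f_def alt_group_carrier simp del: One_nat_def dest: blocks_eqD)
    show "h \<in> hom H ?K"
    proof (rule homI)
      show "h x \<in> carrier ?K" for x by (simp only: h_def sym_group_carrier block_sym_permutes[OF m])
      show "h (x \<otimes>\<^bsub>H\<^esub> y) = h x \<otimes>\<^bsub>?K\<^esub> h y" if "x \<in> carrier H" "y \<in> carrier H" for x y
        using mult[OF that] by (simp add: h_def sym_group_mult block_sym_comp[OF m])
    qed
    show "inj_on h (carrier H)"
    proof (rule inj_onI)
      fix x y assume xy: "x \<in> carrier H" "y \<in> carrier H" "h x = h y"
      then have "(i x, j x, k x) = (i y, j y, k y)" using block_sym_eqD[OF m] by (simp add: h_def)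
      then show "x = y" by (rule inj_onD[OF inj]) (use xy in auto)
    qed
    fix x n assume x: "x \<in> carrier H" and n: "n \<in> carrier ?N"
    obtain p q where pq: "n = (p, q)" "p permutes {1..m}" "q permutes {1..m}" "evenperm p" "evenperm q"
      using n by (auto simp: alt_group_carrier simp del: One_nat_def)
    have hK: "h x \<in> carrier ?K" by (simp only: h_def sym_group_carrier block_sym_permutes[OF m])
    show "h x \<otimes>\<^bsub>?K\<^esub> f n \<otimes>\<^bsub>?K\<^esub> inv\<^bsub>?K\<^esub> h x \<in> f ` carrier ?N"
    proof -
      let ?p = "tp (i x) \<circ> (if k x then q else p) \<circ> tp (i x)"
      let ?q = "tp (j x) \<circ> (if k x then p else q) \<circ> tp (j x)"
      have "h x \<circ> f n = blocks m ?p ?q \<circ> h x"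
        unfolding h_def f_def pq(1) prod.case by (rule block_sym_comp_blocks[OF m pq(2,3)])
      then have "h x \<circ> f n \<circ> inv' (h x) = blocks m ?p ?q \<circ> (h x \<circ> inv' (h x))" by (simp only: comp_assoc)
      also have "h x \<circ> inv' (h x) = id"
        by (rule permutes_inv_o(1)) (use hK in \<open>simp only: sym_group_carrier\<close>)
      finally have conj: "h x \<circ> f n \<circ> inv' (h x) = blocks m ?p ?q \<circ> id" .
      have f_pq: "f (?p, ?q) = blocks m ?p ?q" by (simp only: f_def prod.case)
      have conj': "h x \<otimes>\<^bsub>?K\<^esub> f n \<otimes>\<^bsub>?K\<^esub> inv\<^bsub>?K\<^esub> h x = f (?p, ?q)"
        by (simp only: f_pq sym_group_mult sym_group_inv_equality[OF hK] conj comp_id)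
      have "?p permutes {1..m}" "?q permutes {1..m}"
        using pq(2,3) by (auto intro!: permutes_compose t)
      moreover have "evenperm ?p" "evenperm ?q"
        using pq by (auto simp: evenperm_comp permutation_compose permutation_tp evenperm_tp permutes_interval_permutation)
      ultimately have "(?p, ?q) \<in> carrier ?N"
        by (simp only: carrier_DirProd mem_Times_iff fst_conv snd_conv alt_group_carrier)
      then show ?thesis using conj' by (rule rev_image_eqI)
    qed
    show "x = \<one>\<^bsub>H\<^esub>" if eq: "f n = h x"
    proof -
      have "blocks m p q = block_sym m (i x) (j x) (k x)" using eq by (simp add: f_def h_def pq)
      then have *: "\<not> k x" "p = tp (i x)" "q = tp (j x)" using block_sym_eq_blocks[OF m pq(2,3)] by auto
      then have "(i x, j x, k x) = (False, False, False)" using pq(4,5) evenperm_tp by auto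
      moreover have "(i \<one>\<^bsub>H\<^esub>, j \<one>\<^bsub>H\<^esub>, k \<one>\<^bsub>H\<^esub>) = (False, False, False)"
        using mult[of "\<one>\<^bsub>H\<^esub>" "\<one>\<^bsub>H\<^esub>"] by (auto split: if_splits)
      ultimately show ?thesis using x by (intro inj_onD[OF inj]) auto
    qed
  next
    obtain x where x: "x \<in> carrier H" "i x = odd_u" "j x = odd_v" "\<not> k x" using rep(1) by auto
    obtain y where y: "y \<in> carrier H" "\<not> i y" "\<not> j y" "k y" using rep(2) by auto
    \<comment> \<open>The generator is split into an even pair and the element of the complement
      with the same parities.\<close>
    have "blocks m u v = blocks m (u \<circ> tp odd_u) (v \<circ> tp odd_v) \<circ> h x"
      using x by (simp add: h_def block_sym_def blocks_comp t comp_assoc tp_tp_id)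
    moreover have "evenperm (u \<circ> tp odd_u)" "evenperm (v \<circ> tp odd_v)"
      using parity u v by (simp_all add: evenperm_comp permutation_tp permutes_interval_permutation evenperm_tp)
    moreover have "u \<circ> tp odd_u permutes {1..m}" "v \<circ> tp odd_v permutes {1..m}"
      by (intro permutes_compose u v t)+
    ultimately have "blocks m u v \<in> (\<lambda>(n, x). f n \<otimes>\<^bsub>?K\<^esub> h x) ` (carrier ?N \<times> carrier H)"
      using x(1) by (intro image_eqI[of _ _ "((u \<circ> tp odd_u, v \<circ> tp odd_v), x)"])
        (simp_all add: f_def sym_group_mult alt_group_carrier del: One_nat_def)
    moreover have "swap_blocks m = blocks m id id \<circ> h y"
      using y by (simp add: h_def block_sym_def blocks_id tp_def)
    then have "swap_blocks m \<in> (\<lambda>(n, x). f n \<otimes>\<^bsub>?K\<^esub> h x) ` (carrier ?N \<times> carrier H)"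
      using y(1) by (intro image_eqI[of _ _ "((id, id), y)"])
        (simp_all add: f_def sym_group_mult alt_group_carrier permutes_id del: One_nat_def)
    ultimately show "Z \<subseteq> (\<lambda>(n, x). f n \<otimes>\<^bsub>?K\<^esub> h x) ` (carrier ?N \<times> carrier H)" by (simp add: Z_def)
    show "f ` carrier ?N \<subseteq> generate ?K Z"
      using evenW by (auto simp: f_def alt_group_carrier W_def simp del: One_nat_def)
    have "blocks m id id \<in> W" by (rule evenW) (simp_all add: permutes_id)
    then have "blocks m (tp (i x)) (tp (j x)) \<in> W" if "x \<in> carrier H" for x
      using sub[OF that] parW parW' parW'' by (auto simp: tp_def)
    then have "h x \<in> W" if "x \<in> carrier H" for x
      using that Wcomp bW by (simp add: h_def block_sym_def)
    then show "h ` carrier H \<subseteq> generate ?K Z" by (auto simp: W_def)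
  qed
qed

section \<open>Table criteria\<close>

lemma tab_map_upt:
  assumes "\<And>x. x \<notin> {1..n} \<Longrightarrow> f x = x"
  shows "tab (map f [1..<Suc n]) = f"
proof
  fix i show "tab (map f [1..<Suc n]) i = f i"
    using assms[of i] by (cases "i \<in> {1..n}") (auto simp: tab_def nth_append simp del: upt_Suc)
qed

text \<open>Parity is certified by exhibiting a square root, which takes a single composition of
  tables to check.\<close>

lemma evenperm_square:
  assumes "sort r = [1..<Suc m]" and "comp_tab r r = map p [1..<Suc m]" and p: "p permutes {1..m}"
  shows "evenperm p"
proof -
  have "permutation (tab r)"
    using tab_permutes[OF assms(1)] by (rule permutes_interval_permutation)
  moreover have "p = tab r \<circ> tab r"
    using tab_map_upt[of m p] permutes_not_in[OF p] assms(2) by (metis tab_comp_tab)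
  ultimately show ?thesis by (simp add: evenperm_comp)
qed

definition alternating_table where
  "alternating_table n la lb ra rb prog ts \<longleftrightarrow>
     sort la = [1..<Suc n] \<and> sort lb = [1..<Suc n] \<and> sort ra = [1..<Suc n] \<and> sort rb = [1..<Suc n] \<and>
     comp_tab ra ra = la \<and> comp_tab rb rb = lb \<and>
     (let L = slp [la, lb] prog in
      list_all (\<lambda>(x, y, z). map (three_cycle x y z) [1..<Suc n] \<in> set L) ts) \<and>
     list_all (\<lambda>(x, y, z). distinct [x, y, z] \<and> list_all (\<lambda>i. 1 \<le> i \<and> i \<le> n) [x, y, z]) ts \<and>
     (let U = linked [1] ts in list_all (\<lambda>i. i \<in> set U) [1..<Suc n])"

lemma three_cycle_permutes:
  assumes "distinct [x, y, z]" "list_all (\<lambda>i. 1 \<le> i \<and> i \<le> n) [x, y, z]"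
  shows "three_cycle x y z permutes {1..n}"
  using cycle_permutes[of "[x, y, z]"] assms by (auto intro: permutes_subset)

lemma slp_generate:
  assumes "sort la = [1..<Suc n]" "sort lb = [1..<Suc n]" "l \<in> set (slp [la, lb] prog)"
  shows "tab l \<in> generate (sym_group n) {tab la, tab lb}"
proof -
  have len: "length la = n" "length lb = n"
    using arg_cong[OF assms(1), of length] arg_cong[OF assms(2), of length] by simp_all
  have "length l = n \<and> tab l \<in> generate (sym_group n) {tab la, tab lb}"
  proof (rule slp_closed[OF _ _ assms(3)])
    show "p \<circ> q \<in> generate (sym_group n) {tab la, tab lb}"
      if "p \<in> generate (sym_group n) {tab la, tab lb}" "q \<in> generate (sym_group n) {tab la, tab lb}" for p q
      using generate.eng[OF that] by (simp only: sym_group_mult)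
    show "\<forall>l\<in>set [la, lb]. length l = n \<and> tab l \<in> generate (sym_group n) {tab la, tab lb}"
      using len by (auto intro: generate.incl)
  qed
  then show ?thesis ..
qed

lemma alternating_table_group:
  assumes t: "alternating_table n la lb ra rb prog ts"
  shows "subgroup_generated (sym_group n) {tab la, tab lb} = alt_group n"
proof -
  interpret K: group "sym_group n" by (rule sym_group_is_group)
  have s: "sort la = [1..<Suc n]" "sort lb = [1..<Suc n]" "sort ra = [1..<Suc n]" "sort rb = [1..<Suc n]"
    "comp_tab ra ra = la" "comp_tab rb rb = lb"
    using t by (simp_all only: alternating_table_def)
  let ?W = "generate (sym_group n) {tab la, tab lb}"
  have Z: "{tab la, tab lb} \<subseteq> carrier (sym_group n)"
    using tab_permutes[OF s(1)] tab_permutes[OF s(2)] by (simp only: sym_group_carrier insert_subset empty_subsetI)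
  have ev: "evenperm (tab (comp_tab r r))" if "sort r = [1..<Suc n]" for r
    using permutes_interval_permutation[OF tab_permutes[OF that]] by (simp add: tab_comp_tab evenperm_comp)
  have "{tab la, tab lb} \<subseteq> carrier (alt_group n)"
    using tab_permutes[OF s(1)] tab_permutes[OF s(2)] ev[OF s(3)] ev[OF s(4)] s(5,6)
    by (simp only: alt_group_carrier insert_subset empty_subsetI)
  then have "?W \<subseteq> carrier (alt_group n)"
    by (rule K.generate_subgroup_incl[OF _ alt_group_is_subgroup])
  moreover have "carrier (alt_group n) \<subseteq> ?W"
  proof (rule alternating_subset[OF K.generate_is_subgroup[OF Z]])
    fix x y z assume xyz: "(x, y, z) \<in> set ts"
    then have d: "distinct [x, y, z]" "list_all (\<lambda>i. 1 \<le> i \<and> i \<le> n) [x, y, z]"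
      and m: "map (three_cycle x y z) [1..<Suc n] \<in> set (slp [la, lb] prog)"
      using t unfolding alternating_table_def Let_def list_all_iff[of _ ts] by blast+
    have "tab (map (three_cycle x y z) [1..<Suc n]) = three_cycle x y z"
      by (rule tab_map_upt, rule permutes_not_in[OF three_cycle_permutes[OF d]])
    then show "three_cycle x y z \<in> ?W" using slp_generate[OF s(1,2) m] by (simp only:)
  next
    show "{1..n} \<subseteq> set (linked [1] ts)"
      using t unfolding alternating_table_def Let_def list_all_iff[of _ "[1..<Suc n]"] set_upt_1 by blast
  qed
  ultimately have "?W = carrier (alt_group n)" by (rule subset_antisym)
  then show ?thesis
    using Z by (simp add: subgroup_generated_def Int_absorb1 alt_group_carrier alt_group_def)
qed

text \<open>\<open>lu\<close> and \<open>lv\<close> are the restrictions of the black rotation to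
  the blocks. The square roots \<open>ru\<close> and \<open>rv\<close> certify their parities: an
  odd restriction is first multiplied by the transposition of 1 and 2.\<close>

definition block_table where
  "block_table m la lb lu ru odd_u lv rv odd_v prog ts \<longleftrightarrow> m \<ge> 2 \<and>
     sort lu = [1..<Suc m] \<and> sort lv = [1..<Suc m] \<and> sort ru = [1..<Suc m] \<and> sort rv = [1..<Suc m] \<and>
     sort la = [1..<Suc (2 * m)] \<and> sort lb = [1..<Suc (2 * m)] \<and>
     la = map (blocks m (tab lu) (tab lv)) [1..<Suc (2 * m)] \<and>
     lb = map (swap_blocks m) [1..<Suc (2 * m)] \<and>
     comp_tab ru ru = map (tp odd_u \<circ> tab lu) [1..<Suc m] \<and>
     comp_tab rv rv = map (tp odd_v \<circ> tab lv) [1..<Suc m] \<and>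
     (let L = slp [la, lb] prog in
      list_all (\<lambda>(x, y, z). map (blocks m (three_cycle x y z) id) [1..<Suc (2 * m)] \<in> set L) ts) \<and>
     list_all (\<lambda>(x, y, z). distinct [x, y, z] \<and> list_all (\<lambda>i. 1 \<le> i \<and> i \<le> m) [x, y, z]) ts \<and>
     (let U = linked [1] ts in list_all (\<lambda>i. i \<in> set U) [1..<Suc m])"

lemma block_table_group:
  fixes H :: "('h, 'x) monoid_scheme" and i j k :: "'h \<Rightarrow> bool"
  assumes t: "block_table m la lb lu ru odd_u lv rv odd_v prog ts"
    and H: "group H"
    and mult: "\<And>x y. x \<in> carrier H \<Longrightarrow> y \<in> carrier H \<Longrightarrow>
      i (x \<otimes>\<^bsub>H\<^esub> y) = (i x \<noteq> (if k x then j y else i y)) \<and>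
      j (x \<otimes>\<^bsub>H\<^esub> y) = (j x \<noteq> (if k x then i y else j y)) \<and> k (x \<otimes>\<^bsub>H\<^esub> y) = (k x \<noteq> k y)"
    and inj: "inj_on (\<lambda>x. (i x, j x, k x)) (carrier H)"
    and rep: "(odd_u, odd_v, False) \<in> (\<lambda>x. (i x, j x, k x)) ` carrier H"
      "(False, False, True) \<in> (\<lambda>x. (i x, j x, k x)) ` carrier H"
    and sub: "\<And>x. x \<in> carrier H \<Longrightarrow> (i x, j x) \<in>
      {(False, False), (odd_u, odd_v), (odd_v, odd_u), (odd_u \<noteq> odd_v, odd_u \<noteq> odd_v)}"
  shows "is_some_semidirect_product (subgroup_generated (sym_group (2 * m)) {tab la, tab lb})
    (alt_group m \<times>\<times> alt_group m) H"
proof -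
  have m: "m \<ge> 2" and s: "sort lu = [1..<Suc m]" "sort lv = [1..<Suc m]" "sort ru = [1..<Suc m]" "sort rv = [1..<Suc m]"
    "sort la = [1..<Suc (2 * m)]" "sort lb = [1..<Suc (2 * m)]"
    and la: "la = map (blocks m (tab lu) (tab lv)) [1..<Suc (2 * m)]"
    and lb: "lb = map (swap_blocks m) [1..<Suc (2 * m)]"
    and sq: "comp_tab ru ru = map (tp odd_u \<circ> tab lu) [1..<Suc m]" "comp_tab rv rv = map (tp odd_v \<circ> tab lv) [1..<Suc m]"
    using t unfolding block_table_def by - (elim conjE, assumption)+
  note u = tab_permutes[OF s(1)] and v = tab_permutes[OF s(2)]
  have a: "tab la = blocks m (tab lu) (tab lv)"
    unfolding la by (rule tab_map_upt, rule permutes_not_in[OF blocks_permutes[OF u v]])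
  have b: "tab lb = swap_blocks m"
    unfolding lb by (rule tab_map_upt, rule permutes_not_in[OF swap_blocks_permutes])
  have par: "evenperm (tab l) = (\<not> odd)"
    if "tab l permutes {1..m}" "sort r = [1..<Suc m]" "comp_tab r r = map (tp odd \<circ> tab l) [1..<Suc m]" for l r odd
  proof -
    have "evenperm (tp odd \<circ> tab l)"
      by (rule evenperm_square[OF that(2,3)]) (rule permutes_compose[OF that(1) tp_permutes[OF m]])
    then show ?thesis
      using evenperm_comp[OF permutation_tp permutes_interval_permutation[OF that(1)], of odd] evenperm_tp[of odd] by auto
  qed
  have ts: "distinct [x, y, z]" "list_all (\<lambda>i. 1 \<le> i \<and> i \<le> m) [x, y, z]"
    "map (blocks m (three_cycle x y z) id) [1..<Suc (2 * m)] \<in> set (slp [la, lb] prog)"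
    if "(x, y, z) \<in> set ts" for x y z
    using t that unfolding block_table_def Let_def list_all_iff[of _ ts] by blast+
  show ?thesis
    unfolding a b
  proof (rule block_monodromy[OF m u v _ _ _ H mult inj rep par[OF u s(3) sq(1)] par[OF v s(4) sq(2)] sub])
    fix x y z assume xyz: "(x, y, z) \<in> set ts"
    have "tab (map (blocks m (three_cycle x y z) id) [1..<Suc (2 * m)]) = blocks m (three_cycle x y z) id"
      by (rule tab_map_upt, rule permutes_not_in[OF blocks_permutes[OF three_cycle_permutes[OF ts(1,2)[OF xyz]] permutes_id]])
    then show "blocks m (three_cycle x y z) id \<in>
        generate (sym_group (2 * m)) {blocks m (tab lu) (tab lv), swap_blocks m}"
      using slp_generate[OF s(5,6) ts(3)[OF xyz]] by (simp only: a b)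
    show "distinct [x, y, z] \<and> {x, y, z} \<subseteq> {1..m}" using ts(1,2)[OF xyz] by auto
  next
    show "{1..m} \<subseteq> set (linked [1] ts)"
      using t unfolding block_table_def Let_def list_all_iff[of _ "[1..<Suc m]"] set_upt_1 by blast
  qed
qed

section \<open>The possible groups of parities\<close>

lemma carrier_Z2: "carrier (integer_mod_group 2) = {0, 1}"
proof -
  have "0 \<le> x \<and> x < 2 \<longleftrightarrow> x = 0 \<or> x = 1" for x :: int by presburger
  then show ?thesis by (simp add: carrier_integer_mod_group set_eq_iff)
qed

text \<open>Both restrictions are even, so only the swap remains modulo even pairs.\<close>

lemma block_table_Z2:
  assumes t: "block_table m la lb lu ru False lv rv False prog ts"
  shows "is_some_semidirect_product (subgroup_generated (sym_group (2 * m)) {tab la, tab lb})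
    (alt_group m \<times>\<times> alt_group m) (integer_mod_group 2)"
proof (rule block_table_group[OF t group_integer_mod_group,
      where i = "\<lambda>_. False" and j = "\<lambda>_. False" and k = "\<lambda>x. x = 1"])
  note c = carrier_Z2
  show "inj_on (\<lambda>x::int. (False, False, x = 1)) (carrier (integer_mod_group 2))"
    unfolding c by (auto simp: inj_on_def)
  show "(False, False, False) \<in> (\<lambda>x. (False, False, x = 1)) ` carrier (integer_mod_group 2)"
    "(False, False, True) \<in> (\<lambda>x. (False, False, x = 1)) ` carrier (integer_mod_group 2)"
    unfolding c by auto
  show "False = (False \<noteq> (if x = 1 then False else False)) \<and>
      False = (False \<noteq> (if x = 1 then False else False)) \<and>
      (x \<otimes>\<^bsub>integer_mod_group 2\<^esub> y = 1) = ((x = 1) \<noteq> (y = 1))"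
    if "x \<in> carrier (integer_mod_group 2)" "y \<in> carrier (integer_mod_group 2)" for x y
    using that unfolding c by auto
qed auto

text \<open>Both restrictions are odd, so modulo even pairs the black rotation is a diagonal
  involution, which commutes with the swap.\<close>

lemma block_table_Z2_Z2:
  assumes t: "block_table m la lb lu ru True lv rv True prog ts"
  shows "is_some_semidirect_product (subgroup_generated (sym_group (2 * m)) {tab la, tab lb})
    (alt_group m \<times>\<times> alt_group m) (integer_mod_group 2 \<times>\<times> integer_mod_group 2)"
proof (rule block_table_group[OF t DirProd_group[OF group_integer_mod_group group_integer_mod_group],
      where i = "\<lambda>x. fst x = 1" and j = "\<lambda>x. fst x = 1" and k = "\<lambda>x. snd x = 1"])
  let ?H = "integer_mod_group 2 \<times>\<times> integer_mod_group 2"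
  have c: "carrier ?H = {(0, 0), (0, 1), (1, 0), (1, 1)}" by (auto simp: carrier_Z2)
  show "inj_on (\<lambda>x::int \<times> int. (fst x = 1, fst x = 1, snd x = 1)) (carrier ?H)"
    unfolding c by (auto simp: inj_on_def)
  show "(True, True, False) \<in> (\<lambda>x. (fst x = 1, fst x = 1, snd x = 1)) ` carrier ?H"
    "(False, False, True) \<in> (\<lambda>x. (fst x = 1, fst x = 1, snd x = 1)) ` carrier ?H"
    unfolding c by auto
  show "(fst (x \<otimes>\<^bsub>?H\<^esub> y) = 1) = ((fst x = 1) \<noteq> (if snd x = 1 then fst y = 1 else fst y = 1)) \<and>
      (fst (x \<otimes>\<^bsub>?H\<^esub> y) = 1) = ((fst x = 1) \<noteq> (if snd x = 1 then fst y = 1 else fst y = 1)) \<and>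
      (snd (x \<otimes>\<^bsub>?H\<^esub> y) = 1) = ((snd x = 1) \<noteq> (snd y = 1))"
    if "x \<in> carrier ?H" "y \<in> carrier ?H" for x y
    using that unfolding c by auto
qed auto

lemma carrier_Z4: "carrier (integer_mod_group 4) = {0, 1, 2, 3}"
proof -
  have "0 \<le> x \<and> x < 4 \<longleftrightarrow> x = 0 \<or> x = 1 \<or> x = 2 \<or> x = 3" for x :: int by presburger
  then show ?thesis by (simp add: carrier_integer_mod_group set_eq_iff)
qed

lemma carrier_dihedral_4: "carrier (dihedral_group 4) = {0, 1, 2, 3} \<times> {0, 1}"
  by (simp only: dihedral_group_def semidirect_product_simps carrier_Z2 carrier_Z4)

lemma mult_dihedral_4:
  assumes "a \<in> {0, 1, 2, 3}" "b \<in> {0, 1, 2, 3}"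
  shows "(a, h) \<otimes>\<^bsub>dihedral_group 4\<^esub> (b, k) = ((if h = 0 then a + b else a - b) mod 4, (h + k) mod 2)"
proof -
  have b: "b \<in> carrier (integer_mod_group 4)" unfolding carrier_Z4 by (rule assms)
  have "(a + (- b) mod 4) mod 4 = (a - b) mod 4" by (simp add: mod_add_right_eq)
  then show ?thesis
    by (simp only: dihedral_group_def semidirect_product_simps restrict_apply if_P[OF b]
        inv_integer_mod_group[OF b] mult_integer_mod_group of_nat_numeral prod.inject split: if_split) simp
qed

lemma one_dihedral_4: "\<one>\<^bsub>dihedral_group 4\<^esub> = (0, 0)"
  by (simp add: dihedral_group_def)

text \<open>The rotation of order four is \<open>blocks (1 2) id\<close> times the block swap, so the first coordinate \<open>r\<close>
  contributes the transposition of the first block for \<open>r = 1, 2\<close> and that of the second for \<open>r = 2, 3\<close>.\<close>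

definition dihedral_i :: "int \<times> int \<Rightarrow> bool" where "dihedral_i x = (fst x = 1 \<or> fst x = 2)"
definition dihedral_j :: "int \<times> int \<Rightarrow> bool" where "dihedral_j x = (fst x = 2 \<or> fst x = 3)"
definition dihedral_k :: "int \<times> int \<Rightarrow> bool" where "dihedral_k x = odd (fst x + snd x)"

text \<open>Identifies \<open>dihedral_group 4\<close> with the group of the three bits of
  \<open>block_sym\<close>, by checking all 64 products.\<close>

lemma dihedral_ijk_mult:
  assumes "x \<in> carrier (dihedral_group 4)" "y \<in> carrier (dihedral_group 4)"
  shows "dihedral_i (x \<otimes>\<^bsub>dihedral_group 4\<^esub> y) = (dihedral_i x \<noteq> (if dihedral_k x then dihedral_j y else dihedral_i y)) \<and>
      dihedral_j (x \<otimes>\<^bsub>dihedral_group 4\<^esub> y) = (dihedral_j x \<noteq> (if dihedral_k x then dihedral_i y else dihedral_j y)) \<and>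
      dihedral_k (x \<otimes>\<^bsub>dihedral_group 4\<^esub> y) = (dihedral_k x \<noteq> dihedral_k y)"
proof -
  obtain a h b k where xy: "x = (a, h)" "y = (b, k)" by (metis surj_pair)
  have ab: "a \<in> {0, 1, 2, 3}" "b \<in> {0, 1, 2, 3}" and hk: "h \<in> {0, 1}" "k \<in> {0, 1}"
    using assms unfolding xy carrier_dihedral_4 by auto
  have "dihedral_i ((if h = 0 then a + b else a - b) mod 4, (h + k) mod 2) =
        (dihedral_i (a, h) \<noteq> (if dihedral_k (a, h) then dihedral_j (b, k) else dihedral_i (b, k))) \<and>
      dihedral_j ((if h = 0 then a + b else a - b) mod 4, (h + k) mod 2) =
        (dihedral_j (a, h) \<noteq> (if dihedral_k (a, h) then dihedral_i (b, k) else dihedral_j (b, k))) \<and>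
      dihedral_k ((if h = 0 then a + b else a - b) mod 4, (h + k) mod 2) = (dihedral_k (a, h) \<noteq> dihedral_k (b, k))"
    using ab hk unfolding dihedral_i_def dihedral_j_def dihedral_k_def
    by (elim insertE emptyE) simp_all
  then show ?thesis unfolding xy mult_dihedral_4[OF ab] .
qed

lemma dihedral_ijk_inj: "inj_on (\<lambda>x. (dihedral_i x, dihedral_j x, dihedral_k x)) (carrier (dihedral_group 4))"
  unfolding carrier_dihedral_4 dihedral_i_def dihedral_j_def dihedral_k_def inj_on_def by auto

lemma group_if_embeds:
  assumes K: "group K" and k: "k \<in> hom S K" "inj_on k (carrier S)"
    and closed: "\<And>x y. x \<in> carrier S \<Longrightarrow> y \<in> carrier S \<Longrightarrow> x \<otimes>\<^bsub>S\<^esub> y \<in> carrier S"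
    and one: "\<one>\<^bsub>S\<^esub> \<in> carrier S" "k \<one>\<^bsub>S\<^esub> = \<one>\<^bsub>K\<^esub>"
    and inv: "\<And>x. x \<in> carrier S \<Longrightarrow> \<exists>y\<in>carrier S. y \<otimes>\<^bsub>S\<^esub> x = \<one>\<^bsub>S\<^esub>"
  shows "group S"
proof -
  interpret K: group K by fact
  have kK: "k x \<in> carrier K" if "x \<in> carrier S" for x using k(1) that by (rule hom_in_carrier)
  have km: "k (x \<otimes>\<^bsub>S\<^esub> y) = k x \<otimes>\<^bsub>K\<^esub> k y" if "x \<in> carrier S" "y \<in> carrier S" for x y
    using k(1) that by (rule hom_mult)
  show ?thesis
  proof (rule groupI)
    fix x y z assume xyz: "x \<in> carrier S" "y \<in> carrier S" "z \<in> carrier S"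
    have "k (x \<otimes>\<^bsub>S\<^esub> y \<otimes>\<^bsub>S\<^esub> z) = k (x \<otimes>\<^bsub>S\<^esub> (y \<otimes>\<^bsub>S\<^esub> z))"
      by (simp only: km closed kK K.m_assoc xyz)
    then show "x \<otimes>\<^bsub>S\<^esub> y \<otimes>\<^bsub>S\<^esub> z = x \<otimes>\<^bsub>S\<^esub> (y \<otimes>\<^bsub>S\<^esub> z)"
      by (rule inj_onD[OF k(2)]) (simp_all only: closed xyz)
  next
    fix x assume x: "x \<in> carrier S"
    have "k (\<one>\<^bsub>S\<^esub> \<otimes>\<^bsub>S\<^esub> x) = k x" by (simp only: km one kK K.l_one x)
    then show "\<one>\<^bsub>S\<^esub> \<otimes>\<^bsub>S\<^esub> x = x" by (rule inj_onD[OF k(2)]) (simp_all only: closed one x)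
  qed (use closed one inv in blast)+
qed

text \<open>The group axioms are obtained by embedding into the permutations of four points, with
  \<open>block_sym\<close> for two blocks of size 2.\<close>

lemma group_dihedral_4: "group (dihedral_group 4)"
proof (rule group_if_embeds[OF sym_group_is_group])
  let ?k = "\<lambda>x. block_sym 2 (dihedral_i x) (dihedral_j x) (dihedral_k x)"
  show closed: "x \<otimes>\<^bsub>dihedral_group 4\<^esub> y \<in> carrier (dihedral_group 4)"
    if "x \<in> carrier (dihedral_group 4)" "y \<in> carrier (dihedral_group 4)" for x y
  proof -
    obtain a h b k where xy: "x = (a, h)" "y = (b, k)" by (metis surj_pair)
    have ab: "a \<in> {0, 1, 2, 3}" "b \<in> {0, 1, 2, 3}" and hk: "h \<in> {0, 1}" "k \<in> {0, 1}"
      using that unfolding xy carrier_dihedral_4 by auto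
    have "c mod 4 \<in> {0, 1, 2, 3}" "c mod 2 \<in> {0, 1}" for c :: int by auto
    then show ?thesis unfolding xy mult_dihedral_4[OF ab] carrier_dihedral_4 by blast
  qed
  show "?k \<in> hom (dihedral_group 4) (sym_group (2 * 2))"
  proof (rule homI)
    show "?k x \<in> carrier (sym_group (2 * 2))" for x
      by (simp only: sym_group_carrier block_sym_permutes)
    show "?k (x \<otimes>\<^bsub>dihedral_group 4\<^esub> y) = ?k x \<otimes>\<^bsub>sym_group (2 * 2)\<^esub> ?k y"
      if "x \<in> carrier (dihedral_group 4)" "y \<in> carrier (dihedral_group 4)" for x y
      using dihedral_ijk_mult[OF that] by (simp only: sym_group_mult block_sym_comp[OF order_refl])
  qed
  show "inj_on ?k (carrier (dihedral_group 4))"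
  proof (rule inj_onI)
    fix x y assume xy: "x \<in> carrier (dihedral_group 4)" "y \<in> carrier (dihedral_group 4)" "?k x = ?k y"
    then have "(dihedral_i x, dihedral_j x, dihedral_k x) = (dihedral_i y, dihedral_j y, dihedral_k y)"
      using block_sym_eqD[OF order_refl xy(3)] by simp
    then show "x = y" by (rule inj_onD[OF dihedral_ijk_inj]) (use xy in auto)
  qed
  show "\<one>\<^bsub>dihedral_group 4\<^esub> \<in> carrier (dihedral_group 4)"
    unfolding one_dihedral_4 carrier_dihedral_4 by simp
  show "?k \<one>\<^bsub>dihedral_group 4\<^esub> = \<one>\<^bsub>sym_group (2 * 2)\<^esub>"
    by (simp add: one_dihedral_4 dihedral_i_def dihedral_j_def dihedral_k_def block_sym_def tp_def blocks_id sym_group_one)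
  show "\<exists>y\<in>carrier (dihedral_group 4). y \<otimes>\<^bsub>dihedral_group 4\<^esub> x = \<one>\<^bsub>dihedral_group 4\<^esub>"
    if x: "x \<in> carrier (dihedral_group 4)" for x
  proof -
    obtain a h where xa: "x = (a, h)" by (metis surj_pair)
    have a: "a \<in> {0, 1, 2, 3}" and h: "h \<in> {0, 1}" using x unfolding xa carrier_dihedral_4 by auto
    \<comment> \<open>Rotations are inverted by negating the angle, while reflections are their own
      inverses.\<close>
    define b where "b = (if h = 0 then (- a) mod 4 else a)"
    have b: "b \<in> {0, 1, 2, 3}" using a by (auto simp: b_def)
    have "(b, h) \<otimes>\<^bsub>dihedral_group 4\<^esub> x = \<one>\<^bsub>dihedral_group 4\<^esub>"
      unfolding xa mult_dihedral_4[OF b a] one_dihedral_4 using a h by (auto simp: b_def)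
    then show ?thesis using b h unfolding carrier_dihedral_4 by blast
  qed
qed

text \<open>The restrictions have different parities. Conjugation by the swap moves the odd one to
  the other block, so all parity pairs occur.\<close>

lemma block_table_D8:
  assumes t: "block_table m la lb lu ru True lv rv False prog ts"
  shows "is_some_semidirect_product (subgroup_generated (sym_group (2 * m)) {tab la, tab lb})
    (alt_group m \<times>\<times> alt_group m) (dihedral_group 4)"
proof (rule block_table_group[OF t group_dihedral_4 dihedral_ijk_mult dihedral_ijk_inj])
  show "(True, False, False) \<in> (\<lambda>x. (dihedral_i x, dihedral_j x, dihedral_k x)) ` carrier (dihedral_group 4)"
    unfolding carrier_dihedral_4 dihedral_i_def dihedral_j_def dihedral_k_def
    \<comment> \<open>The rotation of order four followed by the reflection \<open>(0, 1)\<close>,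
      which is the swap: the swap cancels and the transposition of the first block is left.\<close>
    by (rule image_eqI[of _ _ "(1, 1)"]) auto
  show "(False, False, True) \<in> (\<lambda>x. (dihedral_i x, dihedral_j x, dihedral_k x)) ` carrier (dihedral_group 4)"
    unfolding carrier_dihedral_4 dihedral_i_def dihedral_j_def dihedral_k_def
    by (rule image_eqI[of _ _ "(0, 1)"]) auto
qed auto

section \<open>Pairs of points: signed permutations\<close>

declare One_nat_def [simp del]

text \<open>The points \<open>k\<close> and \<open>k + m\<close> form the pair \<open>k\<close>. \<open>flip m c\<close> interchanges the points of the pairs
  selected by \<open>c\<close>, while \<open>blocks m g g\<close> permutes the pairs by \<open>g\<close> and respects the two sheets.\<close>

definition flip :: "nat \<Rightarrow> (nat \<Rightarrow> bool) \<Rightarrow> nat \<Rightarrow> nat" where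
  "flip m c i = (if 1 \<le> i \<and> i \<le> m then (if c i then i + m else i)
     else if m < i \<and> i \<le> 2 * m then (if c (i - m) then i - m else i) else i)"

abbreviation lift :: "nat \<Rightarrow> (nat \<Rightarrow> nat) \<Rightarrow> nat \<Rightarrow> nat" where
  "lift m g \<equiv> blocks m g g"

lemma pair_point_cases:
  fixes i m :: nat
  obtains (zero) "i = 0" | (low) "1 \<le> i" "i \<le> m" | (high) k where "i = k + m" "1 \<le> k" "k \<le> m" | (out) "i > 2 * m"
proof (cases "m < i \<and> i \<le> 2 * m")
  case True
  then have "i = (i - m) + m" "1 \<le> i - m" "i - m \<le> m" by linarith+
  then show ?thesis by (rule high)
qed (use zero low out in linarith)

lemma flip_comp: "flip m c \<circ> flip m d = flip m (\<lambda>k. c k \<noteq> d k)"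
proof
  fix i
  show "(flip m c \<circ> flip m d) i = flip m (\<lambda>k. c k \<noteq> d k) i"
    by (rule pair_point_cases[where i = i and m = m]) (simp_all add: flip_def)
qed

lemma flip_cong:
  assumes "\<And>k. k \<in> {1..m} \<Longrightarrow> c k = d k"
  shows "flip m c = flip m d"
proof
  fix i
  show "flip m c i = flip m d i"
    by (rule pair_point_cases[where i = i and m = m]) (simp_all add: flip_def assms)
qed

lemma flip_eqD: "flip m c = flip m d \<Longrightarrow> k \<in> {1..m} \<Longrightarrow> c k = d k"
  by (drule fun_cong[of _ _ k]) (auto simp: flip_def split: if_splits)

lemma flip_False: "flip m (\<lambda>_. False) = id"
  by (auto simp: fun_eq_iff flip_def)

lemma flip_permutes: "flip m c permutes {1..2 * m}"
proof (rule permutes_if_bij)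
  have "flip m c \<circ> flip m c = id" by (simp add: flip_comp flip_False)
  then show "bij (flip m c)" using o_bij by blast
  show "flip m c x = x" if "x \<notin> {1..2 * m}" for x using that by (auto simp: flip_def)
qed

lemma lift_flip:
  assumes g: "g permutes {1..m}"
  shows "lift m g \<circ> flip m c = flip m (c \<circ> inv' g) \<circ> lift m g"
proof
  fix i
  have im: "g k \<in> {1..m}" if "k \<in> {1..m}" for k using that by (simp only: permutes_in_image[OF g])
  consider "i = 0" | "i \<in> {1..m}" | "m < i" "i \<le> 2 * m" "i - m \<in> {1..m}" | "i > 2 * m" "i \<notin> {1..m}" "i - m \<notin> {1..m}"
    by fastforce
  then show "(lift m g \<circ> flip m c) i = (flip m (c \<circ> inv' g) \<circ> lift m g) i"
  proof cases
    case 1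
    then show ?thesis using permutes_interval_iff(3)[OF g] by (simp add: blocks_def flip_def)
  next
    case 2
    then show ?thesis using im[OF 2] permutes_inverses(2)[OF g] by (auto simp: blocks_def flip_def)
  next
    case 3
    then show ?thesis using im[OF 3(3)] permutes_inverses(2)[OF g] by (auto simp: blocks_def flip_def)
  next
    case 4
    then have "g (i - m) = i - m" using permutes_not_in[OF g] by blast
    then show ?thesis using 4 by (simp add: blocks_def flip_def)
  qed
qed

text \<open>A flip never moves a point to another pair, so the permutation of the pairs is read off
  first and then cancelled.\<close>

lemma flip_lift_eqD:
  assumes g: "g permutes {1..m}" "g' permutes {1..m}" and eq: "flip m c \<circ> lift m g = flip m d \<circ> lift m g'"
  shows "g = g'" "k \<in> {1..m} \<Longrightarrow> c k = d k"
proof -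
  show gg: "g = g'"
  proof
    fix i
    show "g i = g' i"
    proof (cases "i \<in> {1..m}")
      case True
      then have "g i \<in> {1..m}" "g' i \<in> {1..m}"
        by (simp_all only: permutes_in_image[OF g(1)] permutes_in_image[OF g(2)])
      moreover have "flip m c (g i) = flip m d (g' i)"
        using fun_cong[OF eq, of i] True by (simp add: blocks_def)
      ultimately show ?thesis by (auto simp: flip_def split: if_splits)
    next
      case False
      then show ?thesis using permutes_not_in[OF g(1)] permutes_not_in[OF g(2)] by simp
    qed
  qed
  have "flip m c \<circ> (lift m g \<circ> lift m (inv' g)) = flip m d \<circ> (lift m g \<circ> lift m (inv' g))"
    using eq unfolding gg by (simp only: comp_assoc[symmetric])
  moreover have "lift m g \<circ> lift m (inv' g) = id"
    by (simp only: blocks_comp[OF permutes_inv[OF g(1)] permutes_inv[OF g(1)]] permutes_inv_o[OF g(1)] blocks_id)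
  ultimately have "flip m c = flip m d" by simp
  then show "k \<in> {1..m} \<Longrightarrow> c k = d k" by (rule flip_eqD)
qed

lemma flip_lift_comp:
  assumes "g permutes {1..m}" "g' permutes {1..m}"
  shows "(flip m c \<circ> lift m g) \<circ> (flip m d \<circ> lift m g') = flip m (\<lambda>k. c k \<noteq> d (inv' g k)) \<circ> lift m (g \<circ> g')"
proof -
  have "(flip m c \<circ> lift m g) \<circ> (flip m d \<circ> lift m g') = flip m c \<circ> (lift m g \<circ> flip m d) \<circ> lift m g'"
    by (simp only: comp_assoc)
  also have "\<dots> = (flip m c \<circ> flip m (d \<circ> inv' g)) \<circ> (lift m g \<circ> lift m g')"
    unfolding lift_flip[OF assms(1)] by (simp only: comp_assoc)
  finally show ?thesis by (simp only: flip_comp blocks_comp[OF assms(2) assms(2)] o_apply)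
qed

section \<open>Ten pairs in two halves, preserved or exchanged\<close>

definition respects_sides :: "bool \<Rightarrow> (nat \<Rightarrow> nat) \<Rightarrow> bool" where
  "respects_sides k g \<longleftrightarrow> g permutes {1..10} \<and> (\<forall>i\<in>{1..10}. g i \<le> 5 \<longleftrightarrow> k \<noteq> (i \<le> 5))"

lemma respects_sides_inv:
  assumes "respects_sides k g" "i \<in> {1..10}"
  shows "inv' g i \<in> {1..10}" "inv' g i \<le> 5 \<longleftrightarrow> k \<noteq> (i \<le> 5)"
proof -
  have g: "g permutes {1..10}" using assms(1) by (simp add: respects_sides_def)
  show *: "inv' g i \<in> {1..10}" using assms(2) permutes_in_image[OF permutes_inv[OF g], of i] by simp
  show "inv' g i \<le> 5 \<longleftrightarrow> k \<noteq> (i \<le> 5)"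
    using assms(1) * permutes_inverses(1)[OF g, of i] unfolding respects_sides_def by metis
qed

lemma respects_sides_comp: "respects_sides k g \<Longrightarrow> respects_sides k' g' \<Longrightarrow> respects_sides (k \<noteq> k') (g \<circ> g')"
  unfolding respects_sides_def
  by (auto intro: permutes_compose simp: permutes_in_image simp del: atLeastAtMost_iff)

lemma respects_sides_blocks:
  assumes "p permutes {1..5}" "q permutes {1..5}"
  shows "respects_sides False (blocks 5 p q)"
  unfolding respects_sides_def
proof (intro conjI ballI)
  show "blocks 5 p q permutes {1..10}" using blocks_permutes[OF assms] by simp
  fix i :: nat assume i: "i \<in> {1..10}"
  show "blocks 5 p q i \<le> 5 \<longleftrightarrow> False \<noteq> (i \<le> 5)"
    using permutes_interval_iff(1)[OF assms(1), of i] permutes_interval_iff(2)[OF assms(2), of "i - 5"] i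
    by (auto simp: blocks_def)
qed

lemma respects_sides_swap: "respects_sides True (swap_blocks 5)"
  unfolding respects_sides_def using swap_blocks_permutes[of 5] by (auto simp: swap_blocks_def)

lemma respects_sides_block_sym: "respects_sides k (block_sym 5 i j k)"
proof -
  have "respects_sides False (blocks 5 (tp i) (tp j))" by (intro respects_sides_blocks tp_permutes) simp_all
  from this respects_sides_comp[OF this respects_sides_swap] show ?thesis
    by (cases k) (simp_all add: block_sym_def)
qed

definition side_pattern :: "bool \<Rightarrow> bool \<Rightarrow> nat \<Rightarrow> bool" where
  "side_pattern i j k = (if k \<le> 5 then i else j)"

lemma side_pattern_inv:
  assumes "respects_sides k g" "x \<in> {1..10}"
  shows "side_pattern i j (inv' g x) = side_pattern (if k then j else i) (if k then i else j) x"
  using respects_sides_inv[OF assms] by (auto simp: side_pattern_def)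

text \<open>A copy of the dihedral group of order 8 whose central involution flips all pairs.\<close>

definition pair_sym :: "bool \<Rightarrow> bool \<Rightarrow> bool \<Rightarrow> nat \<Rightarrow> nat" where
  "pair_sym i j k = flip 10 (side_pattern i j) \<circ> lift 10 (block_sym 5 (i \<noteq> j) (i \<noteq> j) k)"

lemma block_sym_5_permutes: "block_sym 5 i j k permutes {1..10}"
  using block_sym_permutes[of 5 i j k] by simp

text \<open>The same law as \<open>block_sym_comp\<close>: the permutation part depends on
  \<open>i\<close> and \<open>j\<close> only through their exclusive or, which is additive and does
  not change when the two are exchanged.\<close>

lemma pair_sym_comp:
  "pair_sym i j k \<circ> pair_sym i' j' k' =
    pair_sym (i \<noteq> (if k then j' else i')) (j \<noteq> (if k then i' else j')) (k \<noteq> k')"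
proof -
  let ?g = "block_sym 5 (i \<noteq> j) (i \<noteq> j) k"
  have "pair_sym i j k \<circ> pair_sym i' j' k' = flip 10 (\<lambda>x. side_pattern i j x \<noteq> side_pattern i' j' (inv' ?g x)) \<circ>
      lift 10 (?g \<circ> block_sym 5 (i' \<noteq> j') (i' \<noteq> j') k')"
    unfolding pair_sym_def by (rule flip_lift_comp[OF block_sym_5_permutes block_sym_5_permutes])
  also have "flip 10 (\<lambda>x. side_pattern i j x \<noteq> side_pattern i' j' (inv' ?g x)) =
      flip 10 (side_pattern (i \<noteq> (if k then j' else i')) (j \<noteq> (if k then i' else j')))"
  proof (rule flip_cong)
    fix x :: nat assume "x \<in> {1..10}"
    then show "(side_pattern i j x \<noteq> side_pattern i' j' (inv' ?g x)) =
        side_pattern (i \<noteq> (if k then j' else i')) (j \<noteq> (if k then i' else j')) x"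
      unfolding side_pattern_inv[OF respects_sides_block_sym \<open>x \<in> {1..10}\<close>] by (simp add: side_pattern_def)
  qed
  also have "?g \<circ> block_sym 5 (i' \<noteq> j') (i' \<noteq> j') k' =
      block_sym 5 ((i \<noteq> (if k then j' else i')) \<noteq> (j \<noteq> (if k then i' else j')))
        ((i \<noteq> (if k then j' else i')) \<noteq> (j \<noteq> (if k then i' else j'))) (k \<noteq> k')"
    by (subst block_sym_comp) (simp, rule arg_cong2[where f = "\<lambda>u v. block_sym 5 u v (k \<noteq> k')"], auto)
  finally show ?thesis unfolding pair_sym_def .
qed

section \<open>Flips of evenly many pairs in each half: a copy of \<open>\<int>\<close>/2 to the
  power 8\<close>

definition even_pattern :: "(nat \<Rightarrow> bool) \<Rightarrow> bool" where
  "even_pattern c \<longleftrightarrow> even (card {i \<in> {1..5}. c i}) \<and> even (card {i \<in> {6..10}. c i})"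

text \<open>Each half is mapped onto a half, so the two counts are preserved or exchanged.\<close>

lemma even_pattern_inv:
  assumes g: "respects_sides k g" and c: "even_pattern c"
  shows "even_pattern (c \<circ> inv' g)"
proof -
  have p: "g permutes {1..10}" using g by (simp add: respects_sides_def)
  have side: "g i \<le> 5 \<longleftrightarrow> k \<noteq> (i \<le> 5)" "g i \<in> {1..10}" if "i \<in> {1..10}" for i
    using g that permutes_in_image[OF p, of i] by (auto simp: respects_sides_def)
  have card: "card {i \<in> B. (c \<circ> inv' g) i} = card {i \<in> A. c i}" if "g ` A = B" for A B
  proof -
    have "{i \<in> B. (c \<circ> inv' g) i} = g ` {i \<in> A. c i}"
      using that permutes_inverses(2)[OF p] by auto
    then show ?thesis by (simp add: card_image inj_on_subset[OF permutes_inj[OF p]])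
  qed
  have half: "g ` A = B" if "A \<in> {{1..5}, {6..10}}" "B \<in> {{1..5}, {6..10}}" "\<And>i. i \<in> A \<Longrightarrow> g i \<in> B" for A B
    using that card_image[OF inj_on_subset[OF permutes_inj[OF p] subset_UNIV], of A]
    by (intro card_subset_eq) auto
  show ?thesis
  proof (cases k)
    case True
    have h1: "g ` {1..5} = {6..10}"
    proof (rule half)
      show "g i \<in> {6..10}" if "i \<in> {1..5}" for i using that side[of i] True by auto
    qed auto
    have h2: "g ` {6..10} = {1..5}"
    proof (rule half)
      show "g i \<in> {1..5}" if "i \<in> {6..10}" for i using that side[of i] True by auto
    qed auto
    show ?thesis using c unfolding even_pattern_def card[OF h1] card[OF h2] by (rule conj_commute[THEN iffD1])
  next
    case False
    have "g ` {1..5} = {1..5}"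
    proof (rule half)
      show "g i \<in> {1..5}" if "i \<in> {1..5}" for i using that side[of i] False by auto
    qed auto
    moreover have "g ` {6..10} = {6..10}"
    proof (rule half)
      show "g i \<in> {6..10}" if "i \<in> {6..10}" for i using that side[of i] False by auto
    qed auto
    ultimately show ?thesis using c unfolding even_pattern_def by (simp only: card)
  qed
qed

lemma even_sum_of_bool_5:
  "even (of_bool a + (of_bool b + (of_bool c + (of_bool d + of_bool e))) :: nat) \<longleftrightarrow> e = (a \<noteq> (b \<noteq> (c \<noteq> d)))"
  by (cases a; cases b; cases c; cases d; cases e; simp)

lemma atLeastAtMost_1_10: "k \<in> {1..10} \<Longrightarrow> k \<in> {1, 2, 3, 4, 5, 6, 7, 8, 9, 10 :: nat}"
  by (simp only: atLeastAtMost_iff insert_iff empty_iff) presburger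

text \<open>In this form statements about even patterns become propositional in the ten
  values.\<close>

lemma even_pattern_iff:
  "even_pattern c \<longleftrightarrow> c 5 = (c 1 \<noteq> (c 2 \<noteq> (c 3 \<noteq> c 4))) \<and> c 10 = (c 6 \<noteq> (c 7 \<noteq> (c 8 \<noteq> c 9)))"
proof -
  have card: "card {i \<in> A. c i} = (\<Sum>i\<in>A. of_bool (c i))" if "finite A" for A :: "nat set"
    using that by (simp add: of_bool_def sum.If_cases Int_def)
  have "{1..5::nat} = {1, 2, 3, 4, 5}" "{6..10::nat} = {6, 7, 8, 9, 10}" by auto
  then have "card {i \<in> {1..5}. c i} = of_bool (c 1) + (of_bool (c 2) + (of_bool (c 3) + (of_bool (c 4) + of_bool (c 5))))"
    "card {i \<in> {6..10}. c i} = of_bool (c 6) + (of_bool (c 7) + (of_bool (c 8) + (of_bool (c 9) + of_bool (c 10))))"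
    unfolding card[OF finite_atLeastAtMost] by simp_all
  then show ?thesis unfolding even_pattern_def by (simp only: even_sum_of_bool_5)
qed

text \<open>Eight bits determine an even pattern: the fifth and the tenth value are parity bits.\<close>

definition pattern :: "(nat \<Rightarrow> int) \<Rightarrow> nat \<Rightarrow> bool" where
  "pattern x k = (if k \<le> 4 then odd (x k) else if k = 5 then odd (x 1 + x 2 + x 3 + x 4)
     else if k \<le> 9 then odd (x (k - 1)) else odd (x 5 + x 6 + x 7 + x 8))"

abbreviation "Z2_8 \<equiv> product_group {1..8::nat} (\<lambda>_. integer_mod_group 2)"

lemma even_pattern_pattern: "even_pattern (pattern x)"
  unfolding even_pattern_iff by (simp add: pattern_def) blast

lemma carrier_Z2_8: "x \<in> carrier Z2_8 \<longleftrightarrow> x \<in> extensional {1..8} \<and> (\<forall>i\<in>{1..8}. x i \<in> {0, 1})"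
  by (simp add: carrier_Z2 PiE_iff conj_commute)

lemma pattern_mult:
  assumes "k \<in> {1..10}"
  shows "pattern (x \<otimes>\<^bsub>Z2_8\<^esub> y) k = (pattern x k \<noteq> pattern y k)"
proof -
  note atLeastAtMost_1_10[OF assms]
  then show ?thesis by (elim insertE emptyE; simp add: pattern_def; blast)
qed

lemma pattern_inj:
  assumes "x \<in> carrier Z2_8" "y \<in> carrier Z2_8" "\<And>k. k \<in> {1..10} \<Longrightarrow> pattern x k = pattern y k"
  shows "x = y"
proof (rule extensionalityI[of _ "{1..8}"])
  show "x \<in> extensional {1..8}" "y \<in> extensional {1..8}" using assms(1,2) carrier_Z2_8 by blast+
  fix i :: nat assume i: "i \<in> {1..8}"
  have "odd (x i) = odd (y i)"
    using assms(3)[of i] assms(3)[of "i + 1"] i by (cases "i \<le> 4") (simp_all add: pattern_def)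
  moreover have "x i \<in> {0, 1}" "y i \<in> {0, 1}" using assms(1,2) carrier_Z2_8 i by blast+
  ultimately show "x i = y i" by auto
qed

lemma pattern_surj:
  assumes c: "even_pattern c"
  obtains x where "x \<in> carrier Z2_8" "\<And>k. k \<in> {1..10} \<Longrightarrow> pattern x k = c k"
proof -
  define x :: "nat \<Rightarrow> int" where "x = (\<lambda>i\<in>{1..8}. of_bool (c (if i \<le> 4 then i else i + 1)))"
  have "x \<in> carrier Z2_8" unfolding carrier_Z2_8 by (auto simp: x_def)
  moreover have "pattern x k = c k" if "k \<in> {1..10}" for k
  proof -
    note atLeastAtMost_1_10[OF that]
    then show ?thesis
      using c unfolding even_pattern_iff
      by (elim insertE emptyE; simp add: pattern_def x_def; blast)
  qed
  ultimately show ?thesis by (rule that)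
qed

text \<open>The sets {i, 5} and {i, 10} form a basis of the even patterns over the field with two
  elements; \<open>c i\<close> is the coefficient of the set with first element i.\<close>

lemma pattern_flip_in_subgroup:
  assumes W: "subgroup W (sym_group 20)"
    and basis: "\<And>i. i \<in> {1..4} \<Longrightarrow> flip 10 (\<lambda>k. k = i \<or> k = 5) \<in> W"
      "\<And>i. i \<in> {6..9} \<Longrightarrow> flip 10 (\<lambda>k. k = i \<or> k = 10) \<in> W"
    and c: "even_pattern c"
  shows "flip 10 c \<in> W"
proof -
  \<comment> \<open>Scalar multiplication of the pattern \<open>d\<close> by the bit
    \<open>b\<close>.\<close>
  define sel where "sel b d = (\<lambda>k::nat. b \<and> d k)" for b and d :: "nat \<Rightarrow> bool"
  have xor: "flip 10 (\<lambda>k. d k \<noteq> d' k) \<in> W" if "flip 10 d \<in> W" "flip 10 d' \<in> W" for d d'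
    using subgroup.m_closed[OF W that] by (simp add: sym_group_mult flip_comp)
  have "flip 10 (\<lambda>_. False) \<in> W"
    using subgroup.one_closed[OF W] by (simp add: sym_group_one flip_False)
  then have sel: "flip 10 (sel b d) \<in> W" if "flip 10 d \<in> W" for b d
    using that by (cases b) (simp_all add: sel_def)
  define s where "s i j = sel (c i) (\<lambda>k. k = i \<or> k = j)" for i j :: nat
  have sW: "flip 10 (s i 5) \<in> W" if "i \<in> {1..4}" for i unfolding s_def by (intro sel basis that)
  have sW': "flip 10 (s i 10) \<in> W" if "i \<in> {6..9}" for i unfolding s_def by (intro sel basis that)
  define d where "d k = (((s 1 5 k \<noteq> s 2 5 k) \<noteq> (s 3 5 k \<noteq> s 4 5 k)) \<noteq>
    ((s 6 10 k \<noteq> s 7 10 k) \<noteq> (s 8 10 k \<noteq> s 9 10 k)))" for k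
  have "flip 10 d \<in> W"
    unfolding d_def by (intro xor sW sW') auto
  moreover have "flip 10 c = flip 10 d"
  proof (rule flip_cong)
    fix k :: nat assume "k \<in> {1..10}"
    note atLeastAtMost_1_10[OF this]
    then show "c k = d k"
      using c unfolding even_pattern_iff
      by (elim insertE emptyE; simp add: d_def s_def sel_def; blast)
  qed
  ultimately show ?thesis by simp
qed

lemma pair_sym_permutes: "pair_sym i j k permutes {1..20}"
  unfolding pair_sym_def
  using permutes_compose[OF blocks_permutes[OF block_sym_5_permutes block_sym_5_permutes] flip_permutes] by simp

text \<open>Modulo even patterns and even permutations, the first generator flips oddly in the first
  half and evenly in the second, while its permutations are odd on both halves. Conjugation by the
  swap exchanges the two flip parities, and the product with the conjugate is odd in both flip
  parities with even permutations. So the permutation parity is always the exclusive or of the flip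
  parities, which is the shape of \<open>pair_sym\<close>. Two internal products are nested: even
  permutations by the dihedral group, then even flips by the result.\<close>

lemma pair_monodromy:
  assumes u: "u permutes {1..5}" "\<not> evenperm u" and v: "v permutes {1..5}" "\<not> evenperm v"
    and c: "even_pattern (\<lambda>k. c k \<noteq> side_pattern True False k)"
  defines "Z \<equiv> {flip 10 c \<circ> lift 10 (blocks 5 u v), lift 10 (swap_blocks 5)}"
  defines "W \<equiv> generate (sym_group 20) Z"
  assumes basis: "\<And>i. i \<in> {1..4} \<Longrightarrow> flip 10 (\<lambda>k. k = i \<or> k = 5) \<in> W"
      "\<And>i. i \<in> {6..9} \<Longrightarrow> flip 10 (\<lambda>k. k = i \<or> k = 10) \<in> W"
    and ts: "\<And>x y z. (x, y, z) \<in> set ts \<Longrightarrow> lift 10 (blocks 5 (three_cycle x y z) id) \<in> W"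
    and linked: "{1..5} \<subseteq> set (linked [1] ts)"
    and tsm: "\<And>x y z. (x, y, z) \<in> set ts \<Longrightarrow> distinct [x, y, z] \<and> {x, y, z} \<subseteq> {1..5}"
  shows "\<exists>\<theta>\<in>hom (dihedral_group 4) (AutoGroup (alt_group 5 \<times>\<times> alt_group 5)).
    is_some_semidirect_product (subgroup_generated (sym_group 20) Z) Z2_8
      (semidirect_product (alt_group 5 \<times>\<times> alt_group 5) (dihedral_group 4) \<theta>)"
proof -
  let ?K = "sym_group 20" and ?N = "alt_group 5 \<times>\<times> alt_group 5" and ?D = "dihedral_group 4"
  interpret K: group ?K by (rule sym_group_is_group)
  interpret A: group "alt_group 5" by (rule alt_group_is_group)
  have t: "tp b permutes {1..5}" for b by (rule tp_permutes) simp
  have lift_perm: "lift 10 g permutes {1..20}" if "g permutes {1..10}" for g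
    using blocks_permutes[OF that that] by simp
  have flip_perm: "flip 10 d permutes {1..20}" for d using flip_permutes[of 10 d] by simp
  have blocks_perm: "blocks 5 p q permutes {1..10}" if "p permutes {1..5}" "q permutes {1..5}" for p q
    using blocks_permutes[OF that] by simp
  have swap_perm: "swap_blocks 5 permutes {1..10}" using swap_blocks_permutes[of 5] by simp
  have lift_comp: "lift 10 g \<circ> lift 10 g' = lift 10 (g \<circ> g')" if "g' permutes {1..10}" for g g'
    by (rule blocks_comp[OF that that])
  have ZK: "Z \<subseteq> carrier ?K"
    unfolding Z_def using permutes_compose[OF lift_perm[OF blocks_perm[OF u(1) v(1)]] flip_perm] lift_perm[OF swap_perm]
    by (simp add: sym_group_carrier)
  have W: "subgroup W ?K" unfolding W_def by (rule K.generate_is_subgroup[OF ZK])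
  have Wcomp: "p \<circ> q \<in> W" if "p \<in> W" "q \<in> W" for p q
    using subgroup.m_closed[OF W that] by (simp add: sym_group_mult)
  have aW: "flip 10 c \<circ> lift 10 (blocks 5 u v) \<in> W" and bW: "lift 10 (swap_blocks 5) \<in> W"
    unfolding W_def Z_def by (auto intro: generate.incl)
  have flipW: "flip 10 d \<in> W" if "even_pattern d" for d
    by (rule pattern_flip_in_subgroup[OF W _ _ that]) (rule basis, assumption)+
  \<comment> \<open>Descending to the action on the pairs makes the lemma on two interchanged blocks
    applicable.\<close>
  define W' where "W' = {g. g permutes {1..10} \<and> lift 10 g \<in> W}"
  have W': "subgroup W' (sym_group (2 * 5))"
  proof (rule group.subgroupI[OF sym_group_is_group])
    show "W' \<subseteq> carrier (sym_group (2 * 5))" by (auto simp: W'_def sym_group_carrier)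
    show "W' \<noteq> {}" using swap_perm bW by (auto simp: W'_def)
    fix g assume g: "g \<in> W'"
    then have gp: "g permutes {1..10}" and gW: "lift 10 g \<in> W" by (auto simp: W'_def)
    have "inv' (lift 10 g) = lift 10 (inv' g)"
      by (rule inv_unique_comp)
        (simp_all only: lift_comp[OF gp] lift_comp[OF permutes_inv[OF gp]] permutes_inv_o[OF gp] blocks_id)
    moreover have "inv' (lift 10 g) \<in> W"
      using subgroup.m_inv_closed[OF W gW] subgroup.mem_carrier[OF W gW] by simp
    ultimately show "inv\<^bsub>sym_group (2 * 5)\<^esub> g \<in> W'"
      using gp by (simp add: W'_def sym_group_carrier permutes_inv)
    fix g' assume "g' \<in> W'"
    then show "g \<otimes>\<^bsub>sym_group (2 * 5)\<^esub> g' \<in> W'"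
      using gp gW Wcomp[of "lift 10 g" "lift 10 g'"]
      by (simp add: W'_def sym_group_mult lift_comp permutes_compose)
  qed
  have three_perm: "three_cycle x y z permutes {1..5}" if "(x, y, z) \<in> set ts" for x y z
    using tsm[OF that] by (intro three_cycle_permutes) auto
  have evenW': "blocks 5 p q \<in> W'"
    if "p permutes {1..5}" "q permutes {1..5}" "evenperm p" "evenperm q" for p q
  proof (rule even_blocks_in_subgroup[OF W' _ _ linked tsm that])
    show "swap_blocks 5 \<in> W'" using swap_perm bW by (simp add: W'_def)
    show "blocks 5 (three_cycle x y z) id \<in> W'" if "(x, y, z) \<in> set ts" for x y z
      using ts[OF that] blocks_perm[OF three_perm[OF that] permutes_id] by (simp only: W'_def mem_Collect_eq)
  qed
  then have evenW: "lift 10 (blocks 5 p q) \<in> W"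
    if "p permutes {1..5}" "q permutes {1..5}" "evenperm p" "evenperm q" for p q
    using that by (auto simp: W'_def)
  define f where "f = (\<lambda>(p, q). lift 10 (blocks 5 p q))"
  define h where "h x = pair_sym (dihedral_i x) (dihedral_j x) (dihedral_k x)" for x
  have N: "group ?N" by (rule DirProd_group[OF A.is_group A.is_group])
  have inN: "n \<in> carrier ?N \<longleftrightarrow> fst n permutes {1..5} \<and> snd n permutes {1..5} \<and> evenperm (fst n) \<and> evenperm (snd n)" for n
    by (auto simp: alt_group_carrier mem_Times_iff)
  have hK: "h x \<in> carrier ?K" for x by (simp only: h_def sym_group_carrier pair_sym_permutes)
  have f: "f \<in> hom ?N ?K" "inj_on f (carrier ?N)"
  proof -
    show "f \<in> hom ?N ?K"
      by (rule homI) (auto simp: f_def alt_group_carrier sym_group_carrier lift_perm blocks_perm lift_comp blocks_comp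
          alt_group_mult sym_group_mult)
    show "inj_on f (carrier ?N)"
    proof (rule inj_onI)
      fix n n' assume "n \<in> carrier ?N" "n' \<in> carrier ?N" and eq: "f n = f n'"
      then have p: "fst n permutes {1..5}" "snd n permutes {1..5}" "fst n' permutes {1..5}" "snd n' permutes {1..5}"
        unfolding inN by blast+
      have "lift 10 (blocks 5 (fst n) (snd n)) = lift 10 (blocks 5 (fst n') (snd n'))"
        using eq by (simp add: f_def split_beta)
      then have "blocks 5 (fst n) (snd n) = blocks 5 (fst n') (snd n')"
        using blocks_eqD[OF blocks_perm blocks_perm blocks_perm blocks_perm, OF p(1,2) p(1,2) p(3,4) p(3,4)] by blast
      then show "n = n'" using blocks_eqD[OF p] by (simp add: prod_eq_iff)
    qed
  qed
  have h: "h \<in> hom ?D ?K" "inj_on h (carrier ?D)"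
  proof -
    show "h \<in> hom ?D ?K"
    proof (rule homI)
      show "h x \<in> carrier ?K" for x by (rule hK)
      show "h (x \<otimes>\<^bsub>?D\<^esub> y) = h x \<otimes>\<^bsub>?K\<^esub> h y" if "x \<in> carrier ?D" "y \<in> carrier ?D" for x y
        using dihedral_ijk_mult[OF that] by (simp only: h_def sym_group_mult pair_sym_comp)
    qed
    show "inj_on h (carrier ?D)"
    proof (rule inj_onI)
      fix x y assume xy: "x \<in> carrier ?D" "y \<in> carrier ?D" "h x = h y"
      note D = flip_lift_eqD[OF block_sym_5_permutes block_sym_5_permutes xy(3)[unfolded h_def pair_sym_def]]
      have "dihedral_k x = dihedral_k y" using block_sym_eqD[OF _ D(1)] by simp
      moreover have "dihedral_i x = dihedral_i y" using D(2)[of 1] by (simp add: side_pattern_def)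
      moreover have "dihedral_j x = dihedral_j y" using D(2)[of 6] by (simp add: side_pattern_def)
      ultimately show "x = y" by (intro inj_onD[OF dihedral_ijk_inj]) (use xy in auto)
    qed
  qed
  \<comment> \<open>A side pattern is constant on each half, and \<open>blocks 5 p q\<close>
    preserves the halves, so the two commute.\<close>
  have f_h: "f (p, q) \<circ> h x = flip 10 (side_pattern (dihedral_i x) (dihedral_j x)) \<circ>
      lift 10 (blocks 5 p q \<circ> block_sym 5 (dihedral_i x \<noteq> dihedral_j x) (dihedral_i x \<noteq> dihedral_j x) (dihedral_k x))"
    (is "_ = flip 10 ?s \<circ> lift 10 (_ \<circ> ?g)")
    if "p permutes {1..5}" "q permutes {1..5}" for p q x
  proof -
    have "f (p, q) \<circ> h x = (lift 10 (blocks 5 p q) \<circ> flip 10 ?s) \<circ> lift 10 ?g"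
      by (simp only: f_def prod.case h_def pair_sym_def comp_assoc)
    also have "lift 10 (blocks 5 p q) \<circ> flip 10 ?s = flip 10 (?s \<circ> inv' (blocks 5 p q)) \<circ> lift 10 (blocks 5 p q)"
      by (rule lift_flip[OF blocks_perm[OF that]])
    also have "flip 10 (?s \<circ> inv' (blocks 5 p q)) = flip 10 ?s"
      by (rule flip_cong) (simp add: side_pattern_inv[OF respects_sides_blocks[OF that]])
    finally show ?thesis by (simp only: comp_assoc lift_comp[OF block_sym_5_permutes])
  qed
  obtain \<theta> where \<theta>: "\<theta> \<in> hom ?D (AutoGroup ?N)" and S: "group (semidirect_product ?N ?D \<theta>)"
    and k: "(\<lambda>(n, x). f n \<otimes>\<^bsub>?K\<^esub> h x) \<in> hom (semidirect_product ?N ?D \<theta>) ?K"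
      "inj_on (\<lambda>(n, x). f n \<otimes>\<^bsub>?K\<^esub> h x) (carrier ?N \<times> carrier ?D)"
  proof (rule internal_semidirect_product[OF K.is_group N group_dihedral_4 f h])
    fix x n assume x: "x \<in> carrier ?D" and n: "n \<in> carrier ?N"
    obtain p q where pq: "n = (p, q)" "p permutes {1..5}" "q permutes {1..5}" "evenperm p" "evenperm q"
      using n unfolding inN by (cases n) auto
    define b k where "b = (dihedral_i x \<noteq> dihedral_j x)" and "k = dihedral_k x"
    let ?p = "tp b \<circ> (if k then q else p) \<circ> tp b" and ?q = "tp b \<circ> (if k then p else q) \<circ> tp b"
    have pq': "?p permutes {1..5}" "?q permutes {1..5}"
      using pq(2,3) by (auto intro!: permutes_compose t)
    moreover have "evenperm ?p" "evenperm ?q"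
      using pq by (auto simp: evenperm_comp permutation_compose permutation_tp evenperm_tp permutes_interval_permutation)
    ultimately have N': "(?p, ?q) \<in> carrier ?N" unfolding inN by simp
    have "h x \<circ> f n = flip 10 (side_pattern (dihedral_i x) (dihedral_j x)) \<circ> lift 10 (block_sym 5 b b k \<circ> blocks 5 p q)"
      unfolding h_def pair_sym_def f_def pq(1) prod.case b_def k_def
      by (simp only: comp_assoc lift_comp[OF blocks_perm[OF pq(2,3)]])
    also have "block_sym 5 b b k \<circ> blocks 5 p q = blocks 5 ?p ?q \<circ> block_sym 5 b b k"
      by (rule block_sym_comp_blocks[OF _ pq(2,3)]) simp
    finally have hf: "h x \<circ> f n = f (?p, ?q) \<circ> h x"
      unfolding f_h[OF pq'] b_def[symmetric] k_def[symmetric] .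
    have "h x \<circ> f n \<circ> inv' (h x) = f (?p, ?q) \<circ> (h x \<circ> inv' (h x))"
      unfolding hf by (simp only: comp_assoc)
    also have "h x \<circ> inv' (h x) = id"
      by (rule permutes_inv_o(1)) (use hK in \<open>simp only: sym_group_carrier\<close>)
    finally have "h x \<otimes>\<^bsub>?K\<^esub> f n \<otimes>\<^bsub>?K\<^esub> inv\<^bsub>?K\<^esub> h x = f (?p, ?q)"
      by (simp only: sym_group_mult sym_group_inv_equality[OF hK] comp_id)
    then show "h x \<otimes>\<^bsub>?K\<^esub> f n \<otimes>\<^bsub>?K\<^esub> inv\<^bsub>?K\<^esub> h x \<in> f ` carrier ?N"
      using N' by (rule image_eqI)
    show "x = \<one>\<^bsub>?D\<^esub>" if eq: "f n = h x"
    proof -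
      have "flip 10 (\<lambda>_. False) \<circ> lift 10 (blocks 5 p q) = flip 10 (side_pattern (dihedral_i x) (dihedral_j x)) \<circ>
          lift 10 (block_sym 5 b b k)"
        using eq by (simp add: flip_False f_def pq h_def pair_sym_def b_def k_def)
      note D = flip_lift_eqD[OF blocks_perm[OF pq(2,3)] block_sym_5_permutes this]
      have "\<not> k" using block_sym_eq_blocks[OF _ pq(2,3) D(1)] by simp
      moreover have "\<not> dihedral_i x" using D(2)[of 1] by (simp add: side_pattern_def)
      moreover have "\<not> dihedral_j x" using D(2)[of 6] by (simp add: side_pattern_def)
      moreover have "\<not> dihedral_i \<one>\<^bsub>?D\<^esub>" "\<not> dihedral_j \<one>\<^bsub>?D\<^esub>" "\<not> dihedral_k \<one>\<^bsub>?D\<^esub>" "\<one>\<^bsub>?D\<^esub> \<in> carrier ?D"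
        by (simp_all add: one_dihedral_4 dihedral_i_def dihedral_j_def dihedral_k_def carrier_dihedral_4)
      ultimately show ?thesis using x by (intro inj_onD[OF dihedral_ijk_inj]) (auto simp: k_def)
    qed
  qed
  let ?S = "semidirect_product ?N ?D \<theta>"
  define \<kappa> where "\<kappa> = (\<lambda>(n, x). f n \<otimes>\<^bsub>?K\<^esub> h x)"
  have \<kappa>: "\<kappa> \<in> hom ?S ?K" "inj_on \<kappa> (carrier ?S)" using k by (simp_all add: \<kappa>_def)
  have \<kappa>_form: "\<kappa> ((p, q), x) = flip 10 (side_pattern (dihedral_i x) (dihedral_j x)) \<circ>
      lift 10 (blocks 5 p q \<circ> block_sym 5 (dihedral_i x \<noteq> dihedral_j x) (dihedral_i x \<noteq> dihedral_j x) (dihedral_k x))"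
    if "p permutes {1..5}" "q permutes {1..5}" for p q x
    using f_h[OF that] by (simp only: \<kappa>_def prod.case sym_group_mult)
  define F where "F x = flip 10 (pattern x)" for x
  have Z2_8: "group Z2_8" by (rule product_group) simp
  have FK: "F x \<in> carrier ?K" for x by (simp only: F_def sym_group_carrier flip_perm)
  have Fmult: "F (x \<otimes>\<^bsub>Z2_8\<^esub> y) = F x \<circ> F y" for x y
    unfolding F_def flip_comp by (rule flip_cong) (rule pattern_mult)
  have F: "F \<in> hom Z2_8 ?K" "inj_on F (carrier Z2_8)"
  proof -
    show "F \<in> hom Z2_8 ?K"
    proof (rule homI)
      show "F x \<in> carrier ?K" for x by (rule FK)
      show "F (x \<otimes>\<^bsub>Z2_8\<^esub> y) = F x \<otimes>\<^bsub>?K\<^esub> F y" for x y by (simp only: Fmult sym_group_mult)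
    qed
    show "inj_on F (carrier Z2_8)"
    proof (rule inj_onI)
      fix x y assume xy: "x \<in> carrier Z2_8" "y \<in> carrier Z2_8" "F x = F y"
      show "x = y" by (rule pattern_inj[OF xy(1,2)]) (rule flip_eqD[OF xy(3)[unfolded F_def]])
    qed
  qed
  have F_even: "flip 10 d \<in> F ` carrier Z2_8" if ev: "even_pattern d" for d
  proof -
    obtain x where x: "x \<in> carrier Z2_8" "\<And>k. k \<in> {1..10} \<Longrightarrow> pattern x k = d k"
      using pattern_surj[OF ev] by blast
    have "flip 10 d = F x" unfolding F_def by (rule flip_cong) (simp only: x(2))
    then show ?thesis using x(1) by (rule image_eqI)
  qed
  have hW: "h x \<in> W" for x
  proof -
    \<comment> \<open>The first generator is corrected to \<open>pair_sym True False False\<close>: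
      an even pair reduces its permutations to the transposition of 1 and 2 in either block, and an
      even flip then reduces its flips to the first half.\<close>
    have e: "evenperm (tp True \<circ> inv' u)" "evenperm (tp True \<circ> inv' v)"
      using u v by (simp_all add: evenperm_comp permutation_tp permutation_inverse evenperm_inv
          permutes_interval_permutation[of _ 5] evenperm_tp)
    have p: "tp True \<circ> inv' u permutes {1..5}" "tp True \<circ> inv' v permutes {1..5}"
      by (intro permutes_compose permutes_inv u v t)+
    let ?B = "blocks 5 (tp True \<circ> inv' u) (tp True \<circ> inv' v)"
    have "?B \<circ> blocks 5 u v = blocks 5 (tp True) (tp True)"
      unfolding blocks_comp[OF u(1) v(1)] comp_assoc permutes_inv_o(2)[OF u(1)] permutes_inv_o(2)[OF v(1)] by simp
    then have "lift 10 ?B \<circ> lift 10 (blocks 5 u v) = lift 10 (block_sym 5 True True False)"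
      by (simp add: lift_comp[OF blocks_perm[OF u(1) v(1)]] block_sym_def)
    moreover have "lift 10 ?B \<circ> flip 10 c = flip 10 (c \<circ> inv' ?B) \<circ> lift 10 ?B"
      by (rule lift_flip[OF blocks_perm[OF p]])
    ultimately have "lift 10 ?B \<circ> (flip 10 c \<circ> lift 10 (blocks 5 u v)) =
        flip 10 (c \<circ> inv' ?B) \<circ> lift 10 (block_sym 5 True True False)"
      by (simp only: comp_assoc[symmetric]) (simp only: comp_assoc)
    then have one': "flip 10 (c \<circ> inv' ?B) \<circ> lift 10 (block_sym 5 True True False) \<in> W"
      using Wcomp[OF evenW[OF p e] aW] by simp
    let ?d = "\<lambda>k. c k \<noteq> side_pattern True False k"
    have ep: "even_pattern (?d \<circ> inv' ?B)" by (rule even_pattern_inv[OF respects_sides_blocks[OF p] c])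
    have "flip 10 (?d \<circ> inv' ?B) \<circ> (flip 10 (c \<circ> inv' ?B) \<circ> lift 10 (block_sym 5 True True False)) \<in> W"
      by (rule Wcomp[OF flipW[OF ep] one'])
    moreover have "flip 10 (?d \<circ> inv' ?B) \<circ> flip 10 (c \<circ> inv' ?B) = flip 10 (side_pattern True False)"
      unfolding flip_comp
    proof (rule flip_cong)
      fix k :: nat assume k: "k \<in> {1..10}"
      show "((?d \<circ> inv' ?B) k \<noteq> (c \<circ> inv' ?B) k) = side_pattern True False k"
        using side_pattern_inv[OF respects_sides_blocks[OF p] k, of True False] by auto
    qed
    ultimately have one: "pair_sym True False False \<in> W"
      by (simp add: pair_sym_def flip: comp_assoc)
    have ids: "pair_sym False False True = lift 10 (swap_blocks 5)"
      by (simp add: pair_sym_def side_pattern_def[abs_def] flip_False block_sym_def tp_def blocks_id)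
    have "pair_sym False False False = id"
      by (simp add: pair_sym_def side_pattern_def[abs_def] flip_False block_sym_def tp_def blocks_id)
    then have zero: "pair_sym False False False \<in> W" using subgroup.one_closed[OF W] by (simp add: sym_group_one)
    have b: "pair_sym False False True \<in> W" using bW ids by simp
    \<comment> \<open>Conjugating by the swap moves the flips to the second half; the products of
      the elements found so far exhaust all eight.\<close>
    have "pair_sym False False True \<circ> pair_sym True False False \<circ> pair_sym False False True \<in> W"
      by (intro Wcomp b one)
    then have two: "pair_sym False True False \<in> W" by (simp add: pair_sym_comp)
    have three: "pair_sym True True False \<in> W" using Wcomp[OF one two] by (simp add: pair_sym_comp)
    have all: "pair_sym i j False \<in> W" for i j using zero one two three by (cases i; cases j) simp_all
    have "pair_sym i j k \<in> W" for i j k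
      using all[of i j] Wcomp[OF all[of i j] b] by (cases k) (simp_all add: pair_sym_comp)
    then show ?thesis unfolding h_def .
  qed
  have "is_some_semidirect_product (subgroup_generated ?K Z) Z2_8 ?S"
  proof (rule generated_semidirect_product[OF K.is_group Z2_8 S F \<kappa>])
    fix y x assume y: "y \<in> carrier ?S" and x: "x \<in> carrier Z2_8"
    obtain p q d where pqd: "y = ((p, q), d)" "p permutes {1..5}" "q permutes {1..5}" "evenperm p" "evenperm q" "d \<in> carrier ?D"
      using y by (cases y) (auto simp: alt_group_carrier)
    define b k where "b = (dihedral_i d \<noteq> dihedral_j d)" and "k = dihedral_k d"
    define g s where "g = blocks 5 p q \<circ> block_sym 5 b b k" and "s = side_pattern (dihedral_i d) (dihedral_j d)"
    have \<kappa>y: "\<kappa> y = flip 10 s \<circ> lift 10 g"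
      unfolding pqd(1) \<kappa>_form[OF pqd(2,3)] g_def s_def b_def k_def ..
    have g: "respects_sides k g"
      using respects_sides_comp[OF respects_sides_blocks[OF pqd(2,3)] respects_sides_block_sym] by (simp add: g_def)
    then have gp: "g permutes {1..10}" by (simp add: respects_sides_def)
    have \<kappa>K: "\<kappa> y \<in> carrier ?K" using \<kappa>(1) y by (rule hom_in_carrier)
    have "\<kappa> y \<circ> F x = flip 10 s \<circ> (lift 10 g \<circ> flip 10 (pattern x))"
      by (simp only: \<kappa>y F_def comp_assoc)
    also have "\<dots> = flip 10 s \<circ> flip 10 (pattern x \<circ> inv' g) \<circ> lift 10 g"
      unfolding lift_flip[OF gp] by (simp only: comp_assoc)
    also have "flip 10 s \<circ> flip 10 (pattern x \<circ> inv' g) = flip 10 (pattern x \<circ> inv' g) \<circ> flip 10 s"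
      unfolding flip_comp by (rule flip_cong) blast
    finally have comm: "\<kappa> y \<circ> F x = flip 10 (pattern x \<circ> inv' g) \<circ> \<kappa> y" by (simp only: \<kappa>y comp_assoc)
    have "\<kappa> y \<circ> F x \<circ> inv' (\<kappa> y) = flip 10 (pattern x \<circ> inv' g) \<circ> (\<kappa> y \<circ> inv' (\<kappa> y))"
      unfolding comm by (simp only: comp_assoc)
    also have "\<kappa> y \<circ> inv' (\<kappa> y) = id"
      by (rule permutes_inv_o(1)) (use \<kappa>K in \<open>simp only: sym_group_carrier\<close>)
    finally have "\<kappa> y \<otimes>\<^bsub>?K\<^esub> F x \<otimes>\<^bsub>?K\<^esub> inv\<^bsub>?K\<^esub> \<kappa> y = flip 10 (pattern x \<circ> inv' g)"
      by (simp only: sym_group_mult sym_group_inv_equality[OF \<kappa>K] comp_id)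
    then show "\<kappa> y \<otimes>\<^bsub>?K\<^esub> F x \<otimes>\<^bsub>?K\<^esub> inv\<^bsub>?K\<^esub> \<kappa> y \<in> F ` carrier Z2_8"
      using F_even[OF even_pattern_inv[OF g even_pattern_pattern]] by simp
    show "y = \<one>\<^bsub>?S\<^esub>" if eq: "F x = \<kappa> y"
    proof -
      have "flip 10 (pattern x) \<circ> lift 10 id = flip 10 s \<circ> lift 10 g"
        using eq unfolding \<kappa>y F_def by (simp add: blocks_id)
      note D = flip_lift_eqD[OF permutes_id gp this]
      have "block_sym 5 b b k = (blocks 5 (inv' p) (inv' q) \<circ> blocks 5 p q) \<circ> block_sym 5 b b k"
        by (simp only: blocks_comp[OF pqd(2,3)] permutes_inv_o[OF pqd(2)] permutes_inv_o[OF pqd(3)] blocks_id id_o)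
      also have "\<dots> = blocks 5 (inv' p) (inv' q)"
        using D(1) unfolding g_def comp_assoc by (simp flip: g_def)
      finally have eq': "blocks 5 (inv' p) (inv' q) = block_sym 5 b b k" ..
      have "\<not> k \<and> inv' p = tp b \<and> inv' q = tp b"
        by (rule block_sym_eq_blocks[OF _ permutes_inv[OF pqd(2)] permutes_inv[OF pqd(3)] eq']) simp
      moreover from this have "\<not> b"
        using evenperm_inv[OF permutes_interval_permutation[OF pqd(2)]] pqd(4) evenperm_tp[of b] by simp
      ultimately have nb: "\<not> k" "\<not> b" "inv' p = id" "inv' q = id" by (simp_all add: tp_def)
      then have pq: "p = id" "q = id"
        using permutes_inv_inv[OF pqd(2)] permutes_inv_inv[OF pqd(3)] by (simp_all add: inv_id)
      have "even_pattern (pattern x)" by (rule even_pattern_pattern)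
      moreover have "pattern x k = s k" if "k \<in> {1..10}" for k using D(2)[OF that] .
      \<comment> \<open>A half has five pairs, an odd number, so an even pattern cannot flip all of
        it.\<close>
      ultimately have "\<not> dihedral_i d" unfolding even_pattern_iff by (simp add: s_def side_pattern_def)
      moreover have "\<not> dihedral_j d" using calculation nb(2) by (simp add: b_def)
      moreover have "\<not> dihedral_i \<one>\<^bsub>?D\<^esub>" "\<not> dihedral_j \<one>\<^bsub>?D\<^esub>" "\<not> dihedral_k \<one>\<^bsub>?D\<^esub>" "\<one>\<^bsub>?D\<^esub> \<in> carrier ?D"
        by (simp_all add: one_dihedral_4 dihedral_i_def dihedral_j_def dihedral_k_def carrier_dihedral_4)
      ultimately have "d = \<one>\<^bsub>?D\<^esub>" using nb(1) pqd(6) by (intro inj_onD[OF dihedral_ijk_inj]) (auto simp: k_def)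
      then show ?thesis by (simp add: pqd(1) pq alt_group_one)
    qed
  next
    let ?im = "(\<lambda>(n, x). F n \<otimes>\<^bsub>?K\<^esub> \<kappa> x) ` (carrier Z2_8 \<times> carrier ?S)"
    have im: "flip 10 d \<circ> \<kappa> y \<in> ?im" if ev: "even_pattern d" and y: "y \<in> carrier ?S" for d y
    proof -
      obtain x where "x \<in> carrier Z2_8" "flip 10 d = F x" using F_even[OF ev] by blast
      then show ?thesis using y by (intro image_eqI[of _ _ "(x, y)"]) (simp_all add: sym_group_mult)
    qed
    have "flip 10 c \<circ> lift 10 (blocks 5 u v) \<in> ?im"
    proof -
      let ?p = "u \<circ> tp True" and ?q = "v \<circ> tp True"
      have pq: "?p permutes {1..5}" "?q permutes {1..5}" by (intro permutes_compose u v t)+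
      have e: "evenperm ?p" "evenperm ?q"
        using u v by (simp_all add: evenperm_comp permutation_tp permutes_interval_permutation[of _ 5] evenperm_tp)
      have d: "dihedral_i (1, 1)" "\<not> dihedral_j (1, 1)" "\<not> dihedral_k (1, 1)"
        by (simp_all add: dihedral_i_def dihedral_j_def dihedral_k_def)
      have y: "((?p, ?q), (1, 1)) \<in> carrier ?S" using pq e by (simp add: alt_group_carrier carrier_dihedral_4)
      have "blocks 5 ?p ?q \<circ> block_sym 5 True True False = blocks 5 u v"
        by (simp add: block_sym_def blocks_comp[OF t t] comp_assoc tp_tp_id)
      then have "\<kappa> ((?p, ?q), (1, 1)) = flip 10 (side_pattern True False) \<circ> lift 10 (blocks 5 u v)"
        unfolding \<kappa>_form[OF pq] using d by simp
      then have "flip 10 (\<lambda>k. c k \<noteq> side_pattern True False k) \<circ> \<kappa> ((?p, ?q), (1, 1)) =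
          (flip 10 (\<lambda>k. c k \<noteq> side_pattern True False k) \<circ> flip 10 (side_pattern True False)) \<circ> lift 10 (blocks 5 u v)"
        by (simp only: comp_assoc)
      also have "flip 10 (\<lambda>k. c k \<noteq> side_pattern True False k) \<circ> flip 10 (side_pattern True False) = flip 10 c"
        unfolding flip_comp by (rule flip_cong) blast
      finally have eq: "flip 10 (\<lambda>k. c k \<noteq> side_pattern True False k) \<circ> \<kappa> ((?p, ?q), (1, 1)) =
          flip 10 c \<circ> lift 10 (blocks 5 u v)" .
      show ?thesis using im[OF c y] unfolding eq .
    qed
    moreover have "lift 10 (swap_blocks 5) \<in> ?im"
    proof -
      have d: "\<not> dihedral_i (0, 1)" "\<not> dihedral_j (0, 1)" "dihedral_k (0, 1)"
        by (simp_all add: dihedral_i_def dihedral_j_def dihedral_k_def)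
      have y: "((id, id), (0, 1)) \<in> carrier ?S" by (simp add: alt_group_carrier carrier_dihedral_4 permutes_id)
      have "\<kappa> ((id, id), (0, 1)) = lift 10 (swap_blocks 5)"
        unfolding \<kappa>_form[OF permutes_id permutes_id] using d
        by (simp add: side_pattern_def[abs_def] flip_False block_sym_def tp_def blocks_id)
      then have eq: "flip 10 (\<lambda>_. False) \<circ> \<kappa> ((id, id), (0, 1)) = lift 10 (swap_blocks 5)" by (simp add: flip_False)
      have "even_pattern (\<lambda>_. False)" by (simp add: even_pattern_def)
      from im[OF this y] show ?thesis unfolding eq .
    qed
    ultimately show "Z \<subseteq> ?im" by (simp add: Z_def)
    show "F ` carrier Z2_8 \<subseteq> generate ?K Z"
      using flipW[OF even_pattern_pattern] unfolding W_def F_def by blast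
    show "\<kappa> ` carrier ?S \<subseteq> generate ?K Z"
    proof
      fix w assume "w \<in> \<kappa> ` carrier ?S"
      then obtain n x where nx: "w = f n \<circ> h x" "n \<in> carrier ?N" by (auto simp: \<kappa>_def sym_group_mult)
      moreover have "f n \<in> W" using evenW nx(2) unfolding inN f_def by (auto simp: split_beta)
      ultimately show "w \<in> generate ?K Z" using Wcomp hW unfolding W_def by blast
    qed
  qed
  then show ?thesis using \<theta> by blast
qed


text \<open>\<open>cs\<close> lists the flipped pairs; otherwise as in \<open>block_table\<close>,
  one level down. The two-element sets in the list are the basis of the even patterns.\<close>

definition pair_table where
  "pair_table la lb cs lu ru lv rv prog ts \<longleftrightarrow>
     sort lu = [1..<Suc 5] \<and> sort lv = [1..<Suc 5] \<and> sort ru = [1..<Suc 5] \<and> sort rv = [1..<Suc 5] \<and>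
     sort la = [1..<Suc 20] \<and> sort lb = [1..<Suc 20] \<and>
     la = map (flip 10 (\<lambda>k. k \<in> set cs) \<circ> lift 10 (blocks 5 (tab lu) (tab lv))) [1..<Suc 20] \<and>
     lb = map (lift 10 (swap_blocks 5)) [1..<Suc 20] \<and>
     comp_tab ru ru = map (tp True \<circ> tab lu) [1..<Suc 5] \<and>
     comp_tab rv rv = map (tp True \<circ> tab lv) [1..<Suc 5] \<and>
     odd (length (filter (\<lambda>k. k \<in> set cs) [1, 2, 3, 4, 5])) \<and>
     even (length (filter (\<lambda>k. k \<in> set cs) [6, 7, 8, 9, 10])) \<and>
     (let L = slp [la, lb] prog in
      list_all (\<lambda>(i, j). map (flip 10 (\<lambda>k. k = i \<or> k = j)) [1..<Suc 20] \<in> set L)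
        [(1, 5), (2, 5), (3, 5), (4, 5), (6, 10), (7, 10), (8, 10), (9, 10)] \<and>
      list_all (\<lambda>(x, y, z). map (lift 10 (blocks 5 (three_cycle x y z) id)) [1..<Suc 20] \<in> set L) ts) \<and>
     list_all (\<lambda>(x, y, z). distinct [x, y, z] \<and> list_all (\<lambda>i. 1 \<le> i \<and> i \<le> 5) [x, y, z]) ts \<and>
     (let U = linked [1] ts in list_all (\<lambda>i. i \<in> set U) [1..<Suc 5])"

lemma pair_table_monodromy:
  assumes t: "pair_table la lb cs lu ru lv rv prog ts"
  shows "\<exists>\<theta>\<in>hom (dihedral_group 4) (AutoGroup (alt_group 5 \<times>\<times> alt_group 5)).
    is_some_semidirect_product (subgroup_generated (sym_group 20) {tab la, tab lb}) Z2_8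
      (semidirect_product (alt_group 5 \<times>\<times> alt_group 5) (dihedral_group 4) \<theta>)"
proof -
  define c where "c k \<longleftrightarrow> k \<in> set cs" for k
  have s: "sort lu = [1..<Suc 5]" "sort lv = [1..<Suc 5]" "sort ru = [1..<Suc 5]" "sort rv = [1..<Suc 5]"
    "sort la = [1..<Suc 20]" "sort lb = [1..<Suc 20]"
    and la: "la = map (flip 10 c \<circ> lift 10 (blocks 5 (tab lu) (tab lv))) [1..<Suc 20]"
    and lb: "lb = map (lift 10 (swap_blocks 5)) [1..<Suc 20]"
    and sq: "comp_tab ru ru = map (tp True \<circ> tab lu) [1..<Suc 5]" "comp_tab rv rv = map (tp True \<circ> tab lv) [1..<Suc 5]"
    and odd: "odd (length (filter c [1, 2, 3, 4, 5]))" "even (length (filter c [6, 7, 8, 9, 10]))"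
    using t unfolding pair_table_def c_def[abs_def, symmetric] by - (elim conjE, assumption)+
  have basis: "\<forall>(i, j)\<in>set [(1, 5), (2, 5), (3, 5), (4, 5), (6, 10), (7, 10), (8, 10), (9, 10)].
      map (flip 10 (\<lambda>k. k = i \<or> k = j)) [1..<Suc 20] \<in> set (slp [la, lb] prog)"
    using t unfolding pair_table_def Let_def list_all_iff[of _ "[(1, 5), (2, 5), (3, 5), (4, 5), (6, 10), (7, 10), (8, 10), (9, 10)]"] by - (elim conjE)
  note u = tab_permutes[OF s(1)] and v = tab_permutes[OF s(2)]
  have flip_tab: "tab (map (flip 10 d) [1..<Suc 20]) = flip 10 d" for d
    by (rule tab_map_upt, rule permutes_not_in) (use flip_permutes[of 10 d] in simp)
  have lift_tab: "tab (map (lift 10 g) [1..<Suc 20]) = lift 10 g" if "g permutes {1..10}" for g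
    by (rule tab_map_upt, rule permutes_not_in) (use blocks_permutes[OF that that] in simp)
  have uv: "blocks 5 (tab lu) (tab lv) permutes {1..10}" using blocks_permutes[OF u v] by simp
  have a: "tab la = flip 10 c \<circ> lift 10 (blocks 5 (tab lu) (tab lv))"
    unfolding la
    by (rule tab_map_upt, rule permutes_not_in[OF permutes_compose[OF _ flip_permutes[of 10 c, simplified]]])
      (use blocks_permutes[OF uv uv] in simp_all)
  have b: "tab lb = lift 10 (swap_blocks 5)"
    unfolding lb by (rule lift_tab) (use swap_blocks_permutes[of 5] in simp)
  have odd_perm: "\<not> evenperm (tab l)"
    if "tab l permutes {1..5}" "sort r = [1..<Suc 5]" "comp_tab r r = map (tp True \<circ> tab l) [1..<Suc 5]" for l r
  proof -
    have "evenperm (tp True \<circ> tab l)"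
      by (rule evenperm_square[OF that(2,3)]) (rule permutes_compose[OF that(1) tp_permutes], simp)
    then show ?thesis
      using evenperm_comp[OF permutation_tp permutes_interval_permutation[OF that(1)], of True] evenperm_tp[of True] by auto
  qed
  have flipW: "flip 10 (\<lambda>k. k = i \<or> k = j) \<in> generate (sym_group 20) {tab la, tab lb}"
    if "(i, j) \<in> set [(1, 5), (2, 5), (3, 5), (4, 5), (6, 10), (7, 10), (8, 10), (9, 10)]" for i j
  proof -
    have "map (flip 10 (\<lambda>k. k = i \<or> k = j)) [1..<Suc 20] \<in> set (slp [la, lb] prog)"
      using bspec[OF basis that] by (simp only: prod.case)
    from slp_generate[OF s(5,6) this] show ?thesis by (simp only: flip_tab)
  qed
  have ts: "distinct [x, y, z]" "list_all (\<lambda>i. 1 \<le> i \<and> i \<le> 5) [x, y, z]"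
    "map (lift 10 (blocks 5 (three_cycle x y z) id)) [1..<Suc 20] \<in> set (slp [la, lb] prog)"
    if "(x, y, z) \<in> set ts" for x y z
    using t that unfolding pair_table_def Let_def list_all_iff[of _ ts] by blast+
  show ?thesis
    unfolding a b
  proof (rule pair_monodromy[OF u odd_perm[OF u s(3) sq(1)] v odd_perm[OF v s(4) sq(2)]])
    show "even_pattern (\<lambda>k. c k \<noteq> side_pattern True False k)"
      using odd by (simp add: even_pattern_iff side_pattern_def split: if_splits)
    show "flip 10 (\<lambda>k. k = i \<or> k = 5) \<in> generate (sym_group 20) {flip 10 c \<circ> lift 10 (blocks 5 (tab lu) (tab lv)), lift 10 (swap_blocks 5)}"
      if "i \<in> {1..4}" for i
    proof -
      have "i = 1 \<or> i = 2 \<or> i = 3 \<or> i = 4" using that by (simp only: atLeastAtMost_iff) presburger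
      then show ?thesis using flipW[of i 5] by (auto simp: a b)
    qed
    show "flip 10 (\<lambda>k. k = i \<or> k = 10) \<in> generate (sym_group 20) {flip 10 c \<circ> lift 10 (blocks 5 (tab lu) (tab lv)), lift 10 (swap_blocks 5)}"
      if "i \<in> {6..9}" for i
    proof -
      have "i = 6 \<or> i = 7 \<or> i = 8 \<or> i = 9" using that by (simp only: atLeastAtMost_iff) presburger
      then show ?thesis using flipW[of i 10] by (auto simp: a b)
    qed
    fix x y z assume xyz: "(x, y, z) \<in> set ts"
    have "blocks 5 (three_cycle x y z) id permutes {1..10}"
      using blocks_permutes[OF three_cycle_permutes[OF ts(1,2)[OF xyz]] permutes_id] by simp
    then show "lift 10 (blocks 5 (three_cycle x y z) id) \<in>
        generate (sym_group 20) {flip 10 c \<circ> lift 10 (blocks 5 (tab lu) (tab lv)), lift 10 (swap_blocks 5)}"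
      using slp_generate[OF s(5,6) ts(3)[OF xyz]] by (simp only: a b lift_tab)
    show "distinct [x, y, z] \<and> {x, y, z} \<subseteq> {1..5}" using ts(1,2)[OF xyz] by auto
  next
    show "{1..5} \<subseteq> set (linked [1] ts)"
      using t unfolding pair_table_def Let_def list_all_iff[of _ "[1..<Suc 5]"] set_upt_1 by blast
  qed
qed

declare One_nat_def [simp]

section \<open>Special linear groups\<close>

lemma SL_simps [simp]:
  "carrier (SL :: ('k::field^'n^'n) monoid) = {A. det A = 1}"
  "monoid.mult (SL :: ('k::field^'n^'n) monoid) = (**)"
  "\<one>\<^bsub>(SL :: ('k::field^'n^'n) monoid)\<^esub> = mat 1"
  by (simp_all add: SL_def)

lemma group_SL: "group (SL :: ('k::field^'n^'n) monoid)"
proof (rule groupI)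
  fix A :: "'k^'n^'n" assume "A \<in> carrier SL"
  then have A: "det A = 1" by simp
  then obtain B where B: "B ** A = mat 1"
    using invertible_det_nz[of A] by (auto simp: invertible_def)
  then have "det B = 1" using det_mul[of B A] A by simp
  then show "\<exists>B\<in>carrier SL. B \<otimes>\<^bsub>SL\<^esub> A = \<one>\<^bsub>SL\<^esub>" using B by auto
qed (auto simp: det_mul matrix_mul_assoc)

lemma PSL_iso_SL:
  assumes "group_center (SL :: ('k::field^'n^'n) monoid) = {mat 1}"
  shows "(PSL :: ('k^'n^'n) set monoid) \<cong> (SL :: ('k^'n^'n) monoid)"
proof -
  have "the_elem \<in> iso ((SL :: ('k^'n^'n) monoid) Mod {\<one>\<^bsub>SL\<^esub>}) SL"
    by (rule group.trivial_factor_iso[OF group_SL])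
  then show ?thesis using assms by (intro is_isoI) (simp add: PSL_def)
qed

lemma SL_vector_nonzero:
  fixes A :: "'k::field^'n^'n"
  assumes "det A = 1" "v \<noteq> 0"
  shows "A *v v \<noteq> 0"
proof
  assume "A *v v = 0"
  obtain B where "B ** A = mat 1"
    using invertible_det_nz[of A] assms(1) by (auto simp: invertible_def)
  then have "v = B *v (A *v v)" by (simp add: matrix_vector_mul_assoc)
  then show False using \<open>A *v v = 0\<close> assms(2) by simp
qed

text \<open>Compare the two products of Z with the transvection I + E, where E has its single entry
  1 in row i and column j.\<close>

lemma center_entries:
  fixes Z :: "'k::field^'n^'n" and i j :: 'n
  assumes Z: "Z \<in> group_center SL" and ij: "i \<noteq> j"
  shows "Z $ j $ i = 0 \<and> Z $ i $ i = Z $ j $ j"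
proof -
  define E :: "'k^'n^'n" where "E = (\<chi> r s. if r = i \<and> s = j then 1 else 0)"
  let ?U = "mat 1 + E"
  have "det ?U = 1"
  proof -
    have U: "?U = (\<chi> r. if r = i then row i (mat 1 :: 'k^'n^'n) + 1 *s row j (mat 1) else row r (mat 1))"
      by (auto simp: vec_eq_iff E_def mat_def row_def)
    show ?thesis unfolding U by (simp only: det_row_operation[OF ij] det_I)
  qed
  then have "Z ** ?U = ?U ** Z" using Z by (simp add: group_center_def)
  moreover have "Z ** ?U = Z + Z ** E" by (simp add: matrix_add_ldistrib)
  moreover have "?U ** Z = mat 1 ** Z + E ** Z"
    by (simp add: vec_eq_iff matrix_matrix_mult_def sum.distrib distrib_right)
  ultimately have c: "Z ** E = E ** Z" by simp
  have ZE: "(Z ** E) $ r $ s = (if s = j then Z $ r $ i else 0)" for r s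
    by (simp add: matrix_matrix_mult_def E_def if_distrib cong: if_cong)
  have EZ: "(E ** Z) $ r $ s = (if r = i then Z $ j $ s else 0)" for r s
    by (simp add: matrix_matrix_mult_def E_def if_distrib if_distribR cong: if_cong)
  have "(Z ** E) $ j $ j = (E ** Z) $ j $ j" "(Z ** E) $ i $ j = (E ** Z) $ i $ j" unfolding c by simp_all
  then show ?thesis unfolding ZE EZ using ij by auto
qed

lemma center_scalar:
  fixes Z :: "'k::field^'n^'n"
  assumes Z: "Z \<in> group_center SL"
  shows "Z = mat (Z $ i $ i)"
  unfolding vec_eq_iff
proof (intro allI)
  fix r s
  show "Z $ r $ s = mat (Z $ i $ i) $ r $ s"
  proof (cases "r = s")
    case True
    then show ?thesis using center_entries[OF Z, of r i] by (cases "r = i") (simp_all add: mat_def)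
  next
    case False
    then show ?thesis using center_entries[OF Z, of s r] by (simp add: mat_def)
  qed
qed

lemma one_in_center: "mat 1 \<in> group_center (SL :: ('k::field^'n^'n) monoid)"
  by (simp add: group_center_def)

lemma center_SL_3_bit: "group_center (SL :: (bit^3^3) monoid) = {mat 1}"
proof -
  have "Z = mat 1" if Z: "Z \<in> group_center SL" for Z :: "bit^3^3"
  proof -
    note s = center_scalar[OF Z, of 1]
    have "det Z = 1" using Z by (simp add: group_center_def)
    then have "Z $ 1 $ 1 \<noteq> 0" using s by (metis det_0 mat_0 zero_neq_one)
    then have "Z $ 1 $ 1 = 1" by simp
    then show ?thesis using s by metis
  qed
  then show ?thesis using one_in_center by auto
qed

declare One_nat_def [simp del]

section \<open>The action of \<open>SL(3,2)\<close> on the nonzero vectors\<close>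

definition dec3 :: "nat \<Rightarrow> bit^3" where
  "dec3 n = vector [of_bool (odd n), of_bool (odd (n div 2)), of_bool (odd (n div 4))]"

definition enc3 :: "bit^3 \<Rightarrow> nat" where
  "enc3 v = of_bool (v $ 1 = 1) + 2 * of_bool (v $ 2 = 1) + 4 * of_bool (v $ 3 = 1)"

text \<open>Bitwise exclusive or of three-digit binary numbers, which is addition of the encoded
  vectors.\<close>

definition xor3 :: "nat \<Rightarrow> nat \<Rightarrow> nat" where
  "xor3 a b = of_bool (odd a \<noteq> odd b) + 2 * of_bool (odd (a div 2) \<noteq> odd (b div 2)) +
     4 * of_bool (odd (a div 4) \<noteq> odd (b div 4))"

lemma dec_enc3: "dec3 (enc3 v) = v"
proof -
  have "x = 0 \<or> x = 1" for x :: bit by (cases x) auto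
  then have "(v $ 1 = 0 \<or> v $ 1 = 1) \<and> (v $ 2 = 0 \<or> v $ 2 = 1) \<and> (v $ 3 = 0 \<or> v $ 3 = 1)" by blast
  then show ?thesis
    unfolding vec_eq_iff forall_3 by (elim conjE disjE) (simp_all add: dec3_def enc3_def vector_3)
qed

lemma nat_less_8: "n < 8 \<Longrightarrow> n \<in> {0, 1, 2, 3, 4, 5, 6, 7 :: nat}"
  by (simp only: insert_iff empty_iff) presburger

lemma enc_dec3: "n < 8 \<Longrightarrow> enc3 (dec3 n) = n"
  by (drule nat_less_8, elim insertE emptyE) (simp_all add: dec3_def enc3_def vector_3)

lemma enc3_less: "enc3 v < 8"
  by (simp add: enc3_def of_bool_def)

lemma enc3_add: "enc3 (u + v) = xor3 (enc3 u) (enc3 v)"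
proof -
  have "(x + y = 1) = ((x = 1) \<noteq> (y = 1))" for x y :: bit by (cases x; cases y; simp)
  moreover have "odd (enc3 w) = (w $ 1 = 1)" "odd (enc3 w div 2) = (w $ 2 = 1)" "odd (enc3 w div 4) = (w $ 3 = 1)" for w
    by (simp_all add: enc3_def of_bool_def)
  ultimately show ?thesis by (simp add: xor3_def enc3_def[of "u + v"] del: add_bit_eq_xor)
qed

definition act3 :: "bit^3^3 \<Rightarrow> nat \<Rightarrow> nat" where
  "act3 A i = (if i \<in> {1..7} then enc3 (A *v dec3 i) else i)"

lemma dec3_zero_iff: "n < 8 \<Longrightarrow> dec3 n = 0 \<longleftrightarrow> n = 0"
proof -
  have "dec3 0 = 0" unfolding vec_eq_iff forall_3 by (simp add: dec3_def vector_3)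
  then show "n < 8 \<Longrightarrow> dec3 n = 0 \<longleftrightarrow> n = 0" using enc_dec3[of n] enc_dec3[of 0] by auto
qed

lemma act3_in:
  assumes "det A = 1" "i \<in> {1..7}"
  shows "act3 A i \<in> {1..7}" "dec3 (act3 A i) = A *v dec3 i"
proof -
  have "dec3 i \<noteq> 0" using dec3_zero_iff[of i] assms(2) by simp
  then have "A *v dec3 i \<noteq> 0" by (rule SL_vector_nonzero[OF assms(1)])
  show d: "dec3 (act3 A i) = A *v dec3 i" using assms(2) by (simp only: act3_def if_True dec_enc3)
  have "act3 A i < 8" using assms(2) enc3_less by (simp only: act3_def if_True)
  moreover have "act3 A i \<noteq> 0"
  proof
    assume "act3 A i = 0"
    then have "A *v dec3 i = dec3 0" using d by simp
    then show False using \<open>A *v dec3 i \<noteq> 0\<close> dec3_zero_iff[of 0] by simp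
  qed
  ultimately show "act3 A i \<in> {1..7}" by simp
qed

lemma act3_comp:
  assumes "det A = 1" "det B = 1"
  shows "act3 (A ** B) = act3 A \<circ> act3 B"
proof
  fix i show "act3 (A ** B) i = (act3 A \<circ> act3 B) i"
  proof (cases "i \<in> {1..7}")
    case True
    note B = act3_in[OF assms(2) True]
    have "act3 A (act3 B i) = enc3 (A *v (B *v dec3 i))"
      using B by (simp only: act3_def[of A] if_True)
    also have "\<dots> = act3 (A ** B) i" using True by (simp only: act3_def[of "A ** B"] if_True matrix_vector_mul_assoc)
    finally show ?thesis by simp
  next
    case False
    then show ?thesis by (simp only: act3_def o_apply if_False)
  qed
qed

lemma act3_id: "act3 (mat 1) = id"
  by (auto simp: act3_def fun_eq_iff enc_dec3)

lemma act3_inj: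
  assumes "act3 A = act3 B" shows "A = B"
  unfolding matrix_eq
proof
  fix v show "A *v v = B *v v"
  proof (cases "enc3 v \<in> {1..7}")
    case True
    then have "enc3 (A *v v) = enc3 (B *v v)"
      using fun_cong[OF assms, of "enc3 v"] by (simp only: act3_def if_True dec_enc3)
    then show ?thesis by (metis dec_enc3)
  next
    case False
    then have "enc3 v = 0" using enc3_less[of v] by simp
    then have "v = 0" by (metis dec_enc3 dec3_zero_iff zero_less_numeral)
    then show ?thesis by simp
  qed
qed

lemma act3_permutes:
  assumes A: "det A = 1" shows "act3 A permutes {1..7}"
proof (rule permutes_if_bij)
  interpret G: group "SL :: (bit^3^3) monoid" by (rule group_SL)
  have A': "A \<in> carrier SL" using A by simp
  define B where "B = inv\<^bsub>SL\<^esub> A"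
  have "B \<in> carrier SL" unfolding B_def by (rule G.inv_closed[OF A'])
  then have B: "det B = 1" "B ** A = mat 1" "A ** B = mat 1"
    using G.l_inv[OF A'] G.r_inv[OF A'] by (simp_all add: B_def)
  show "bij (act3 A)"
    by (rule o_bij[of "act3 B"]) (simp_all only: act3_comp[OF A B(1), symmetric] act3_comp[OF B(1) A, symmetric] B act3_id)
  show "act3 A x = x" if "x \<notin> {1..7}" for x using that by (simp only: act3_def if_False)
qed

text \<open>The basis vectors have the codes 1, 2 and 4; a linear map is given by their images and
  extended to the codes 1 to 7 by addition.\<close>

definition linear_table :: "nat \<Rightarrow> nat \<Rightarrow> nat \<Rightarrow> nat list" where
  "linear_table a b c = [a, b, xor3 a b, c, xor3 a c, xor3 b c, xor3 (xor3 a b) c]"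

lemma act3_table: "map (act3 A) [1..<Suc 7] = linear_table (act3 A 1) (act3 A 2) (act3 A 4)"
proof -
  have d: "dec3 3 = dec3 1 + dec3 2" "dec3 5 = dec3 1 + dec3 4" "dec3 6 = dec3 2 + dec3 4"
    "dec3 7 = dec3 1 + dec3 2 + dec3 4"
    unfolding vec_eq_iff forall_3 by (simp_all add: dec3_def vector_3)
  have "act3 A 3 = xor3 (act3 A 1) (act3 A 2)" "act3 A 5 = xor3 (act3 A 1) (act3 A 4)"
    "act3 A 6 = xor3 (act3 A 2) (act3 A 4)" "act3 A 7 = xor3 (xor3 (act3 A 1) (act3 A 2)) (act3 A 4)"
    by (simp_all add: act3_def d matrix_vector_right_distrib enc3_add)
  moreover have "[1..<Suc 7] = [1, 2, 3, 4, 5, 6, 7]" by (simp add: upt_rec)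
  ultimately show ?thesis by (simp add: linear_table_def)
qed

definition of_columns3 :: "nat \<Rightarrow> nat \<Rightarrow> nat \<Rightarrow> bit^3^3" where
  "of_columns3 a b c = transpose (vector [dec3 a, dec3 b, dec3 c])"

lemma act3_of_columns3:
  assumes "a < 8" "b < 8" "c < 8"
  shows "act3 (of_columns3 a b c) 1 = a" "act3 (of_columns3 a b c) 2 = b" "act3 (of_columns3 a b c) 4 = c"
proof -
  have basis: "dec3 1 = vector [1, 0, 0]" "dec3 2 = vector [0, 1, 0]" "dec3 4 = vector [0, 0, 1]"
    by (simp_all add: dec3_def)
  have "of_columns3 a b c *v dec3 1 = dec3 a" "of_columns3 a b c *v dec3 2 = dec3 b" "of_columns3 a b c *v dec3 4 = dec3 c"
    unfolding vec_eq_iff forall_3 basis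
    by (simp_all add: of_columns3_def matrix_vector_mult_def sum_3 Finite_Cartesian_Product.transpose_def vector_3
        del: add_bit_eq_xor mult_bit_eq_and)
  then show "act3 (of_columns3 a b c) 1 = a" "act3 (of_columns3 a b c) 2 = b" "act3 (of_columns3 a b c) 4 = c"
    using assms by (simp_all add: act3_def enc_dec3)
qed

lemma tab_linear_table:
  assumes "l = linear_table a b c" "a < 8" "b < 8" "c < 8" "det (of_columns3 a b c) = 1"
  shows "tab l = act3 (of_columns3 a b c)"
proof -
  have "tab (map (act3 (of_columns3 a b c)) [1..<Suc 7]) = act3 (of_columns3 a b c)"
    by (rule tab_map_upt, rule permutes_not_in[OF act3_permutes[OF assms(5)]])
  then show ?thesis
    unfolding act3_table act3_of_columns3[OF assms(2-4)] assms(1) .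
qed

text \<open>A stabiliser chain: the listed words move 1 to all 7 points, move 2 to the 6 other
  points while fixing 1, and move 4 to 4 points while fixing 1 and 2. Dividing by a suitable word at
  each stage leaves a linear map that fixes a basis, so every element of SL is a product of three
  words.\<close>

lemma PSL_3_2_tables:
  assumes la: "la = linear_table a b c" "a < 8" "b < 8" "c < 8" "det (of_columns3 a b c) = 1"
    and lb: "lb = linear_table a' b' c'" "a' < 8" "b' < 8" "c' < 8" "det (of_columns3 a' b' c') = 1"
    and sorted: "sort la = [1..<Suc 7]" "sort lb = [1..<Suc 7]"
    and check: "let L = slp [la, lb] prog in
      list_all (\<lambda>i. list_ex (\<lambda>l. tab l 1 = i) L) [1..<8] \<and>
      list_all (\<lambda>i. list_ex (\<lambda>l. tab l 1 = 1 \<and> tab l 2 = i) L) [2..<8] \<and>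
      list_all (\<lambda>i. list_ex (\<lambda>l. tab l 1 = 1 \<and> tab l 2 = 2 \<and> tab l 4 = i) L) [4..<8]"
  shows "subgroup_generated (sym_group 7) {tab la, tab lb} \<cong> (PSL :: (bit^3^3) set monoid)"
proof -
  interpret K: group "sym_group 7" by (rule sym_group_is_group)
  interpret G: group "SL :: (bit^3^3) monoid" by (rule group_SL)
  interpret h: group_hom "SL :: (bit^3^3) monoid" "sym_group 7" act3
    by (rule group_hom.intro[OF group_SL K.is_group], unfold group_hom_axioms_def, rule homI)
      (simp_all add: sym_group_carrier sym_group_mult act3_permutes act3_comp)
  have gens: "tab la = act3 (of_columns3 a b c)" "tab lb = act3 (of_columns3 a' b' c')"
    by (rule tab_linear_table; fact)+
  let ?Z = "{tab la, tab lb}"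
  have Z: "?Z \<subseteq> act3 ` carrier SL" using gens la(5) lb(5) by auto
  have Z': "?Z \<subseteq> carrier (sym_group 7)"
    unfolding gens using act3_permutes la(5) lb(5) by (simp add: sym_group_carrier)
  have "generate (sym_group 7) ?Z = act3 ` carrier SL"
  proof
    show "generate (sym_group 7) ?Z \<subseteq> act3 ` carrier SL"
      by (rule K.generate_subgroup_incl[OF Z h.img_is_subgroup])
    show "act3 ` carrier SL \<subseteq> generate (sym_group 7) ?Z"
    proof
      fix p assume "p \<in> act3 ` carrier SL"
      then obtain A where A: "det A = 1" "p = act3 A" by auto
      have Wcomp: "p \<circ> q \<in> generate (sym_group 7) ?Z" if "p \<in> generate (sym_group 7) ?Z" "q \<in> generate (sym_group 7) ?Z" for p q
        using generate.eng[OF that] by (simp only: sym_group_mult)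
      have inj: "act3 B i = act3 B j \<Longrightarrow> i = j" if "det B = 1" for B i j
        using permutes_inj[OF act3_permutes[OF that]] by (rule injD)
      \<comment> \<open>After division by a word the remaining factor still comes from a matrix of
        determinant 1, so the next stage can use linearity.\<close>
      have quot: "\<exists>C. det C = 1 \<and> act3 A = p \<circ> act3 C" if A: "det A = 1" and p: "p \<in> generate (sym_group 7) ?Z" for A p
      proof -
        obtain B where B: "det B = 1" "p = act3 B"
          using p K.generate_subgroup_incl[OF Z h.img_is_subgroup] by auto
        obtain B' where B': "det B' = 1" "B ** B' = mat 1"
          using G.r_inv[of B] G.inv_closed[of B] B(1) by auto
        have "act3 A = act3 (B ** (B' ** A))" by (simp add: matrix_mul_assoc B'(2))
        also have "\<dots> = act3 B \<circ> act3 (B' ** A)"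
          using A B(1) B'(1) by (intro act3_comp) (simp_all add: det_mul)
        finally show ?thesis using A B'(1) unfolding B(2) by (intro exI[of _ "B' ** A"]) (simp add: det_mul)
      qed
      have word: "tab l \<in> generate (sym_group 7) ?Z" if "l \<in> set (slp [la, lb] prog)" for l
        by (rule slp_generate[OF sorted that])
      have "\<exists>l\<in>set (slp [la, lb] prog). tab l 1 = act3 A 1"
        using check act3_in(1)[OF A(1), of 1] unfolding Let_def list_all_iff list_ex_iff by simp
      then obtain p1 where p1: "p1 \<in> generate (sym_group 7) ?Z" "p1 1 = act3 A 1" using word by blast
      obtain B where B: "det B = 1" "act3 A = p1 \<circ> act3 B" using quot[OF A(1) p1(1)] by blast
      have inj1: "inj p" if "p \<in> generate (sym_group 7) ?Z" for p
        using that K.generate_subgroup_incl[OF Z h.img_is_subgroup] permutes_inj[OF act3_permutes] by auto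
      have cancel: "act3 D i = i"
        if "p \<in> generate (sym_group 7) ?Z" "act3 C = p \<circ> act3 D" "p i = act3 C i" for p C D i
        using injD[OF inj1[OF that(1)], of "act3 D i" i] fun_cong[OF that(2), of i] that(3) by (simp only: comp_apply)
      have tab_act3: "tab (map (act3 B) [1..<Suc 7]) = act3 B" if "det B = 1" for B
        by (rule tab_map_upt, rule permutes_not_in[OF act3_permutes[OF that]])
      have B1: "act3 B 1 = 1" by (rule cancel[OF p1(1) B(2) p1(2)])
      then have "act3 B 2 \<noteq> 1" using inj[OF B(1), of 2 1] by auto
      then have "act3 B 2 \<in> set [2..<8]" using act3_in(1)[OF B(1), of 2] by auto
      then have "\<exists>l\<in>set (slp [la, lb] prog). tab l 1 = 1 \<and> tab l 2 = act3 B 2"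
        using check unfolding Let_def list_all_iff list_ex_iff by blast
      then obtain p2 where p2: "p2 \<in> generate (sym_group 7) ?Z" "p2 1 = 1" "p2 2 = act3 B 2" using word by blast
      obtain C where C: "det C = 1" "act3 B = p2 \<circ> act3 C" using quot[OF B(1) p2(1)] by blast
      have C1: "act3 C 1 = 1" "act3 C 2 = 2"
        by (rule cancel[OF p2(1) C(2)], simp only: p2 B1)+
      \<comment> \<open>Index 2 of the table belongs to the point 3. Being the sum of 1 and 2 it is
        fixed as well, which leaves only 4 to 7 as images of 4.\<close>
      have "map (act3 C) [1..<Suc 7] ! 2 = xor3 1 2" unfolding act3_table linear_table_def C1 by simp
      then have "act3 C 3 = 3" by (simp add: xor3_def del: upt_Suc)
      then have "act3 C 4 \<notin> {1, 2, 3}" using C1 inj[OF C(1), of 4 1] inj[OF C(1), of 4 2] inj[OF C(1), of 4 3] by auto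
      then have "act3 C 4 \<in> set [4..<8]" using act3_in(1)[OF C(1), of 4] by auto
      then have "\<exists>l\<in>set (slp [la, lb] prog). tab l 1 = 1 \<and> tab l 2 = 2 \<and> tab l 4 = act3 C 4"
        using check unfolding Let_def list_all_iff list_ex_iff by blast
      then obtain p3 where p3: "p3 \<in> generate (sym_group 7) ?Z" "p3 1 = 1" "p3 2 = 2" "p3 4 = act3 C 4"
        using word by blast
      obtain D where D: "det D = 1" "act3 C = p3 \<circ> act3 D" using quot[OF C(1) p3(1)] by blast
      have "act3 D 1 = 1" "act3 D 2 = 2" "act3 D 4 = 4"
        by (rule cancel[OF p3(1) D(2)], simp only: p3 C1)+
      then have "map (act3 D) [1..<Suc 7] = map (act3 (mat 1)) [1..<Suc 7]"
        unfolding act3_table by (simp only: act3_id id_apply)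
      from arg_cong[OF this, of tab] have "act3 D = id"
        by (simp only: tab_act3[OF D(1)] tab_act3[OF det_I, unfolded act3_id] act3_id)
      from D(2)[unfolded this comp_id] C(2) B(2) A(2) have "p = p1 \<circ> (p2 \<circ> p3)" by (simp only:)
      then show "p \<in> generate (sym_group 7) ?Z" using Wcomp[OF p1(1) Wcomp[OF p2(1) p3(1)]] by (simp only:)
    qed
  qed
  then have "act3 \<in> iso SL (subgroup_generated (sym_group 7) ?Z)"
    using Z' h.homh act3_inj
    by (auto simp: iso_def bij_betw_def inj_on_def hom_def carrier_subgroup_generated Int_absorb1)
  then have "(SL :: (bit^3^3) monoid) \<cong> subgroup_generated (sym_group 7) ?Z" by (rule is_isoI)
  from iso_trans[OF PSL_iso_SL[OF center_SL_3_bit] this]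
  have "(PSL :: (bit^3^3) set monoid) \<cong> subgroup_generated (sym_group 7) ?Z" .
  moreover have "{\<one>\<^bsub>SL\<^esub>} \<lhd> (SL :: (bit^3^3) monoid)" by (rule group.one_is_normal[OF group_SL])
  then have "group (PSL :: (bit^3^3) set monoid)"
    unfolding PSL_def center_SL_3_bit using normal.factorgroup_is_group by force
  ultimately show ?thesis by (simp add: group.iso_sym)
qed

declare One_nat_def [simp]

section \<open>The projective line\<close>

definition point :: "'k::field ^ 2 \<Rightarrow> 'k option" where
  "point v = (if v $ 2 = 0 then None else Some (v $ 1 / v $ 2))"

definition rep :: "'k::field option \<Rightarrow> 'k ^ 2" where
  "rep p = (case p of None \<Rightarrow> vector [1, 0] | Some x \<Rightarrow> vector [x, 1])"

definition moebius :: "'k::field ^ 2 ^ 2 \<Rightarrow> 'k option \<Rightarrow> 'k option" where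
  "moebius A p = point (A *v rep p)"

lemma rep_nonzero: "rep p \<noteq> 0"
  by (cases p) (simp_all add: rep_def vec_eq_iff forall_2 vector_2)

lemma point_rep: "point (rep p) = p"
  by (cases p) (simp_all add: rep_def point_def vector_2)

lemma point_scale: "c \<noteq> 0 \<Longrightarrow> point (c *s v) = point v"
  by (simp add: point_def)

lemma rep_point:
  assumes "v \<noteq> 0" obtains c where "c \<noteq> 0" "v = c *s rep (point v)"
proof (cases "v $ 2 = 0")
  case True
  then show ?thesis using assms that[of "v $ 1"] by (simp add: rep_def point_def vec_eq_iff forall_2 vector_2)
next
  case False
  then show ?thesis using that[of "v $ 2"] by (simp add: rep_def point_def vec_eq_iff forall_2 vector_2)
qed

text \<open>The representative of a point is unique only up to a scalar, which passes through
  \<open>A\<close> and is ignored by \<open>point\<close>; the determinant of \<open>B\<close>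
  ensures that no vector becomes zero.\<close>

lemma moebius_comp:
  assumes "det B = 1"
  shows "moebius (A ** B) p = moebius A (moebius B p)"
proof -
  obtain c where c: "c \<noteq> 0" "B *v rep p = c *s rep (point (B *v rep p))"
    using rep_point[OF SL_vector_nonzero[OF assms rep_nonzero]] by blast
  have "moebius (A ** B) p = point (A *v (B *v rep p))" by (simp add: moebius_def matrix_vector_mul_assoc)
  also have "\<dots> = point (c *s (A *v rep (point (B *v rep p))))" by (subst c(2)) (simp only: vector_scalar_commute)
  finally show ?thesis using c(1) by (simp add: point_scale moebius_def)
qed

lemma moebius_mat_1: "moebius (mat 1) p = p"
  by (simp add: moebius_def point_rep)

lemma moebius_Some: "moebius A (Some x) =
    (if A $ 2 $ 1 * x + A $ 2 $ 2 = 0 then None else Some ((A $ 1 $ 1 * x + A $ 1 $ 2) / (A $ 2 $ 1 * x + A $ 2 $ 2)))"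
  by (simp add: moebius_def rep_def point_def matrix_vector_mult_def sum_2 vector_2)

lemma moebius_None: "moebius A None = (if A $ 2 $ 1 = 0 then None else Some (A $ 1 $ 1 / A $ 2 $ 1))"
  by (simp add: moebius_def rep_def point_def matrix_vector_mult_def sum_2 vector_2)

text \<open>Fixing infinity and 0 makes the matrix diagonal, and fixing 1 makes its diagonal entries
  equal.\<close>

lemma moebius_fix_three:
  assumes "moebius A None = None" "moebius A (Some 0) = Some 0" "moebius A (Some 1) = Some 1"
  shows "A = mat (A $ 1 $ 1)"
proof -
  have 1: "A $ 2 $ 1 = 0" using assms(1) by (simp add: moebius_None split: if_splits)
  moreover have 2: "A $ 2 $ 2 \<noteq> 0" "A $ 1 $ 2 = 0" using assms(2) 1 by (simp_all add: moebius_Some split: if_splits)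
  moreover have "A $ 1 $ 1 = A $ 2 $ 2" using assms(3) 1 2 by (simp add: moebius_Some split: if_splits)
  ultimately show ?thesis by (simp add: vec_eq_iff forall_2 mat_def)
qed

definition mat2 :: "'k \<Rightarrow> 'k \<Rightarrow> 'k \<Rightarrow> 'k \<Rightarrow> 'k::field ^ 2 ^ 2" where
  "mat2 a b c d = vector [vector [a, b], vector [c, d]]"

lemma mat2_nth [simp]: "mat2 a b c d $ 1 $ 1 = a" "mat2 a b c d $ 1 $ 2 = b" "mat2 a b c d $ 2 $ 1 = c" "mat2 a b c d $ 2 $ 2 = d"
  by (simp_all add: mat2_def vector_2)

lemma mat2_mult: "mat2 a b c d ** mat2 a' b' c' d' = mat2 (a * a' + b * c') (a * b' + b * d') (c * a' + d * c') (c * b' + d * d')"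
  by (simp add: vec_eq_iff forall_2 matrix_matrix_mult_def sum_2)

lemma mat2_eta: "A = mat2 (A $ 1 $ 1) (A $ 1 $ 2) (A $ 2 $ 1) (A $ 2 $ 2)"
  by (simp add: vec_eq_iff forall_2)

lemma det_mat2: "det (mat2 a b c d) = a * d - b * c"
  by (simp add: det_2)

section \<open>The action of \<open>SL(2,8)\<close> and of the Frobenius map on nine points\<close>

lemma gf8_double: "(x :: gf8) + x = 0"
  by (cases x) (simp add: zero_gf8_def)

lemma gf8_minus: "(x :: gf8) - y = x + y"
  by (simp add: minus_gf8_def)

lemma gf8_square_add: "((x :: gf8) + y) * (x + y) = x * x + y * y"
proof -
  have "(x + y) * (x + y) = x * x + y * y + (x * y + x * y)" by (simp only: distrib_left distrib_right ac_simps)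
  then show ?thesis by (simp add: gf8_double)
qed

text \<open>Squaring is additive, so the square of x + 1 is 0.\<close>

lemma gf8_square_eq_1: "(x :: gf8) * x = 1 \<Longrightarrow> x = 1"
proof -
  assume "x * x = 1"
  then have "(x + 1) * (x + 1) = 0" by (simp add: gf8_square_add gf8_double)
  then have "x + 1 = 0" by simp
  then have "x + (1 + 1) = 1" by (simp only: add.assoc[symmetric]) simp
  then show "x = 1" by (simp add: gf8_double)
qed

lemma scalar_SL_2: "det (mat c :: gf8^2^2) = 1 \<Longrightarrow> mat c = (mat 1 :: gf8^2^2)"
  using gf8_square_eq_1[of c] by (simp add: det_2 mat_def)

lemma center_SL_2_gf8: "group_center (SL :: (gf8^2^2) monoid) = {mat 1}"
proof -
  have "Z = mat 1" if Z: "Z \<in> group_center SL" for Z :: "gf8^2^2"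
    using center_scalar[OF Z, of 1] scalar_SL_2[of "Z $ 1 $ 1"] Z by (simp add: group_center_def)
  then show ?thesis using one_in_center by auto
qed

definition bit_of :: "bool \<Rightarrow> bit" where "bit_of b = (if b then 1 else 0)"

text \<open>The label 9 is infinity; the binary digits of n - 1 are the coefficients of the other
  points.\<close>

definition dec9 :: "nat \<Rightarrow> gf8 option" where
  "dec9 n = (if n = 9 then None else Some (GF8 (bit_of (odd (n - 1))) (bit_of (odd ((n - 1) div 2))) (bit_of (odd ((n - 1) div 4)))))"

fun enc9 :: "gf8 option \<Rightarrow> nat" where
  "enc9 None = 9"
| "enc9 (Some (GF8 a b c)) = 1 + (if a = 1 then 1 else 0) + (if b = 1 then 2 else 0) + (if c = 1 then 4 else 0)"

lemma dec_enc9: "dec9 (enc9 p) = p"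
proof (cases p)
  case (Some x)
  have b: "y = 0 \<or> y = 1" for y :: bit by (cases y) auto
  obtain a b c where "x = GF8 a b c" by (cases x)
  then show ?thesis using Some b[of a] b[of b] b[of c] by (elim disjE) (simp_all add: dec9_def bit_of_def)
qed (simp add: dec9_def)

lemma enc9_in: "enc9 p \<in> {1..9}"
  by (cases p rule: enc9.cases) auto

lemma enc_dec9: "n \<in> {1..9} \<Longrightarrow> enc9 (dec9 n) = n"
proof -
  assume "n \<in> {1..9}"
  then have "n \<in> {1, 2, 3, 4, 5, 6, 7, 8, 9}"
    by (simp only: atLeastAtMost_iff insert_iff empty_iff) presburger
  then show ?thesis by (elim insertE emptyE) (simp_all add: dec9_def bit_of_def)
qed

definition on9 :: "(gf8 option \<Rightarrow> gf8 option) \<Rightarrow> nat \<Rightarrow> nat" where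
  "on9 g i = (if i \<in> {1..9} then enc9 (g (dec9 i)) else i)"

lemma on9_comp: "on9 g \<circ> on9 g' = on9 (g \<circ> g')"
proof
  fix i show "(on9 g \<circ> on9 g') i = on9 (g \<circ> g') i"
    by (cases "i \<in> {1..9}") (simp_all only: on9_def o_apply if_True if_False enc9_in dec_enc9)
qed

lemma on9_id: "on9 id = id"
proof
  fix i show "on9 id i = id i"
    by (cases "i \<in> {1..9}") (simp_all only: on9_def id_apply if_True if_False enc_dec9)
qed

lemma on9_eqD: "on9 g = on9 g' \<Longrightarrow> g = g'"
proof
  fix p assume "on9 g = on9 g'"
  from fun_cong[OF this, of "enc9 p"] have "enc9 (g p) = enc9 (g' p)"
    by (simp only: on9_def enc9_in if_True dec_enc9)
  then show "g p = g' p" by (metis dec_enc9)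
qed

lemma on9_permutes:
  assumes "g \<circ> g' = id" "g' \<circ> g = id"
  shows "on9 g permutes {1..9}"
proof (rule permutes_if_bij)
  show "bij (on9 g)" by (rule o_bij[of "on9 g'"]) (simp_all only: on9_comp assms on9_id)
  show "on9 g x = x" if "x \<notin> {1..9}" for x using that by (simp only: on9_def if_False)
qed

definition act9 :: "gf8^2^2 \<Rightarrow> nat \<Rightarrow> nat" where
  "act9 A = on9 (moebius A)"

lemma act9_comp: "det B = 1 \<Longrightarrow> act9 (A ** B) = act9 A \<circ> act9 B"
  unfolding act9_def on9_comp by (rule arg_cong[where f = on9]) (simp add: fun_eq_iff moebius_comp)

lemma act9_permutes:
  assumes A: "det A = 1" shows "act9 A permutes {1..9}"
proof -
  interpret G: group "SL :: (gf8^2^2) monoid" by (rule group_SL)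
  have A': "A \<in> carrier SL" using A by simp
  define B where "B = inv\<^bsub>SL\<^esub> A"
  have "B \<in> carrier SL" unfolding B_def by (rule G.inv_closed[OF A'])
  then have B: "det B = 1" "B ** A = mat 1" "A ** B = mat 1"
    using G.l_inv[OF A'] G.r_inv[OF A'] by (simp_all add: B_def)
  show ?thesis unfolding act9_def
    by (rule on9_permutes[of _ "moebius B"])
      (simp_all add: fun_eq_iff B moebius_mat_1 flip: moebius_comp[OF A] moebius_comp[OF B(1)])
qed

lemma act9_eq_id:
  fixes A :: "gf8^2^2"
  assumes "det A = 1" "moebius A None = None" "moebius A (Some 0) = Some 0" "moebius A (Some 1) = Some 1"
  shows "A = mat 1"
proof -
  note eq = moebius_fix_three[OF assms(2-4)]
  have "det (mat (A $ 1 $ 1) :: gf8^2^2) = 1" by (subst eq[symmetric]) (rule assms(1))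
  then have "mat (A $ 1 $ 1) = (mat 1 :: gf8^2^2)" by (rule scalar_SL_2)
  then show ?thesis by (rule trans[OF eq])
qed

section \<open>The Frobenius map and its action on Moebius transformations\<close>

definition frobenius :: "gf8 option \<Rightarrow> gf8 option" where
  "frobenius = map_option (\<lambda>x. x * x)"

lemma frobenius_cubed: "frobenius (frobenius (frobenius p)) = p"
proof (cases p)
  case (Some x)
  have b: "y = 0 \<or> y = 1" for y :: bit by (cases y) auto
  obtain a b c where "x = GF8 a b c" by (cases x)
  then show ?thesis using Some b[of a] b[of b] b[of c] by (elim disjE) (simp_all add: frobenius_def)
qed (simp add: frobenius_def)

definition square_entries :: "gf8^2^2 \<Rightarrow> gf8^2^2" where
  "square_entries A = (\<chi> i j. A $ i $ j * A $ i $ j)"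

lemma det_square_entries: "det (square_entries A) = det A * det A"
  by (simp add: det_2 square_entries_def gf8_minus gf8_square_add ac_simps)

text \<open>Squaring is a field automorphism, so it can be applied to the coordinates of a vector
  and to the entries of the matrix separately. Hence the Frobenius map normalises the image of
  SL.\<close>

lemma frobenius_moebius: "frobenius (moebius A p) = moebius (square_entries A) (frobenius p)"
proof -
  define \<sigma> :: "gf8^2 \<Rightarrow> gf8^2" where "\<sigma> v = (\<chi> i. v $ i * v $ i)" for v
  have "\<sigma> (A *v v) = square_entries A *v \<sigma> v" for v
    unfolding vec_eq_iff forall_2
    by (simp add: \<sigma>_def square_entries_def matrix_vector_mult_def sum_2 gf8_square_add ac_simps)
  moreover have "frobenius (point v) = point (\<sigma> v)" for v
    by (simp add: frobenius_def point_def \<sigma>_def)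
  moreover have "\<sigma> (rep p) = rep (frobenius p)"
    unfolding vec_eq_iff forall_2 by (cases p) (simp_all add: \<sigma>_def rep_def frobenius_def vector_2)
  ultimately show ?thesis by (simp add: moebius_def)
qed

text \<open>The vector-free form in which the tables are computed.\<close>

fun moebius_code :: "gf8 \<times> gf8 \<times> gf8 \<times> gf8 \<Rightarrow> gf8 option \<Rightarrow> gf8 option" where
  "moebius_code (a, b, c, d) (Some x) = (if c * x + d = 0 then None else Some ((a * x + b) / (c * x + d)))"
| "moebius_code (a, b, c, d) None = (if c = 0 then None else Some (a / c))"

lemma moebius_code: "moebius (mat2 a b c d) = moebius_code (a, b, c, d)"
proof
  fix p show "moebius (mat2 a b c d) p = moebius_code (a, b, c, d) p"
    by (cases p) (simp_all add: moebius_Some moebius_None)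
qed

lemma act9_table:
  assumes "l = map (on9 (moebius_code (a, b, c, d))) [1..<Suc 9]" "det (mat2 a b c d) = 1"
  shows "tab l = act9 (mat2 a b c d)"
  unfolding assms(1) moebius_code[symmetric] act9_def[symmetric]
  by (rule tab_map_upt, rule permutes_not_in[OF act9_permutes[OF assms(2)]])

text \<open>The three upper unitriangular matrices correspond to a basis of the field over its prime
  field, so their products give all of them. In characteristic 2 the exchange of coordinates has
  determinant 1; conjugation by it gives the lower unitriangular matrices, and every matrix with
  nonzero lower left entry is a product upper, lower, upper.\<close>

lemma SL_2_generated:
  fixes P :: "gf8^2^2 \<Rightarrow> bool"
  assumes A: "det A = 1"
    and mult: "\<And>A B. P A \<Longrightarrow> P B \<Longrightarrow> P (A ** B)"
    and U: "P (mat2 1 (GF8 1 0 0) 0 1)" "P (mat2 1 (GF8 0 1 0) 0 1)" "P (mat2 1 (GF8 0 0 1) 0 1)"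
    and w: "P (mat2 0 1 1 0)"
  shows "P A"
proof -
  have U_add: "mat2 1 (x + y) 0 1 = mat2 1 x 0 1 ** mat2 1 y 0 (1::gf8)" for x y
    by (simp add: mat2_mult add.commute)
  have U2: "P (mat2 1 (x + y) 0 1)" if "P (mat2 1 x 0 1)" "P (mat2 1 y 0 1)" for x y
    unfolding U_add by (rule mult[OF that])
  have U0: "P (mat2 1 0 0 1)" using U2[OF U(1) U(1)] by (simp add: gf8_double)
  have PU: "P (mat2 1 x 0 1)" for x
  proof -
    have b: "y = 0 \<or> y = 1" for y :: bit by (cases y) auto
    obtain a b c where x: "x = GF8 a b c" by (cases x)
    have "x = (GF8 a 0 0 + GF8 0 b 0) + GF8 0 0 c" by (simp add: x)
    moreover have "P (mat2 1 (GF8 a 0 0) 0 1)" "P (mat2 1 (GF8 0 b 0) 0 1)" "P (mat2 1 (GF8 0 0 c) 0 1)"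
      using b[of a] b[of b] b[of c] U U0 by (auto simp: zero_gf8_def)
    ultimately show ?thesis using U2 by metis
  qed
  have L: "P (mat2 1 0 x 1)" for x
  proof -
    have "mat2 1 0 x 1 = mat2 0 1 1 0 ** mat2 1 x 0 1 ** mat2 0 1 1 (0::gf8)" by (simp add: mat2_mult)
    then show ?thesis using mult w PU by simp
  qed
  have big: "P (mat2 a b c d)" if "c \<noteq> 0" "a * d - b * c = 1" for a b c d
  proof -
    \<comment> \<open>The diagonal of the triple product is 1 + x c and 1 + y c; this fixes
      \<open>x\<close> and \<open>y\<close>, and the determinant then determines the upper right
      entry.\<close>
    define x y where "x = (a - 1) / c" and "y = (d - 1) / c"
    have xc: "x * c = a - 1" and yc: "y * c = d - 1" using that(1) by (simp_all add: x_def y_def)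
    have "(a * y + x) * c = a * (y * c) + x * c" by (simp only: distrib_right mult.assoc)
    also have "\<dots> = b * c" using that(2) unfolding xc yc by (simp add: algebra_simps)
    finally have b: "a * y + x = b" using that(1) by simp
    have "mat2 1 x 0 1 ** mat2 1 0 c 1 ** mat2 1 y 0 1 = mat2 (1 + x * c) ((1 + x * c) * y + x) c (y * c + 1)"
      by (simp add: mat2_mult mult.commute)
    also have "\<dots> = mat2 a b c d" unfolding xc yc using b by simp
    finally have "mat2 a b c d = mat2 1 x 0 1 ** mat2 1 0 c 1 ** mat2 1 y 0 1" ..
    then show ?thesis using mult L PU by simp
  qed
  define a b c d where "a = A $ 1 $ 1" and "b = A $ 1 $ 2" and "c = A $ 2 $ 1" and "d = A $ 2 $ 2"
  have A2: "A = mat2 a b c d" unfolding a_def b_def c_def d_def by (rule mat2_eta)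
  have det: "a * d - b * c = 1" using A unfolding A2 det_mat2 .
  show ?thesis
  proof (cases "c = 0")
    case False
    then show ?thesis unfolding A2 using big det by blast
  next
    case True
    \<comment> \<open>Exchanging the rows brings \<open>a\<close> to the lower left corner, which
      reduces to the generic case.\<close>
    then have "a \<noteq> 0" using det by auto
    have "mat2 0 1 1 0 ** A = mat2 c d a b" unfolding A2 by (simp add: mat2_mult)
    moreover have "c * b - d * a = 1" using det True by (simp add: gf8_minus ac_simps)
    then have "P (mat2 c d a b)" using big \<open>a \<noteq> 0\<close> by blast
    ultimately have "P (mat2 0 1 1 0 ** (mat2 0 1 1 0 ** A))" using mult w by simp
    moreover have "mat2 0 1 1 0 ** (mat2 0 1 1 0 ** A) = A" unfolding A2 by (simp add: mat2_mult)
    ultimately show ?thesis by simp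
  qed
qed

lemma carrier_Z3: "carrier (integer_mod_group 3) = {0, 1, 2}"
proof -
  have "0 \<le> x \<and> x < 3 \<longleftrightarrow> x = 0 \<or> x = 1 \<or> x = 2" for x :: int by presburger
  then show ?thesis by (simp add: carrier_integer_mod_group set_eq_iff)
qed

text \<open>The table \<open>la\<close> is a Moebius transformation after the Frobenius map and \<open>lb\<close> is \<open>x \<mapsto> x + 1\<close>.\<close>

lemma PGammaL_2_8_tables:
  assumes la: "la = map (on9 (moebius_code (a, b, c, d) \<circ> frobenius)) [1..<Suc 9]" "det (mat2 a b c d) = 1"
    and lb: "lb = map (on9 (moebius_code (1, GF8 1 0 0, 0, 1))) [1..<Suc 9]"
    and sorted: "sort la = [1..<Suc 9]" "sort lb = [1..<Suc 9]"
    and slp: "list_all (\<lambda>abcd. map (on9 (moebius_code abcd)) [1..<Suc 9] \<in> set (slp [la, lb] prog))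
      [(1, GF8 0 1 0, 0, 1), (1, GF8 0 0 1, 0, 1), (0, 1, 1, 0)]"
  shows "is_some_semidirect_product (subgroup_generated (sym_group 9) {tab la, tab lb})
    (PSL :: (gf8^2^2) set monoid) (integer_mod_group 3)"
proof -
  let ?K = "sym_group 9" and ?Z = "{tab la, tab lb}" and ?SL = "SL :: (gf8^2^2) monoid" and ?PSL = "PSL :: (gf8^2^2) set monoid"
  let ?W = "generate ?K ?Z"
  interpret K: group ?K by (rule sym_group_is_group)
  interpret G: group ?SL by (rule group_SL)
  have inv_frob: "frobenius \<circ> (frobenius \<circ> frobenius) = id" "(frobenius \<circ> frobenius) \<circ> frobenius = id"
    by (simp_all add: fun_eq_iff frobenius_cubed)
  define \<phi> where "\<phi> = on9 frobenius"
  have \<phi>p: "\<phi> permutes {1..9}" unfolding \<phi>_def by (rule on9_permutes[OF inv_frob])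
  have \<phi>3: "\<phi> \<circ> (\<phi> \<circ> \<phi>) = id" unfolding \<phi>_def on9_comp inv_frob on9_id ..
  have Zperm: "tab la permutes {1..9}" "tab lb permutes {1..9}"
    using tab_permutes[OF sorted(1)] tab_permutes[OF sorted(2)] .
  have ZK: "?Z \<subseteq> carrier ?K" using Zperm by (simp only: sym_group_carrier insert_subset empty_subsetI)
  have Wsub: "subgroup ?W ?K" by (rule K.generate_is_subgroup[OF ZK])
  have Wcomp: "p \<circ> q \<in> ?W" if "p \<in> ?W" "q \<in> ?W" for p q
    using subgroup.m_closed[OF Wsub that] by (simp only: sym_group_mult)
  let ?A = "mat2 a b c d"
  have tla: "tab la = act9 ?A \<circ> \<phi>"
  proof -
    have eq: "on9 (moebius_code (a, b, c, d) \<circ> frobenius) = act9 ?A \<circ> \<phi>"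
      by (simp only: act9_def \<phi>_def on9_comp moebius_code)
    have "tab (map (act9 ?A \<circ> \<phi>) [1..<Suc 9]) = act9 ?A \<circ> \<phi>"
      by (rule tab_map_upt, rule permutes_not_in[OF permutes_compose[OF \<phi>p act9_permutes[OF la(2)]]])
    then show ?thesis unfolding la(1) eq .
  qed
  let ?U = "mat2 1 (GF8 1 0 0) 0 1"
  have tlb: "tab lb = act9 ?U" by (rule act9_table[OF lb]) (simp add: det_mat2)
  have slpW: "act9 (mat2 a' b' c' d') \<in> ?W"
    if "(a', b', c', d') \<in> set [(1, GF8 0 1 0, 0, 1), (1, GF8 0 0 1, 0, 1), (0, 1, 1, 0)]" "det (mat2 a' b' c' d') = 1" for a' b' c' d'
  proof -
    have "map (on9 (moebius_code (a', b', c', d'))) [1..<Suc 9] \<in> set (slp [la, lb] prog)"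
      using slp that(1) unfolding list_all_iff by blast
    from slp_generate[OF sorted this] show ?thesis by (simp only: act9_table[OF refl that(2)])
  qed
  have SLW: "act9 A \<in> ?W" if A: "det A = 1" for A
  proof -
    have "det A = 1 \<and> act9 A \<in> ?W"
    proof (rule SL_2_generated[OF A])
      show "det (A ** B) = 1 \<and> act9 (A ** B) \<in> ?W" if "det A = 1 \<and> act9 A \<in> ?W" "det B = 1 \<and> act9 B \<in> ?W" for A B
        using that Wcomp by (simp add: det_mul act9_comp)
      have "tab lb \<in> ?W" by (rule generate.incl) simp
      then show "det ?U = 1 \<and> act9 ?U \<in> ?W" by (simp add: det_mat2 tlb)
    qed (use slpW in \<open>auto simp: det_mat2 gf8_minus\<close>)
    then show ?thesis ..
  qed
  \<comment> \<open>The Frobenius map is what remains of \<open>la\<close> after cancelling its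
    Moebius factor, which lies in the group by \<open>SLW\<close>.\<close>
  have \<phi>W: "\<phi> \<in> ?W"
  proof -
    obtain B where B: "det B = 1" "B ** ?A = mat 1"
      using G.l_inv[of ?A] G.inv_closed[of ?A] la(2) by auto
    have "act9 B \<circ> tab la \<in> ?W" by (rule Wcomp[OF SLW[OF B(1)] generate.incl]) simp
    moreover have "act9 B \<circ> tab la = (act9 B \<circ> act9 ?A) \<circ> \<phi>" by (simp only: tla comp_assoc)
    moreover have "act9 (mat 1) = id" by (simp add: act9_def moebius_mat_1[abs_def] on9_id flip: id_def)
    ultimately show ?thesis using B by (simp flip: act9_comp[OF la(2)])
  qed
  define h where "h k = (if k = 0 then id else if k = 1 then \<phi> else \<phi> \<circ> \<phi>)" for k :: int
  have hp: "h k permutes {1..9}" for k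
    unfolding h_def using \<phi>p by (auto intro: permutes_id permutes_compose simp del: One_nat_def)
  have hK: "h k \<in> carrier ?K" for k by (simp only: sym_group_carrier hp)
  have \<phi>\<phi>\<phi>: "\<phi> (\<phi> (\<phi> i)) = i" for i using fun_cong[OF \<phi>3, of i] by simp
  have \<phi>A: "\<phi> \<circ> act9 A = act9 (square_entries A) \<circ> \<phi>" for A
    unfolding \<phi>_def act9_def on9_comp by (rule arg_cong[where f = on9]) (simp add: fun_eq_iff frobenius_moebius)
  have hA: "\<exists>A'. det A' = 1 \<and> h k \<circ> act9 A = act9 A' \<circ> h k" if A: "det A = 1" for k A
  proof -
    have d: "det (square_entries A) = 1" "det (square_entries (square_entries A)) = 1"
      by (simp_all add: det_square_entries A)
    have "\<phi> \<circ> \<phi> \<circ> act9 A = act9 (square_entries (square_entries A)) \<circ> (\<phi> \<circ> \<phi>)"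
      by (metis \<phi>A comp_assoc)
    then show ?thesis using d A \<phi>A unfolding h_def by auto
  qed
  have PSL_iso: "?PSL \<cong> ?SL" by (rule PSL_iso_SL[OF center_SL_2_gf8])
  have "{\<one>\<^bsub>SL\<^esub>} \<lhd> ?SL" by (rule group.one_is_normal[OF group_SL])
  then have PSL: "group ?PSL"
    unfolding PSL_def center_SL_2_gf8 using normal.factorgroup_is_group by force
  obtain \<iota> where \<iota>: "\<iota> \<in> iso ?PSL ?SL" using PSL_iso by (auto simp: is_iso_def)
  then have \<iota>hom: "\<iota> \<in> hom ?PSL ?SL" and \<iota>bij: "bij_betw \<iota> (carrier ?PSL) (carrier ?SL)" by (simp_all add: iso_def)
  have \<iota>det: "det (\<iota> x) = 1" if "x \<in> carrier ?PSL" for x using hom_in_carrier[OF \<iota>hom that] by simp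
  have surj: "\<exists>x\<in>carrier ?PSL. \<iota> x = A" if "det A = 1" for A
  proof -
    have "A \<in> carrier ?SL" using that by simp
    then have "A \<in> \<iota> ` carrier ?PSL" using bij_betw_imp_surj_on[OF \<iota>bij] by simp
    then show ?thesis by blast
  qed
  define f where "f x = act9 (\<iota> x)" for x
  \<comment> \<open>The quotient of two matrices with the same action fixes infinity, 0 and
    1.\<close>
  have act_inj: "A = B" if AB: "det A = 1" "det B = 1" "act9 A = act9 B" for A B
  proof -
    obtain C where C: "det C = 1" "C ** B = mat 1" "B ** C = mat 1"
      using G.l_inv[of B] G.r_inv[of B] G.inv_closed[of B] AB(2) by auto
    have "moebius A = moebius B" using AB(3) unfolding act9_def by (rule on9_eqD)
    then have "moebius (C ** A) p = p" for p
      unfolding moebius_comp[OF AB(1)] by (simp add: C moebius_mat_1 flip: moebius_comp[OF AB(2)])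
    then have "C ** A = mat 1" using C(1) AB(1) by (intro act9_eq_id) (simp_all add: det_mul)
    then have "B ** (C ** A) = B" by simp
    then show ?thesis by (simp add: matrix_mul_assoc C)
  qed
  show ?thesis
  proof (rule generated_semidirect_product[OF K.is_group PSL group_integer_mod_group, of f h])
    show "f \<in> hom ?PSL ?K"
    proof (rule homI)
      show "f x \<in> carrier ?K" if "x \<in> carrier ?PSL" for x
        using act9_permutes[OF \<iota>det[OF that]] by (simp only: f_def sym_group_carrier)
      show "f (x \<otimes>\<^bsub>?PSL\<^esub> y) = f x \<otimes>\<^bsub>?K\<^esub> f y" if "x \<in> carrier ?PSL" "y \<in> carrier ?PSL" for x y
        using hom_mult[OF \<iota>hom that] act9_comp[OF \<iota>det[OF that(2)]] by (simp add: f_def sym_group_mult)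
    qed
    show "inj_on f (carrier ?PSL)"
    proof (rule inj_onI)
      fix x y assume xy: "x \<in> carrier ?PSL" "y \<in> carrier ?PSL" "f x = f y"
      then have "\<iota> x = \<iota> y" using act_inj \<iota>det unfolding f_def by blast
      then show "x = y" using \<iota>bij xy unfolding bij_betw_def by (blast dest: inj_onD)
    qed
    show "h \<in> hom (integer_mod_group 3) ?K"
    proof (rule homI)
      show "h x \<in> carrier ?K" for x by (rule hK)
      show "h (x \<otimes>\<^bsub>integer_mod_group 3\<^esub> y) = h x \<otimes>\<^bsub>?K\<^esub> h y"
        if "x \<in> carrier (integer_mod_group 3)" "y \<in> carrier (integer_mod_group 3)" for x y
        using that unfolding carrier_Z3 sym_group_mult
        by (elim insertE emptyE) (simp_all add: h_def fun_eq_iff \<phi>\<phi>\<phi>)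
    qed
    \<comment> \<open>The labels 3, 5 and 7 belong to x, its square and its fourth power, so the
      point 3 tells the three powers of the Frobenius map apart.\<close>
    have \<phi>3': "\<phi> 3 = 5" "\<phi> 5 = 7"
      by (simp_all add: \<phi>_def on9_def dec9_def bit_of_def frobenius_def)
    have \<phi>fix: "frobenius None = None" "frobenius (Some 0) = Some 0" "frobenius (Some 1) = Some 1"
      by (simp_all add: frobenius_def)
    have h_id: "k = 0" if "k \<in> carrier (integer_mod_group 3)" "h k = id" for k
    proof (rule ccontr)
      assume "k \<noteq> 0"
      then have "h k 3 \<noteq> 3" using \<phi>3' by (simp add: h_def)
      then show False using that(2) by simp
    qed
    show "inj_on h (carrier (integer_mod_group 3))"
    proof (rule inj_onI)
      fix x y assume xy: "x \<in> carrier (integer_mod_group 3)" "y \<in> carrier (integer_mod_group 3)" "h x = h y"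
      have "h 0 3 = 3" "h 1 3 = 5" "h 2 3 = 7" using \<phi>3' by (simp_all add: h_def)
      then show "x = y" using xy fun_cong[OF xy(3), of 3] unfolding carrier_Z3 by auto
    qed
    fix k x assume k: "k \<in> carrier (integer_mod_group 3)" and x: "x \<in> carrier ?PSL"
    show "h k \<otimes>\<^bsub>?K\<^esub> f x \<otimes>\<^bsub>?K\<^esub> inv\<^bsub>?K\<^esub> h k \<in> f ` carrier ?PSL"
    proof -
      obtain A' where A': "det A' = 1" "h k \<circ> f x = act9 A' \<circ> h k"
        using hA[OF \<iota>det[OF x]] unfolding f_def by blast
      obtain y where y: "y \<in> carrier ?PSL" "\<iota> y = A'" using surj[OF A'(1)] by blast
      have "h k \<circ> f x \<circ> inv' (h k) = act9 A' \<circ> (h k \<circ> inv' (h k))" unfolding A'(2) by (simp only: comp_assoc)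
      then have "h k \<otimes>\<^bsub>?K\<^esub> f x \<otimes>\<^bsub>?K\<^esub> inv\<^bsub>?K\<^esub> h k = f y"
        by (simp only: sym_group_mult sym_group_inv_equality[OF hK] permutes_inv_o(1)[OF hp] comp_id f_def y(2))
      then show ?thesis using y(1) by (rule image_eqI)
    qed
    show "k = \<one>\<^bsub>integer_mod_group 3\<^esub>" if eq: "f x = h k"
    proof -
      \<comment> \<open>Powers of the Frobenius map fix infinity, 0 and 1, while the identity is the
        only matrix in SL that does.\<close>
      define g where "g = (if k = 0 then id else if k = 1 then frobenius else frobenius \<circ> frobenius)"
      have "h k = on9 g" by (simp add: h_def g_def \<phi>_def on9_comp on9_id)
      then have "moebius (\<iota> x) = g" using eq unfolding f_def act9_def by (intro on9_eqD) simp
      moreover have "g None = None" "g (Some 0) = Some 0" "g (Some 1) = Some 1" by (simp_all add: g_def \<phi>fix)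
      ultimately have "\<iota> x = mat 1" by (intro act9_eq_id[OF \<iota>det[OF x]]) simp_all
      then have "f x = id" by (simp add: f_def act9_def moebius_mat_1[abs_def] on9_id flip: id_def)
      then show ?thesis using h_id[OF k] eq by simp
    qed
  next
    have mem: "act9 A \<circ> h k \<in> (\<lambda>(n, x). f n \<otimes>\<^bsub>?K\<^esub> h x) ` (carrier ?PSL \<times> carrier (integer_mod_group 3))"
      if A: "det A = 1" and k: "k \<in> {0, 1, 2}" for A k
    proof -
      obtain y where y: "y \<in> carrier ?PSL" "\<iota> y = A" using surj[OF A] by blast
      then show ?thesis using k by (intro image_eqI[of _ _ "(y, k)"]) (simp_all add: f_def sym_group_mult carrier_Z3)
    qed
    show "?Z \<subseteq> (\<lambda>(n, x). f n \<otimes>\<^bsub>?K\<^esub> h x) ` (carrier ?PSL \<times> carrier (integer_mod_group 3))"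
      using mem[OF la(2), of 1] mem[of ?U 0] by (simp add: tla tlb h_def det_mat2)
    show "f ` carrier ?PSL \<subseteq> ?W" using SLW \<iota>det by (auto simp: f_def)
    have "id \<in> ?W" using generate.one[of ?K ?Z] by (simp add: sym_group_one)
    then show "h ` carrier (integer_mod_group 3) \<subseteq> ?W" using \<phi>W Wcomp by (auto simp: h_def)
  qed
qed

section \<open>The monodromy groups\<close>

definition program1 :: "(nat \<times> nat) list" where
  "program1 = [(1, 0), (0, 0), (0, 1), (1, 1), (0, 2), (1, 3), (1, 4), (1, 6), (0, 7), (0, 8), (0, 9), (1, 10), (1,
     11), (0, 11), (1, 12), (0, 13), (0, 14), (1, 15), (0, 16), (0, 17), (1, 18), (0, 19), (0, 20), (1, 21),
     (0, 22), (0, 23), (1, 24), (0, 25), (0, 26), (0, 28), (1, 30), (1, 31), (0, 32), (0, 33), (1, 34), (1,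
     35), (0, 36)]"

lemma linear1:
  "black_rot1 = linear_table 1 4 6" "white_rot1 = linear_table 2 1 4"
  "sort black_rot1 = [1..<Suc 7]" "sort white_rot1 = [1..<Suc 7]"
  "let L = slp [black_rot1, white_rot1] program1 in
      list_all (\<lambda>i. list_ex (\<lambda>l. tab l 1 = i) L) [1..<8] \<and>
      list_all (\<lambda>i. list_ex (\<lambda>l. tab l 1 = 1 \<and> tab l 2 = i) L) [2..<8] \<and>
      list_all (\<lambda>i. list_ex (\<lambda>l. tab l 1 = 1 \<and> tab l 2 = 2 \<and> tab l 4 = i) L) [4..<8]"
  by code_simp+

definition program3 :: "(nat \<times> nat) list" where
  "program3 = [(0, 0), (1, 2), (0, 3), (0, 4), (1, 5), (0, 6), (1, 7), (0, 8), (0, 9), (1, 10), (0, 11), (1, 12), (0, 13),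
     (1, 14), (1, 4), (0, 16), (1, 17), (0, 18), (0, 19), (1, 20), (0, 21), (0, 22), (1, 23), (0, 24), (0, 1), (1,
     26), (0, 27), (0, 28), (1, 29), (0, 30), (1, 31), (0, 32), (0, 33), (1, 34), (0, 35), (1, 36), (0, 37), (0,
     38), (1, 39)]"

lemma moebius3:
  "black_rot3 = map (on9 (moebius_code (0, GF8 1 1 0, GF8 0 1 1, GF8 0 1 0) \<circ> frobenius)) [1..<Suc 9]"
  "white_rot3 = map (on9 (moebius_code (1, GF8 1 0 0, 0, 1))) [1..<Suc 9]"
  "sort black_rot3 = [1..<Suc 9]" "sort white_rot3 = [1..<Suc 9]"
  "list_all (\<lambda>abcd. map (on9 (moebius_code abcd)) [1..<Suc 9] \<in> set (slp [black_rot3, white_rot3] program3))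
     [(1, GF8 0 1 0, 0, 1), (1, GF8 0 0 1, 0, 1), (0, 1, 1, 0)]"
  by code_simp+

lemma mirrors:
  "comp_tab black_rot1' black_rot1 = [1..<Suc 7]" "comp_tab black_rot3' black_rot3 = [1..<Suc 9]"
  by code_simp+

text \<open>The two tables after the rotations are their square roots; the triples are the
  three-cycles reached by the program.\<close>

lemma alternating2:
  "alternating_table 7 black_rot2 white_rot2 [4, 3, 1, 2, 7, 5, 6] [5, 2, 4, 1, 3, 6, 7]
     [(0, 0), (2, 2), (0, 3), (1, 3), (5, 1), (0, 6), (7, 4), (1, 8), (9, 1), (0, 10), (11, 4)]
     [(1, 7, 4), (5, 6, 7), (4, 6, 7), (3, 7, 5), (2, 5, 3)]"
  by code_simp

lemma alternating2':
  "alternating_table 7 black_rot2' white_rot2' [7, 6, 5, 3, 4, 1, 2] [6, 2, 5, 4, 1, 3, 7]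
     [(0, 0), (2, 2), (0, 3), (1, 3), (5, 1), (0, 6), (7, 4)]
     [(1, 4, 6), (3, 4, 5), (2, 5, 7)]"
  by code_simp

text \<open>On the first block the black rotation is a transposition and on the second a
  transposition times a disjoint three-cycle: both are odd.\<close>

lemma blocks4:
  "block_table 5 black_rot4 white_rot4 [2, 1, 3, 4, 5] [1, 2, 3, 4, 5] True
     [3, 4, 1, 5, 2] [4, 1, 5, 3, 2] True
     [(0, 0), (2, 2), (1, 3), (4, 1), (0, 3), (1, 0), (7, 1), (1, 6), (9, 1), (0, 5), (11, 6), (8, 12), (13, 10)]
     [(1, 4, 5), (2, 4, 5), (2, 3, 5)]"
  by code_simp

text \<open>Here the blocks carry a three-cycle and two transpositions, both even; this is what
  distinguishes the tree from the previous one.\<close>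

lemma blocks4':
  "block_table 5 black_rot4' white_rot4 [2, 3, 1, 4, 5] [3, 1, 2, 4, 5] False
     [4, 2, 5, 1, 3] [5, 2, 1, 3, 4] False
     [(0, 0), (2, 2), (0, 3), (1, 0), (5, 1), (1, 4), (7, 1), (6, 3), (9, 8)]
     [(1, 2, 3), (2, 5, 4)]"
  by code_simp

text \<open>One block contains one vertex of degree 4 and the other block two, so the parities are
  odd and even.\<close>

lemma blocks5':
  "block_table 10 black_rot5' white_rot5' [2, 3, 4, 1, 5, 6, 7, 8, 9, 10] [1, 4, 2, 3, 5, 6, 7, 8, 9, 10] True
     [5, 2, 3, 8, 6, 7, 1, 9, 10, 4] [8, 2, 3, 1, 9, 10, 4, 5, 6, 7] False
     [(0, 1), (2, 2), (0, 0), (0, 4), (5, 1), (3, 6), (7, 2), (8, 6), (9, 2), (10, 2), (11, 2), (12, 12), (13, 13), (12, 14), (1, 15), (16, 1), (1, 0), (18, 1), (1, 5), (20, 1), (19, 17), (22, 21), (19, 23), (24, 21), (21, 17), (26, 19), (5, 17), (28, 0)]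
     [(1, 3, 4), (3, 8, 5), (3, 9, 6), (3, 10, 7), (2, 3, 4)]"
  by code_simp

text \<open>Products of five-cycles are even however the three vertices of degree 5 are distributed
  over the blocks.\<close>

lemma blocks6:
  "block_table 13 black_rot6 white_rot6 [2, 3, 4, 5, 1, 6, 7, 8, 9, 10, 11, 12, 13] [4, 5, 1, 2, 3, 6, 7, 8, 9, 10, 11, 12, 13] False
     [6, 2, 3, 4, 10, 7, 8, 9, 1, 11, 12, 13, 5] [8, 2, 3, 4, 12, 9, 1, 6, 7, 13, 5, 10, 11] False
     [(0, 0), (0, 2), (3, 1), (2, 1), (4, 5), (2, 2), (7, 1), (6, 8), (9, 4), (10, 10), (11, 11), (1, 0), (13, 1), (1, 7), (15, 1), (16, 12), (17, 14), (14, 12), (19, 16), (14, 20), (21, 16), (16, 18), (23, 14), (0, 12), (25, 7), (0, 26), (27, 7)]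
     [(1, 5, 2), (2, 7, 11), (2, 6, 10), (2, 8, 12), (2, 9, 13), (3, 7, 11), (4, 7, 11)]"
  by code_simp

lemma blocks6':
  "block_table 13 black_rot6' white_rot6 [2, 3, 4, 5, 1, 6, 7, 8, 9, 10, 11, 12, 13] [4, 5, 1, 2, 3, 6, 7, 8, 9, 10, 11, 12, 13] False
     [6, 2, 3, 10, 5, 7, 8, 9, 1, 11, 12, 13, 4] [8, 2, 3, 12, 5, 9, 1, 6, 7, 13, 4, 10, 11] False
     [(0, 0), (0, 2), (3, 1), (0, 1), (4, 5), (6, 5), (2, 2), (8, 1), (7, 9), (10, 10), (11, 11), (1, 0), (13, 1), (1, 8), (15, 1), (0, 12), (17, 8), (14, 12), (19, 16), (14, 20), (21, 16), (16, 12), (23, 14), (16, 24), (25, 14)]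
     [(1, 4, 2), (2, 5, 3), (2, 6, 10), (2, 7, 11), (2, 9, 13), (2, 8, 12)]"
  by code_simp

text \<open>The four-cycle 1, 2, 11, 12 at the centre of the tree becomes the transposition of the
  pairs 1 and 2 together with a flip of the pair 1; the other block carries a four-cycle of
  pairs.\<close>

lemma pairs5:
  "pair_table black_rot5 white_rot5 [1] [2, 1, 3, 4, 5] [1, 2, 3, 4, 5] [3, 2, 4, 5, 1] [5, 4, 2, 1, 3]
     [(0, 1), (0, 0), (3, 1), (2, 4), (0, 3), (6, 1), (5, 7), (8, 4), (9, 9), (9, 10), (7, 4), (12, 12), (13, 13),
     (1, 0), (15, 1), (1, 6), (17, 1), (0, 11), (19, 6), (1, 11), (21, 1), (6, 11), (23, 0), (16, 11), (25, 18),
     (0, 20), (27, 6), (0, 22), (29, 6), (18, 22), (31, 16), (16, 24), (33, 18), (0, 26), (35, 6), (1, 28), (37,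
     1), (16, 30), (39, 18), (0, 32), (41, 6), (16, 36), (43, 18), (0, 40), (45, 6), (0, 44), (47, 6), (16, 46),
     (49, 18), (16, 14), (51, 18), (50, 34), (53, 20), (54, 52)]
     [(1, 4, 2), (2, 3, 5)]"
  by code_simp

text \<open>The trees in a class have monodromy groups that are only isomorphic to the tabulated
  one, so \<open>P\<close> and \<open>P'\<close> are required for every isomorphic group.\<close>

lemma two_trees:
  assumes S: "tree_table K \<alpha> \<beta> be we lb lw" and S': "tree_table K \<alpha> \<beta> be' we' lb' lw'"
    and sep: "separates w lb lw lb' lw'" and cov: "covers \<alpha> \<beta> [(lb, lw), (lb', lw')]"
    and len: "length lb = n" "length lb' = n" and mset: "mset \<alpha> = A" "mset \<beta> = B"
    and P: "\<And>G :: (nat \<Rightarrow> nat) monoid. subgroup_generated (sym_group n) {tab lb, tab lw} \<cong> G \<Longrightarrow> P G"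
    and P': "\<And>G :: (nat \<Rightarrow> nat) monoid. subgroup_generated (sym_group n) {tab lb', tab lw'} \<cong> G \<Longrightarrow> P' G"
  shows "\<exists>C1 C2. trees A B n = {C1, C2} \<and> C1 \<noteq> C2 \<and>
    (\<forall>T\<in>C1. P (monodromy_group T)) \<and> (\<forall>T\<in>C2. P' (monodromy_group T))"
proof -
  have "length lb' = length lb" by (simp add: len)
  note trees = trees_of_tables[OF S S' this cov sep]
  let ?C = "isomorphism_relation `` {mk_tree be we lb lw}" and ?C' = "isomorphism_relation `` {mk_tree be' we' lb' lw'}"
  have G: "monodromy_group (mk_tree be we lb lw) = subgroup_generated (sym_group n) {tab lb, tab lw}"
    "monodromy_group (mk_tree be' we' lb' lw') = subgroup_generated (sym_group n) {tab lb', tab lw'}"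
    by (simp_all add: monodromy_group_def mk_tree_def len)
  have "P (monodromy_group T)" if T: "T \<in> ?C" for T
    using trees(3)[OF T] rot_iso_monodromy[OF tree_table_plane_tree[OF S]] P unfolding G(1)[symmetric] by blast
  moreover have "P' (monodromy_group T)" if T: "T \<in> ?C'" for T
    using trees(4)[OF T] rot_iso_monodromy[OF tree_table_plane_tree[OF S']] P' unfolding G(2)[symmetric] by blast
  ultimately show ?thesis using trees(1,2) unfolding mset len by blast
qed

lemma two_trees_same:
  assumes "\<exists>C1 C2. trees A B n = {C1, C2} \<and> C1 \<noteq> C2 \<and> (\<forall>T\<in>C1. P (monodromy_group T)) \<and> (\<forall>T\<in>C2. P (monodromy_group T))"
  shows "card (trees A B n) = 2 \<and> (\<forall>C\<in>trees A B n. \<forall>T\<in>C. P (monodromy_group T))"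
proof -
  obtain C1 C2 where C: "trees A B n = {C1, C2}" "C1 \<noteq> C2" "\<forall>T\<in>C1. P (monodromy_group T)" "\<forall>T\<in>C2. P (monodromy_group T)"
    using assms by blast
  then show ?thesis by simp
qed

lemma group_generated_sym: "group (subgroup_generated (sym_group n) Z)"
  by (rule group.group_subgroup_generated[OF sym_group_is_group])

lemma iso_transfer: "subgroup_generated (sym_group n) Z \<cong> G \<Longrightarrow> subgroup_generated (sym_group n) Z \<cong> H \<Longrightarrow> G \<cong> H"
  using group.iso_sym[OF group_generated_sym] iso_trans by blast

text \<open>Reflecting a tree inverts both permutations; if \<open>tab lb\<close> is an involution, only \<open>tab la\<close> changes.\<close>

lemma subgroup_generated_mirror:
  assumes "sort la = [1..<Suc n]" "sort lb = [1..<Suc n]" and inv: "comp_tab la' la = [1..<Suc n]" "length la' = n"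
  shows "subgroup_generated (sym_group n) {tab la', tab lb} = subgroup_generated (sym_group n) {tab la, tab lb}"
proof -
  interpret K: group "sym_group n" by (rule sym_group_is_group)
  have a: "tab la \<in> carrier (sym_group n)" and b: "tab lb \<in> carrier (sym_group n)"
    using tab_permutes[OF assms(1)] tab_permutes[OF assms(2)] by (simp_all only: sym_group_carrier)
  have len: "length la = n" using arg_cong[OF assms(1), of length] by simp
  have "tab la' \<circ> tab la = id"
    using tab_map_upt[of n id] inv len by (simp flip: tab_comp_tab)
  then have eq: "tab la' = inv\<^bsub>sym_group n\<^esub> (tab la)"
    using tab_permutes[OF assms(1)] unfolding sym_group_inv_equality[OF a]
    by (metis comp_assoc comp_id id_comp permutes_inv_o(1))
  have a': "tab la' \<in> carrier (sym_group n)" unfolding eq by (rule K.inv_closed[OF a])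
  have eq': "tab la = inv\<^bsub>sym_group n\<^esub> (tab la')" unfolding eq by (rule K.inv_inv[OF a, symmetric])
  have m: "tab la' \<in> generate (sym_group n) {tab la, tab lb}" unfolding eq by (rule generate.inv) simp
  have m': "tab la \<in> generate (sym_group n) {tab la', tab lb}" by (subst eq') (rule generate.inv, simp)
  have "generate (sym_group n) {tab la', tab lb} \<subseteq> generate (sym_group n) {tab la, tab lb}"
    by (rule K.generate_subgroup_incl[OF _ K.generate_is_subgroup]) (use a b m in \<open>auto intro: generate.incl\<close>)
  moreover have "generate (sym_group n) {tab la, tab lb} \<subseteq> generate (sym_group n) {tab la', tab lb}"
    by (rule K.generate_subgroup_incl[OF _ K.generate_is_subgroup]) (use a' b m' in \<open>auto intro: generate.incl\<close>)
  ultimately show ?thesis using a b a' by (simp add: subgroup_generated_def Int_absorb1 subset_antisym)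
qed

lemma monodromy1: "subgroup_generated (sym_group 7) {tab black_rot1, tab white_rot1} \<cong> (PSL :: (bit^3^3) set monoid)"
proof (rule PSL_3_2_tables[OF linear1(1) _ _ _ _ linear1(2) _ _ _ _ linear1(3-5)])
  show "det (of_columns3 1 4 6) = 1" "det (of_columns3 2 1 4) = 1"
    by (simp_all add: of_columns3_def det_3 dec3_def Finite_Cartesian_Product.transpose_def)
qed simp_all

lemma monodromy1': "subgroup_generated (sym_group 7) {tab black_rot1', tab white_rot1} \<cong> (PSL :: (bit^3^3) set monoid)"
  using monodromy1 subgroup_generated_mirror[OF linear1(3,4) mirrors(1)] by (simp add: black_rot1'_def)

lemma monodromy3: "is_some_semidirect_product (subgroup_generated (sym_group 9) {tab black_rot3, tab white_rot3})
    (PSL :: (gf8^2^2) set monoid) (integer_mod_group 3)"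
  by (rule PGammaL_2_8_tables[OF moebius3(1) _ moebius3(2-5)])
    (simp add: mat2_def det_2 uminus_gf8_def one_gf8_def)

lemma monodromy3': "is_some_semidirect_product (subgroup_generated (sym_group 9) {tab black_rot3', tab white_rot3})
    (PSL :: (gf8^2^2) set monoid) (integer_mod_group 3)"
  using monodromy3 subgroup_generated_mirror[OF moebius3(3,4) mirrors(2)] by (simp add: black_rot3'_def)

lemmas monodromy2 = alternating_table_group[OF alternating2] alternating_table_group[OF alternating2']
lemmas monodromy4 = block_table_Z2_Z2[OF blocks4, simplified] block_table_Z2[OF blocks4', simplified]
lemmas monodromy5 = pair_table_monodromy[OF pairs5] block_table_D8[OF blocks5', simplified]
lemmas monodromy6 = block_table_Z2[OF blocks6, simplified] block_table_Z2[OF blocks6', simplified]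

section \<open>The six passports\<close>

lemma trees1:
  "\<exists>C1 C2. trees {#3, 3, 1#} {#2, 2, 1, 1, 1#} 7 = {C1, C2} \<and> C1 \<noteq> C2 \<and>
    (\<forall>T\<in>C1. monodromy_group T \<cong> (PSL :: (bit^3^3) set monoid)) \<and>
    (\<forall>T\<in>C2. monodromy_group T \<cong> (PSL :: (bit^3^3) set monoid))"
proof (rule two_trees[OF tables1 covers1])
  show "length black_rot1 = 7" "length black_rot1' = 7"
    by (simp_all add: black_rot1_def black_rot1'_def)
  show "G \<cong> (PSL :: (bit^3^3) set monoid)" if "subgroup_generated (sym_group 7) {tab black_rot1, tab white_rot1} \<cong> G" for G :: "(nat \<Rightarrow> nat) monoid"
    by (rule iso_transfer[OF that monodromy1])
  show "G \<cong> (PSL :: (bit^3^3) set monoid)" if "subgroup_generated (sym_group 7) {tab black_rot1', tab white_rot1} \<cong> G" for G :: "(nat \<Rightarrow> nat) monoid"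
    by (rule iso_transfer[OF that monodromy1'])
qed (simp_all add: numeral_eq_Suc)

lemma trees2:
  "\<exists>C1 C2. trees {#3, 2, 2#} {#2, 2, 1, 1, 1#} 7 = {C1, C2} \<and> C1 \<noteq> C2 \<and>
    (\<forall>T\<in>C1. monodromy_group T \<cong> alt_group 7) \<and>
    (\<forall>T\<in>C2. monodromy_group T \<cong> alt_group 7)"
proof (rule two_trees[OF tables2 covers2])
  show "length black_rot2 = 7" "length black_rot2' = 7"
    by (simp_all add: black_rot2_def black_rot2'_def)
  show "G \<cong> alt_group 7" if "subgroup_generated (sym_group 7) {tab black_rot2, tab white_rot2} \<cong> G" for G :: "(nat \<Rightarrow> nat) monoid"
    using group.iso_sym[OF group_generated_sym that] by (simp only: monodromy2(1))
  show "G \<cong> alt_group 7" if "subgroup_generated (sym_group 7) {tab black_rot2', tab white_rot2'} \<cong> G" for G :: "(nat \<Rightarrow> nat) monoid"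
    using group.iso_sym[OF group_generated_sym that] by (simp only: monodromy2(2))
qed (simp_all add: numeral_eq_Suc)

lemma trees3:
  "\<exists>C1 C2. trees {#3, 3, 1, 1, 1#} {#2, 2, 2, 2, 1#} 9 = {C1, C2} \<and> C1 \<noteq> C2 \<and>
    (\<forall>T\<in>C1. is_some_semidirect_product (monodromy_group T) (PSL :: (gf8^2^2) set monoid) (integer_mod_group 3)) \<and>
    (\<forall>T\<in>C2. is_some_semidirect_product (monodromy_group T) (PSL :: (gf8^2^2) set monoid) (integer_mod_group 3))"
proof (rule two_trees[OF tables3 covers3])
  show "length black_rot3 = 9" "length black_rot3' = 9"
    by (simp_all add: black_rot3_def black_rot3'_def)
  show "is_some_semidirect_product (G) (PSL :: (gf8^2^2) set monoid) (integer_mod_group 3)" if "subgroup_generated (sym_group 9) {tab black_rot3, tab white_rot3} \<cong> G" for G :: "(nat \<Rightarrow> nat) monoid"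
    by (rule is_some_semidirect_product_cong[OF that group_generated_sym monodromy3])
  show "is_some_semidirect_product (G) (PSL :: (gf8^2^2) set monoid) (integer_mod_group 3)" if "subgroup_generated (sym_group 9) {tab black_rot3', tab white_rot3} \<cong> G" for G :: "(nat \<Rightarrow> nat) monoid"
    by (rule is_some_semidirect_product_cong[OF that group_generated_sym monodromy3'])
qed (simp_all add: numeral_eq_Suc)

lemma trees4:
  "\<exists>C1 C2. trees {#3, 2, 2, 1, 1, 1#} (replicate_mset 5 2) 10 = {C1, C2} \<and> C1 \<noteq> C2 \<and>
    (\<forall>T\<in>C1. is_some_semidirect_product (monodromy_group T) (alt_group 5 \<times>\<times> alt_group 5) (integer_mod_group 2 \<times>\<times> integer_mod_group 2)) \<and>
    (\<forall>T\<in>C2. is_some_semidirect_product (monodromy_group T) (alt_group 5 \<times>\<times> alt_group 5) (integer_mod_group 2))"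
proof (rule two_trees[OF tables4 covers4])
  show "length black_rot4 = 10" "length black_rot4' = 10"
    by (simp_all add: black_rot4_def black_rot4'_def)
  show "is_some_semidirect_product (G) (alt_group 5 \<times>\<times> alt_group 5) (integer_mod_group 2 \<times>\<times> integer_mod_group 2)" if "subgroup_generated (sym_group 10) {tab black_rot4, tab white_rot4} \<cong> G" for G :: "(nat \<Rightarrow> nat) monoid"
    by (rule is_some_semidirect_product_cong[OF that group_generated_sym monodromy4(1)])
  show "is_some_semidirect_product (G) (alt_group 5 \<times>\<times> alt_group 5) (integer_mod_group 2)" if "subgroup_generated (sym_group 10) {tab black_rot4', tab white_rot4} \<cong> G" for G :: "(nat \<Rightarrow> nat) monoid"
    by (rule is_some_semidirect_product_cong[OF that group_generated_sym monodromy4(2)])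
qed (simp_all add: numeral_eq_Suc)

lemma trees5:
  "\<exists>C1 C2. trees (replicate_mset 3 4 + replicate_mset 8 1) (replicate_mset 10 2) 20 = {C1, C2} \<and> C1 \<noteq> C2 \<and>
    (\<forall>T\<in>C1. \<exists>\<theta>\<in>hom (dihedral_group 4) (AutoGroup (alt_group 5 \<times>\<times> alt_group 5)). is_some_semidirect_product (monodromy_group T) (product_group {1..8::nat} (\<lambda>_. integer_mod_group 2)) (semidirect_product (alt_group 5 \<times>\<times> alt_group 5) (dihedral_group 4) \<theta>)) \<and>
    (\<forall>T\<in>C2. is_some_semidirect_product (monodromy_group T) (alt_group 10 \<times>\<times> alt_group 10) (dihedral_group 4))"
proof (rule two_trees[OF tables5 covers5])
  show "length black_rot5 = 20" "length black_rot5' = 20"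
    by (simp_all add: black_rot5_def black_rot5'_def)
  show "\<exists>\<theta>\<in>hom (dihedral_group 4) (AutoGroup (alt_group 5 \<times>\<times> alt_group 5)). is_some_semidirect_product (G) (product_group {1..8::nat} (\<lambda>_. integer_mod_group 2)) (semidirect_product (alt_group 5 \<times>\<times> alt_group 5) (dihedral_group 4) \<theta>)" if "subgroup_generated (sym_group 20) {tab black_rot5, tab white_rot5} \<cong> G" for G :: "(nat \<Rightarrow> nat) monoid"
    using monodromy5(1) is_some_semidirect_product_cong[OF that group_generated_sym] by blast
  show "is_some_semidirect_product (G) (alt_group 10 \<times>\<times> alt_group 10) (dihedral_group 4)" if "subgroup_generated (sym_group 20) {tab black_rot5', tab white_rot5'} \<cong> G" for G :: "(nat \<Rightarrow> nat) monoid"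
    by (rule is_some_semidirect_product_cong[OF that group_generated_sym monodromy5(2)])
qed (simp_all add: numeral_eq_Suc)

lemma trees6:
  "\<exists>C1 C2. trees (replicate_mset 3 5 + replicate_mset 11 1) (replicate_mset 13 2) 26 = {C1, C2} \<and> C1 \<noteq> C2 \<and>
    (\<forall>T\<in>C1. is_some_semidirect_product (monodromy_group T) (alt_group 13 \<times>\<times> alt_group 13) (integer_mod_group 2)) \<and>
    (\<forall>T\<in>C2. is_some_semidirect_product (monodromy_group T) (alt_group 13 \<times>\<times> alt_group 13) (integer_mod_group 2))"
proof (rule two_trees[OF tables6 covers6])
  show "length black_rot6 = 26" "length black_rot6' = 26"
    by (simp_all add: black_rot6_def black_rot6'_def)
  show "is_some_semidirect_product (G) (alt_group 13 \<times>\<times> alt_group 13) (integer_mod_group 2)" if "subgroup_generated (sym_group 26) {tab black_rot6, tab white_rot6} \<cong> G" for G :: "(nat \<Rightarrow> nat) monoid"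
    by (rule is_some_semidirect_product_cong[OF that group_generated_sym monodromy6(1)])
  show "is_some_semidirect_product (G) (alt_group 13 \<times>\<times> alt_group 13) (integer_mod_group 2)" if "subgroup_generated (sym_group 26) {tab black_rot6', tab white_rot6} \<cong> G" for G :: "(nat \<Rightarrow> nat) monoid"
    by (rule is_some_semidirect_product_cong[OF that group_generated_sym monodromy6(2)])
qed (simp_all add: numeral_eq_Suc)

theorem lemma9p5:
  shows
    "(card (trees {#3, 3, 1#} {#2, 2, 1, 1, 1#} 7) = 2 \<and>
      (\<forall>C\<in>trees {#3, 3, 1#} {#2, 2, 1, 1, 1#} 7. \<forall>T\<in>C.
         monodromy_group T \<cong> (PSL :: (bit ^ 3 ^ 3) set monoid)))
   \<and> (card (trees {#3, 2, 2#} {#2, 2, 1, 1, 1#} 7) = 2 \<and>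
      (\<forall>C\<in>trees {#3, 2, 2#} {#2, 2, 1, 1, 1#} 7. \<forall>T\<in>C.
         monodromy_group T \<cong> alt_group 7))
   \<and> (card (trees {#3, 3, 1, 1, 1#} {#2, 2, 2, 2, 1#} 9) = 2 \<and>
      (\<forall>C\<in>trees {#3, 3, 1, 1, 1#} {#2, 2, 2, 2, 1#} 9. \<forall>T\<in>C.
         is_some_semidirect_product (monodromy_group T)
           (PSL :: (gf8 ^ 2 ^ 2) set monoid) (integer_mod_group 3)))
   \<and> (\<exists>C1 C2. trees {#3, 2, 2, 1, 1, 1#} (replicate_mset 5 2) 10 = {C1, C2} \<and> C1 \<noteq> C2 \<and>
      (\<forall>T\<in>C1. is_some_semidirect_product (monodromy_group T)
         (alt_group 5 \<times>\<times> alt_group 5) (integer_mod_group 2 \<times>\<times> integer_mod_group 2)) \<and>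
      (\<forall>T\<in>C2. is_some_semidirect_product (monodromy_group T)
         (alt_group 5 \<times>\<times> alt_group 5) (integer_mod_group 2)))
   \<and> (\<exists>C1 C2. trees (replicate_mset 3 4 + replicate_mset 8 1) (replicate_mset 10 2) 20 = {C1, C2} \<and>
      C1 \<noteq> C2 \<and>
      (\<forall>T\<in>C1. \<exists>\<theta>\<in>hom (dihedral_group 4) (AutoGroup (alt_group 5 \<times>\<times> alt_group 5)).
         is_some_semidirect_product (monodromy_group T)
           (product_group {1..8::nat} (\<lambda>_. integer_mod_group 2))
           (semidirect_product (alt_group 5 \<times>\<times> alt_group 5) (dihedral_group 4) \<theta>)) \<and>
      (\<forall>T\<in>C2. is_some_semidirect_product (monodromy_group T)
         (alt_group 10 \<times>\<times> alt_group 10) (dihedral_group 4)))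
   \<and> (card (trees (replicate_mset 3 5 + replicate_mset 11 1) (replicate_mset 13 2) 26) = 2 \<and>
      (\<forall>C\<in>trees (replicate_mset 3 5 + replicate_mset 11 1) (replicate_mset 13 2) 26. \<forall>T\<in>C.
         is_some_semidirect_product (monodromy_group T)
           (alt_group 13 \<times>\<times> alt_group 13) (integer_mod_group 2)))"
  using two_trees_same[OF trees1] two_trees_same[OF trees2] two_trees_same[OF trees3] trees4 trees5 two_trees_same[OF trees6]
  by (intro conjI) (assumption | elim conjE)+

end
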